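(* Let $(K,\ast_K)$ be a commutative hypergroup with identity $e$, with Haar measure $\lambda$, and with a quasi-metric $\rho$ on $K$, and let $N>0$ and $A>0$ be constants such that $\lambda(B(e,s))=A s^N$ for all $s>0$, where $B(e,s)=\{y\in K:\rho(e,y)<s\}$. Assume that $1<p<\infty$, $0<\alpha<\frac Np$, and let $r$ be defined by $\frac1r=\frac1p-\frac\alpha N$. If $f\in L^{p}(K,\lambda)$, then $I_\alpha f\in L^{r}(K,\lambda)$ and $$\|I_\alpha f\|_{K,r}\le C\,\|f\|_{K,p},\qquad C=\frac{3pr}{p-1}\left(\frac pr\right)^{\frac1p-\frac1r}\frac{N}{\alpha}\,A^{\frac{N-\alpha}{N}}.$$
   Context: A hypergroup $(K,\ast_K)$ is a locally compact Hausdorff space $K$ together with a bilinear, associative, weakly continuous convolution $\ast_K$ on the Banach space of all bounded regular Borel measures on $K$ such that: (1) for all $x,y\in K$, $\delta_x\ast_K\delta_y$ (convolution of point measures) is a probability measure with compact support; (2) the map $(x,y)\mapsto \operatorname{supp}(\delta_x\ast_K\delta_y)$ from $K\times K$ to the space $\mathcal C(K)$ of nonvoid compact subsets of $K$ is continuous, where $\mathcal C(K)$ carries the Michael topology generated by the sets $U_{V,W}=\{L\in\mathcal C(K): L\cap V\ne\varnothing,\ L\subset W\}$ with $V,W$ open in $K$; (3) there is an identity $e\in K$ with $\delta_e\ast_K\delta_x=\delta_x\ast_K\delta_e=\delta_x$ for all $x\in K$; (4) there is a continuous involution $x\mapsto x^{\sim}$ on $K$ such that $(\delta_x\ast_K\delta_y)^{\sim}=\delta_{y^\sim}\ast_K\delta_{x^\sim}$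 (where $\mu^\sim$ is the image of $\mu$ under the involution), and $e\in\operatorname{supp}(\delta_x\ast_K\delta_y)$ if and only if $x=y^\sim$. The hypergroup is commutative if $\delta_x\ast_K\delta_y=\delta_y\ast_K\delta_x$ for all $x,y\in K$. Generalized translation: $T^xf(y)=\int_K f\,d(\delta_x\ast_K\delta_y)$ for $x,y\in K$. Every commutative hypergroup has a Haar measure $\lambda$, i.e. a (nonzero, positive, Radon) measure with $\int_K T^xf(y)\,d\lambda(y)=\int_K f(y)\,d\lambda(y)$ for all $x\in K$ and Borel measurable $f$ (for which the integrals make sense). A quasi-metric on $K$ is a function $\rho:K\times K\to[0,\infty)$ such that $\rho(x,y)=0\Leftrightarrow x=y$; $\rho(x,y)=\rho(y,x)$; and there is a constant $c\ge1$ with $\rho(x,y)\le c(\rho(x,z)+\rho(z,y))$ for all $x,y,z\in K$. The hypothesis on $\lambda(B(e,s))$ includes that these balls are $\lambda$-measurable. Fractional integral (Riesz potential), for $0<\alpha<N$: $I_\alpha f(x)=\int_K \left(T^x g\right)(y)\,f(y^\sim)\,d\lambda(y)$, where $g(y)=\rho(e,y)^{\alpha-N}$ (with the convention $0^{\alpha-N}=+\infty$). For $1\le p<\infty$, $L^p(K,\lambda)$ is the space of $\lambda$-measurable $f$ on $K$ with $\|f\|_{K,p}=\left(\int_K|f(x)|^p\,d\lambda(x)\right)^{1/p}<\infty$. *)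

theory Defs
  imports "HOL-Analysis.Analysis"
begin

section \<open>Bounded regular Borel measures\<close>

text \<open>
  A complex Borel measure is a countably additive function from the Borel sets to the complex
  numbers (hence automatically bounded).  It is extended by 0 to the sets that are not Borel, so
  that equality of measures is equality of functions.
\<close>

definition complex_borel_measure :: "('a::topological_space set \<Rightarrow> complex) \<Rightarrow> bool" where
  "complex_borel_measure \<mu> \<longleftrightarrow>
     (\<forall>E. E \<notin> sets borel \<longrightarrow> \<mu> E = 0) \<and>
     (\<forall>E :: nat \<Rightarrow> 'a set. range E \<subseteq> sets borel \<longrightarrow> disjoint_family E \<longrightarrow>
        (\<lambda>i. \<mu> (E i)) sums \<mu> (\<Union>i. E i))"

definition total_variation ::
    "('a::topological_space set \<Rightarrow> complex) \<Rightarrow> 'a set \<Rightarrow> ennreal" where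
  "total_variation \<mu> E =
     (SUP P \<in> {P. finite P \<and> P \<subseteq> sets borel \<and> disjoint P \<and> \<Union>P \<subseteq> E}.
        \<Sum>F\<in>P. ennreal (norm (\<mu> F)))"

definition bounded_regular_measures :: "('a::topological_space set \<Rightarrow> complex) set" where
  "bounded_regular_measures =
     {\<mu>. complex_borel_measure \<mu> \<and>
        (\<forall>E \<in> sets borel. \<forall>\<epsilon>>0. \<exists>C U. compact C \<and> open U \<and> C \<subseteq> E \<and> E \<subseteq> U \<and>
           total_variation \<mu> (U - C) < ennreal \<epsilon>)}"

definition positive_measures :: "('a::topological_space set \<Rightarrow> complex) set" where
  "positive_measures = {\<mu> \<in> bounded_regular_measures. \<forall>E. \<mu> E \<in> \<real>\<^sub>\<ge>\<^sub>0}"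

definition probability_measures :: "('a::topological_space set \<Rightarrow> complex) set" where
  "probability_measures = {\<mu> \<in> positive_measures. \<mu> UNIV = 1}"

definition point_measure :: "'a::topological_space \<Rightarrow> 'a set \<Rightarrow> complex" where
  "point_measure x E = (if E \<in> sets borel \<and> x \<in> E then 1 else 0)"

definition image_measure ::
    "('a::topological_space \<Rightarrow> 'a) \<Rightarrow> ('a set \<Rightarrow> complex) \<Rightarrow> 'a set \<Rightarrow> complex" where
  "image_measure h \<mu> E = (if E \<in> sets borel then \<mu> (h -` E) else 0)"

definition measure_support :: "('a::topological_space set \<Rightarrow> complex) \<Rightarrow> 'a set" where
  "measure_support \<mu> = {x. \<forall>U. open U \<longrightarrow> x \<in> U \<longrightarrow> total_variation \<mu> U \<noteq> 0}"

text \<open>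
  The positive part of a real-valued countably additive set function, in the form
  given by the Hahn decomposition: $\nu^+(E) = \sup \{\nu(F) : F \subseteq E\}$.  Since
  \<^const>\<open>ennreal\<close> sends negative numbers to 0 and the empty set is admissible, the
  supremum below is this one.  On a positive measure it is the identity.
\<close>

definition positive_part :: "('a::topological_space set \<Rightarrow> real) \<Rightarrow> 'a measure" where
  "positive_part \<nu> =
     measure_of UNIV (sets borel) (\<lambda>E. SUP F \<in> {F \<in> sets borel. F \<subseteq> E}. ennreal (\<nu> F))"

text \<open>The integral of a bounded function, via the Jordan decompositions of the real and
  imaginary parts of the measure.\<close>

definition cm_integral ::
    "('a::topological_space set \<Rightarrow> complex) \<Rightarrow> ('a \<Rightarrow> complex) \<Rightarrow> complex" where
  "cm_integral \<mu> f =
     ((LINT x|positive_part (\<lambda>E. Re (\<mu> E)). f x) - (LINT x|positive_part (\<lambda>E. - Re (\<mu> E)). f x)) +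
     \<i> * ((LINT x|positive_part (\<lambda>E. Im (\<mu> E)). f x) - (LINT x|positive_part (\<lambda>E. - Im (\<mu> E)). f x))"

text \<open>The weak topology on the bounded regular measures induced by the bounded continuous
  functions.\<close>

definition weak_topology :: "('a::topological_space set \<Rightarrow> complex) topology" where
  "weak_topology = topology_generated_by
     {{\<mu> \<in> bounded_regular_measures. cm_integral \<mu> f \<in> G} | f G.
        continuous_on UNIV f \<and> bounded (range f) \<and> open G}"

definition michael_topology :: "'a::topological_space set topology" where
  "michael_topology = topology_generated_by
     {{L. compact L \<and> L \<noteq> {} \<and> L \<inter> V \<noteq> {} \<and> L \<subseteq> W} | V W. open V \<and> open W}"


section \<open>Hypergroups\<close>

text \<open>
  The underlying space is the whole type \<^typ>\<open>'a\<close>.  The convolution is only constrained on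
  bounded regular measures.  Weak continuity of the convolution is meant in the usual sense of
  the theory of hypergroups: joint continuity, for the weak topology, on pairs of positive
  measures.  (Joint weak continuity on all pairs of complex measures already fails for the
  convolution of the additive group of the reals.)
\<close>

locale hypergroup =
  fixes conv :: "('a::t2_space set \<Rightarrow> complex) \<Rightarrow> ('a set \<Rightarrow> complex) \<Rightarrow> ('a set \<Rightarrow> complex)"
    and e :: 'a
    and invol :: "'a \<Rightarrow> 'a"
  assumes locally_compact: "locally compact (UNIV :: 'a set)"
    and conv_closed:
      "\<And>\<mu> \<nu>. \<mu> \<in> bounded_regular_measures \<Longrightarrow> \<nu> \<in> bounded_regular_measures \<Longrightarrow>
         conv \<mu> \<nu> \<in> bounded_regular_measures"
    and conv_linear_left:
      "\<And>\<mu> \<mu>' \<nu> a b. \<mu> \<in> bounded_regular_measures \<Longrightarrow> \<mu>' \<in> bounded_regular_measures \<Longrightarrow>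
         \<nu> \<in> bounded_regular_measures \<Longrightarrow>
         conv (\<lambda>E. a * \<mu> E + b * \<mu>' E) \<nu> = (\<lambda>E. a * conv \<mu> \<nu> E + b * conv \<mu>' \<nu> E)"
    and conv_linear_right:
      "\<And>\<mu> \<nu> \<nu>' a b. \<mu> \<in> bounded_regular_measures \<Longrightarrow> \<nu> \<in> bounded_regular_measures \<Longrightarrow>
         \<nu>' \<in> bounded_regular_measures \<Longrightarrow>
         conv \<mu> (\<lambda>E. a * \<nu> E + b * \<nu>' E) = (\<lambda>E. a * conv \<mu> \<nu> E + b * conv \<mu> \<nu>' E)"
    and conv_assoc:
      "\<And>\<mu> \<nu> \<kappa>. \<mu> \<in> bounded_regular_measures \<Longrightarrow> \<nu> \<in> bounded_regular_measures \<Longrightarrow>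
         \<kappa> \<in> bounded_regular_measures \<Longrightarrow> conv (conv \<mu> \<nu>) \<kappa> = conv \<mu> (conv \<nu> \<kappa>)"
    and conv_weakly_continuous:
      "continuous_map
         (prod_topology (subtopology weak_topology positive_measures)
                        (subtopology weak_topology positive_measures))
         weak_topology (\<lambda>(\<mu>, \<nu>). conv \<mu> \<nu>)"
    and point_conv_probability:
      "\<And>x y. conv (point_measure x) (point_measure y) \<in> probability_measures"
    and point_conv_compact_support:
      "\<And>x y. compact (measure_support (conv (point_measure x) (point_measure y)))"
    and support_continuous:
      "continuous_map (euclidean :: ('a \<times> 'a) topology) michael_topology
         (\<lambda>(x, y). measure_support (conv (point_measure x) (point_measure y)))"
    and conv_identity_left: "\<And>x. conv (point_measure e) (point_measure x) = point_measure x"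
    and conv_identity_right: "\<And>x. conv (point_measure x) (point_measure e) = point_measure x"
    and invol_continuous: "continuous_on UNIV invol"
    and invol_invol: "\<And>x. invol (invol x) = x"
    and invol_conv:
      "\<And>x y. image_measure invol (conv (point_measure x) (point_measure y)) =
         conv (point_measure (invol y)) (point_measure (invol x))"
    and identity_in_support_iff:
      "\<And>x y. e \<in> measure_support (conv (point_measure x) (point_measure y)) \<longleftrightarrow> x = invol y"

locale commutative_hypergroup = hypergroup +
  assumes point_conv_commute:
    "\<And>x y. conv (point_measure x) (point_measure y) = conv (point_measure y) (point_measure x)"

text \<open>
  The generalized translation $T^x f(y)$ of a function with values in $[0,\infty]$.  The integral
  \<^const>\<open>nn_integral\<close> is also defined for functions that are not Borel; it agrees with the
  integral over the completion of the measure.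
\<close>

definition translation ::
    "(('a::topological_space set \<Rightarrow> complex) \<Rightarrow> ('a set \<Rightarrow> complex) \<Rightarrow> ('a set \<Rightarrow> complex)) \<Rightarrow>
      'a \<Rightarrow> ('a \<Rightarrow> ennreal) \<Rightarrow> 'a \<Rightarrow> ennreal" where
  "translation conv x f y =
     (\<integral>\<^sup>+z. f z \<partial>measure_of UNIV (sets borel)
        (\<lambda>E. ennreal (Re (conv (point_measure x) (point_measure y) E))))"

definition radon_measure :: "'a::topological_space measure \<Rightarrow> bool" where
  "radon_measure M \<longleftrightarrow>
     sets M = sets borel \<and>
     (\<forall>C. compact C \<longrightarrow> emeasure M C < \<infinity>) \<and>
     (\<forall>E \<in> sets borel. emeasure M E = (INF U \<in> {U. open U \<and> E \<subseteq> U}. emeasure M U)) \<and>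
     (\<forall>U. open U \<longrightarrow> emeasure M U = (SUP C \<in> {C. compact C \<and> C \<subseteq> U}. emeasure M C))"

text \<open>
  Invariance is stated for nonnegative Borel functions; for integrable functions it follows by
  splitting into positive and negative (real and imaginary) parts.
\<close>

definition haar_measure ::
    "(('a::topological_space set \<Rightarrow> complex) \<Rightarrow> ('a set \<Rightarrow> complex) \<Rightarrow> ('a set \<Rightarrow> complex)) \<Rightarrow>
      'a measure \<Rightarrow> bool" where
  "haar_measure conv M \<longleftrightarrow>
     radon_measure M \<and> emeasure M UNIV \<noteq> 0 \<and>
     (\<forall>x. \<forall>f \<in> borel_measurable borel.
        (\<integral>\<^sup>+y. translation conv x f y \<partial>M) = (\<integral>\<^sup>+y. f y \<partial>M))"


section \<open>Quasi-metrics, Lebesgue spaces and fractional integrals\<close>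

definition quasi_metric :: "('a \<Rightarrow> 'a \<Rightarrow> real) \<Rightarrow> bool" where
  "quasi_metric \<rho> \<longleftrightarrow>
     (\<forall>x y. 0 \<le> \<rho> x y) \<and>
     (\<forall>x y. \<rho> x y = 0 \<longleftrightarrow> x = y) \<and>
     (\<forall>x y. \<rho> x y = \<rho> y x) \<and>
     (\<exists>c\<ge>1. \<forall>x y z. \<rho> x y \<le> c * (\<rho> x z + \<rho> z y))"

definition quasi_ball :: "('a \<Rightarrow> 'a \<Rightarrow> real) \<Rightarrow> 'a \<Rightarrow> real \<Rightarrow> 'a set" where
  "quasi_ball \<rho> x s = {y. \<rho> x y < s}"

text \<open>Measurability with respect to a Borel measure \<open>M\<close> means measurability with respect to its
  completion.\<close>

definition Lp_space :: "real \<Rightarrow> 'a measure \<Rightarrow> ('a \<Rightarrow> complex) set" where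
  "Lp_space p M = {f \<in> borel_measurable (completion M).
     (\<integral>\<^sup>+x. ennreal (norm (f x) powr p) \<partial>completion M) < \<infinity>}"

definition Lp_norm :: "real \<Rightarrow> 'a measure \<Rightarrow> ('a \<Rightarrow> complex) \<Rightarrow> real" where
  "Lp_norm p M f = (LINT x|completion M. norm (f x) powr p) powr (1 / p)"

text \<open>The separate case is the convention $0^{\alpha-N} = \infty$; in Isabelle
  \<^term>\<open>0 powr a = (0::real)\<close>.\<close>

definition riesz_kernel :: "('a \<Rightarrow> 'a \<Rightarrow> real) \<Rightarrow> 'a \<Rightarrow> real \<Rightarrow> real \<Rightarrow> 'a \<Rightarrow> ennreal" where
  "riesz_kernel \<rho> e N \<alpha> y = (if \<rho> e y = 0 then \<infinity> else ennreal (\<rho> e y powr (\<alpha> - N)))"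

text \<open>
  The fractional integral is defined at \<open>x\<close> if its integral converges absolutely,
  where absolute convergence is expressed with the kernel taken in $[0,\infty]$.
  Elsewhere the value of \<open>fractional_integral\<close> has no meaning.
\<close>

definition fractional_integral_defined ::
    "(('a::topological_space set \<Rightarrow> complex) \<Rightarrow> ('a set \<Rightarrow> complex) \<Rightarrow> ('a set \<Rightarrow> complex)) \<Rightarrow>
      'a \<Rightarrow> ('a \<Rightarrow> 'a) \<Rightarrow> 'a measure \<Rightarrow> ('a \<Rightarrow> 'a \<Rightarrow> real) \<Rightarrow> real \<Rightarrow> real \<Rightarrow>
      ('a \<Rightarrow> complex) \<Rightarrow> 'a \<Rightarrow> bool" where
  "fractional_integral_defined conv e invol M \<rho> N \<alpha> f x \<longleftrightarrow>
     (\<lambda>y. translation conv x (riesz_kernel \<rho> e N \<alpha>) y) \<in> borel_measurable (completion M) \<and>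
     (\<lambda>y. f (invol y)) \<in> borel_measurable (completion M) \<and>
     (\<integral>\<^sup>+y. translation conv x (riesz_kernel \<rho> e N \<alpha>) y * ennreal (norm (f (invol y)))
        \<partial>completion M) < \<infinity>"

definition fractional_integral ::
    "(('a::topological_space set \<Rightarrow> complex) \<Rightarrow> ('a set \<Rightarrow> complex) \<Rightarrow> ('a set \<Rightarrow> complex)) \<Rightarrow>
      'a \<Rightarrow> ('a \<Rightarrow> 'a) \<Rightarrow> 'a measure \<Rightarrow> ('a \<Rightarrow> 'a \<Rightarrow> real) \<Rightarrow> real \<Rightarrow> real \<Rightarrow>
      ('a \<Rightarrow> complex) \<Rightarrow> 'a \<Rightarrow> complex" where
  "fractional_integral conv e invol M \<rho> N \<alpha> f x =
     (LINT y|completion M.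
        complex_of_real (enn2real (translation conv x (riesz_kernel \<rho> e N \<alpha>) y)) * f (invol y))"

end

theory Submission
  imports Defs
begin

text \<open>
  Write $g$ for the Riesz kernel, $\theta = \alpha/N$ and $q = N/(N-\alpha)$.  The ball condition says
  $\lambda\{g > t\} = A t^{-q}$; splitting $g$ at a height depending on $\lambda(E)$, invariance of the Haar
  measure gives $\int_E T^x g \, d\lambda \leq D \lambda(E)^\theta$ for all $x$ and $E$, where
  $D = (N/\alpha) A^{1/q}$.  By commutativity $T^x g(y)$ is symmetric in $x$ and $y$, so it is a kernel of weak type
  in both variables.  For such a kernel $k$ and $\|F\|_p \leq 1$, $\|H\|_{r'} \leq 1$, the bilinear form
  $\int\int H(x) k(x,y) F(y)$ is estimated, as in the proof of the Hardy-Littlewood-Sobolev inequality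
  by Lieb and Loss, by separating the regions $F^p \leq H^{r'}$ and $F^p > H^{r'}$ and using the level sets of the
  smaller factor; duality yields the $L^r$ bound, with a constant better than the required one.

  The reduction needs that $f(y^\sim)$ has the same $L^p$ norm as $f$, that is $\lambda(E^\sim) = \lambda(E)$, and that
  $T^x g(y)$ can be integrated in either order.  As the space need not be second countable, open subsets of the
  square need not lie in the product $\sigma$-algebra, but up to sets with almost all sections null they are countable
  unions of rectangles; this suffices because $(x, y) \mapsto (\delta_x * \delta_y)(U)$ is lower semicontinuous for
  open $U$.
\<close>

section \<open>Integral operators with kernels of weak type\<close>

text \<open>Nothing ties \<open>\<rho>\<close> to the topology of K: its balls are measurable for
  the completion only and need not be open. So sigma-finiteness is extracted from the balls around
  \<open>e\<close> by outer regularity, and the Riesz kernel is replaced by an a.e. equal Borel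
  function. Translation respects a.e. equality, because the masses that the point convolutions give
  to a null set integrate to zero. Weak continuity is given on positive measures only. To exploit
  associativity, integrals against a convolution with a point mass are computed for finite sums of
  point masses first, and these are weakly dense among positive measures. What comes out is a
  symmetry of supports, and that is the source of the invariance of \<open>haar\<close> under the
  involution. The L^r norm of the potential is not known to be finite in advance, so duality is
  applied to truncations. With p' = p/(p-1) and X = (r/p)^(1-\<theta>), the two halves of the
  bilinear form contribute X and at most p', up to the common factor D; the stated constant is D
  times 3 p p' X.\<close>

lemma nn_integral_powr_from_0:
  fixes a c :: real
  assumes "a > -1" "c \<ge> 0"
  shows "(\<integral>\<^sup>+t. ennreal (t powr a) * indicator {0<..<c} t \<partial>lborel) = ennreal (c powr (a + 1) / (a + 1))"
proof -
  have "(\<integral>\<^sup>+t. ennreal (t powr a) * indicator {0<..<c} t \<partial>lborel)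
      = (\<integral>\<^sup>+t. ennreal (t powr a) * indicator {0..c} t \<partial>lborel)"
    by (rule nn_integral_cong_AE, use AE_lborel_singleton[of 0] AE_lborel_singleton[of c] in eventually_elim)
      (auto simp: indicator_def)
  also have "\<dots> = ennreal (c powr (a + 1) / (a + 1))"
    by (rule nn_integral_has_integral_lebesgue'[OF _ has_integral_powr_from_0]) (use assms in auto)
  finally show ?thesis .
qed

text \<open>Tonelli in y and t. The weight \<open>w\<close> decides which function of
  \<open>F\<close> is represented: p t^(p-1) gives F^p, the indicator of (0,c) gives the truncation
  of \<open>F\<close> at c. The density \<open>K\<close> is carried along so that a kernel can be
  integrated over level sets.\<close>

lemma (in sigma_finite_measure) nn_integral_layer_cake:
  fixes K :: "'a \<Rightarrow> ennreal" and F :: "'a \<Rightarrow> real" and w :: "real \<Rightarrow> ennreal"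
  assumes [measurable]: "K \<in> borel_measurable M" "F \<in> borel_measurable M" "w \<in> borel_measurable borel"
  shows "(\<integral>\<^sup>+y. K y * (\<integral>\<^sup>+t. w t * indicator {0<..<F y} t \<partial>lborel) \<partial>M)
    = (\<integral>\<^sup>+t. w t * indicator {0<..} t * (\<integral>\<^sup>+y. K y * indicator {z \<in> space M. t < F z} y \<partial>M) \<partial>lborel)"
proof -
  interpret L: pair_sigma_finite M lborel ..
  have "(\<integral>\<^sup>+y. K y * (\<integral>\<^sup>+t. w t * indicator {0<..<F y} t \<partial>lborel) \<partial>M)
      = (\<integral>\<^sup>+y. (\<integral>\<^sup>+t. K y * (w t * (if 0 < t \<and> t < F y then 1 else 0)) \<partial>lborel) \<partial>M)"
    by (intro nn_integral_cong) (auto simp: nn_integral_cmult[symmetric] indicator_def intro!: nn_integral_cong)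
  also have "\<dots> = (\<integral>\<^sup>+t. (\<integral>\<^sup>+y. K y * (w t * (if 0 < t \<and> t < F y then 1 else 0)) \<partial>M) \<partial>lborel)"
    by (rule L.Fubini'[symmetric]) measurable
  also have "\<dots> = (\<integral>\<^sup>+t. w t * indicator {0<..} t * (\<integral>\<^sup>+y. K y * indicator {z \<in> space M. t < F z} y \<partial>M) \<partial>lborel)"
    by (intro nn_integral_cong) (auto simp: nn_integral_cmult[symmetric] indicator_def mult_ac intro!: nn_integral_cong)
  finally show ?thesis .
qed

lemma (in sigma_finite_measure) nn_integral_level_sets_powr:
  fixes F :: "'a \<Rightarrow> real"
  assumes [measurable]: "F \<in> borel_measurable M" and nn: "\<And>y. 0 \<le> F y" and p: "p > 0"
  shows "(\<integral>\<^sup>+t. ennreal (p * t powr (p - 1)) * indicator {0<..} t * emeasure M {z \<in> space M. t < F z} \<partial>lborel)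
    = (\<integral>\<^sup>+y. ennreal (F y powr p) \<partial>M)"
proof -
  have "(\<integral>\<^sup>+t. ennreal (p * t powr (p - 1)) * indicator {0<..<F y} t \<partial>lborel) = ennreal (F y powr p)" for y
    using nn_integral_powr_from_0[of "p - 1" "F y"] p nn[of y]
    by (simp add: ennreal_mult mult.assoc nn_integral_cmult) (simp flip: ennreal_mult)
  then show ?thesis
    using nn_integral_layer_cake[of "\<lambda>_. 1" F "\<lambda>t. ennreal (p * t powr (p - 1))"] by simp
qed

text \<open>Weighted arithmetic-geometric mean inequality for a product in which the powers of
  \<open>t\<close> and \<open>\<tau>\<close> cancel. For \<open>v\<close> the distribution function
  of some F, the first term integrates to a multiple of the integral of F^p, and the power of
  \<open>t\<close> in the second is integrable at 0 when p\<theta> < 1. \<open>\<tau>\<close> stays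
  free for balancing the two.\<close>

lemma Young_powr_weighted:
  fixes v t p \<theta> \<tau> :: real
  assumes "v \<ge> 0" "t > 0" "\<tau> > 0" "0 < \<theta>" "\<theta> < 1"
  shows "v powr \<theta> \<le> \<theta> * \<tau> * (v * t powr (p - 1))
      + (1 - \<theta>) * \<tau> powr (- \<theta> / (1 - \<theta>)) * t powr (- ((p - 1) * \<theta> / (1 - \<theta>)))"
proof (cases "v = 0")
  case True
  then show ?thesis using assms by simp
next
  case False
  define a where "a = \<tau> * v * t powr (p - 1)"
  define b where "b = \<tau> powr (- \<theta> / (1 - \<theta>)) * t powr (- ((p - 1) * \<theta> / (1 - \<theta>)))"
  have "v > 0" using False assms by simp
  have "a powr \<theta> * b powr (1 - \<theta>) = v powr \<theta>"
  proof -
    have "a powr \<theta> = \<tau> powr \<theta> * v powr \<theta> * t powr ((p - 1) * \<theta>)"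
      using assms by (simp add: a_def powr_mult powr_powr)
    moreover have "b powr (1 - \<theta>) = \<tau> powr (- \<theta>) * t powr (- ((p - 1) * \<theta>))"
      using assms by (simp add: b_def powr_mult powr_powr)
    moreover have "\<tau> powr \<theta> * \<tau> powr (- \<theta>) = 1" "t powr ((p - 1) * \<theta>) * t powr (- ((p - 1) * \<theta>)) = 1"
      using assms by (simp_all only: powr_add[symmetric]) auto
    ultimately show ?thesis
      by (metis (no_types, lifting) mult.assoc mult.commute mult.right_neutral)
  qed
  moreover have "a > 0" "b > 0" using assms \<open>v > 0\<close> by (auto simp: a_def b_def)
  ultimately have "v powr \<theta> \<le> \<theta> * a + (1 - \<theta>) * b"
    using Youngs_inequality_0[of \<theta> "1 - \<theta>" a b] assms by simp
  then show ?thesis by (simp add: a_def b_def mult_ac)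
qed

text \<open>The bound over sets is the normed form of membership in weak L^q with 1/q = 1 -
  \<theta>. It is the form in which the integral of \<open>K\<close> over a level set can be
  estimated directly.\<close>

definition weak_kernel :: "'a measure \<Rightarrow> real \<Rightarrow> real \<Rightarrow> ('a \<Rightarrow> ennreal) \<Rightarrow> bool" where
  "weak_kernel M D \<theta> K \<longleftrightarrow> K \<in> borel_measurable M \<and>
     (\<forall>E \<in> sets M. emeasure M E < \<infinity> \<longrightarrow>
        (\<integral>\<^sup>+y. K y * indicator E y \<partial>M) \<le> ennreal (D * measure M E powr \<theta>))"

text \<open>By the layer cake formula only the level sets {F > t} with t < c enter, and each
  contributes at most D v(t)^\<theta>, where v(t) is its measure. Cutting at \<open>c\<close> is
  what makes the power of t left by Young's inequality integrable.\<close>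

lemma (in sigma_finite_measure) weak_kernel_truncated:
  fixes K :: "'a \<Rightarrow> ennreal" and F :: "'a \<Rightarrow> real"
  assumes K: "weak_kernel M D \<theta> K" and D: "D \<ge> 0"
    and F[measurable]: "F \<in> borel_measurable M" and nn: "\<And>y. 0 \<le> F y"
    and int: "(\<integral>\<^sup>+y. ennreal (F y powr p) \<partial>M) \<le> 1"
    and p: "1 < p" and \<theta>: "0 < \<theta>" "p * \<theta> < 1" and c: "c \<ge> 0"
  shows "(\<integral>\<^sup>+y. K y * ennreal (min (F y) c) \<partial>M)
    \<le> ennreal (D * ((1 - p * \<theta>) powr (- (1 - \<theta>)) * c powr (1 - p * \<theta>)))"
proof (cases "c = 0")
  case True
  then show ?thesis using nn by simp
next
  case False
  then have c: "c > 0" using c by simp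
  have \<theta>1: "\<theta> < 1"
  proof -
    have "\<theta> < p * \<theta>" using p \<theta> by simp
    then show ?thesis using \<theta> by linarith
  qed
  have Km[measurable]: "K \<in> borel_measurable M" using K by (simp add: weak_kernel_def)
  define v where "v t = measure M {z \<in> space M. t < F z}" for t
  have lev: "(\<integral>\<^sup>+t. ennreal (p * t powr (p - 1)) * indicator {0<..} t * emeasure M {z \<in> space M. t < F z} \<partial>lborel) \<le> 1"
    using nn_integral_level_sets_powr[OF F nn, of p] int p by simp
  \<comment> \<open>Chebyshev's inequality; \<open>weak_kernel\<close> speaks of sets of finite
    measure only.\<close>
  have fin: "emeasure M {z \<in> space M. t < F z} < \<infinity>" if "t > 0" for t
  proof -
    have "ennreal (t powr p) * emeasure M {z \<in> space M. t < F z}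
        = (\<integral>\<^sup>+y. ennreal (t powr p) * indicator {z \<in> space M. t < F z} y \<partial>M)"
      by (simp add: nn_integral_cmult)
    also have "\<dots> \<le> (\<integral>\<^sup>+y. ennreal (F y powr p) \<partial>M)"
      using that p by (intro nn_integral_mono) (auto simp: indicator_def intro!: ennreal_leI powr_mono2)
    also have "\<dots> \<le> 1" by fact
    finally have "ennreal (t powr p) * emeasure M {z \<in> space M. t < F z} < \<infinity>"
      by (simp add: order_le_less_trans)
    then show ?thesis using that by (auto simp: ennreal_mult_less_top)
  qed
  have vm[measurable]: "v \<in> borel_measurable borel"
  proof -
    have "(\<lambda>t. emeasure M {z \<in> space M. t < F z}) \<in> borel_measurable lborel"
    proof -
      have "(\<lambda>t. \<integral>\<^sup>+z. (if t < F z then 1 else 0) \<partial>M) \<in> borel_measurable lborel"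
        by measurable
      also have "(\<lambda>t. \<integral>\<^sup>+z. (if t < F z then 1 else 0) \<partial>M) = (\<lambda>t. emeasure M {z \<in> space M. t < F z})"
      proof
        fix t
        have "(\<integral>\<^sup>+z. (if t < F z then 1 else 0) \<partial>M) = (\<integral>\<^sup>+z. indicator {z \<in> space M. t < F z} z \<partial>M)"
          by (intro nn_integral_cong) (auto simp: indicator_def)
        then show "(\<integral>\<^sup>+z. (if t < F z then 1 else 0) \<partial>M) = emeasure M {z \<in> space M. t < F z}"
          by simp
      qed
      finally show ?thesis .
    qed
    then show ?thesis unfolding v_def measure_def by simp
  qed
  \<comment> \<open>\<open>s\<close> is the exponent that Young's inequality leaves on 1/t, and the
    integral of t^(-s) over (0,c) is X/(1-s) = (1-\<theta>) Y. The choice of \<open>\<tau>\<close>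
    gives \<tau>^(-\<theta>/(1-\<theta>)) Y = \<tau>, so both terms become multiples of
    \<open>\<tau>\<close>.\<close>
  define s where "s = (p - 1) * \<theta> / (1 - \<theta>)"
  define X where "X = c powr (1 - s)"
  define Y where "Y = X / (1 - p * \<theta>)"
  define \<tau> where "\<tau> = Y powr (1 - \<theta>)"
  have s1: "1 - s = (1 - p * \<theta>) / (1 - \<theta>)" using \<theta>1 by (simp add: s_def field_simps)
  have "1 - s > 0" using s1 \<theta> \<theta>1 by simp
  have Y: "Y > 0" "X > 0" using c \<theta> by (auto simp: Y_def X_def)
  have \<tau>: "\<tau> > 0" using Y by (simp add: \<tau>_def)
  have b: "v t powr \<theta> \<le> \<theta> * \<tau> / p * (p * t powr (p - 1) * v t) + (1 - \<theta>) * \<tau> powr (- \<theta> / (1 - \<theta>)) * t powr (- s)"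
    if "t > 0" for t
    using Young_powr_weighted[of "v t" t \<tau> \<theta> p] that \<tau> \<theta> \<theta>1 p by (simp add: s_def v_def mult_ac)
  have "(\<integral>\<^sup>+y. K y * ennreal (min (F y) c) \<partial>M)
      = (\<integral>\<^sup>+y. K y * (\<integral>\<^sup>+t. indicator {0<..<c} t * indicator {0<..<F y} t \<partial>lborel) \<partial>M)"
  proof (intro nn_integral_cong arg_cong2[where f="(*)"] refl)
    fix y
    have "(\<integral>\<^sup>+t. indicator {0<..<c} t * indicator {0<..<F y} t \<partial>lborel) = (\<integral>\<^sup>+t. indicator {0<..<min (F y) c} t \<partial>lborel)"
      by (intro nn_integral_cong) (auto simp: indicator_def)
    then show "ennreal (min (F y) c) = (\<integral>\<^sup>+t. indicator {0<..<c} t * indicator {0<..<F y} t \<partial>lborel)"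
      using nn[of y] c by simp
  qed
  also have "\<dots> = (\<integral>\<^sup>+t. indicator {0<..<c} t * indicator {0<..} t *
      (\<integral>\<^sup>+y. K y * indicator {z \<in> space M. t < F z} y \<partial>M) \<partial>lborel)"
    by (rule nn_integral_layer_cake) measurable
  also have "\<dots> \<le> (\<integral>\<^sup>+t. ennreal (D * (\<theta> * \<tau> / p)) * (ennreal (p * t powr (p - 1)) * indicator {0<..} t * emeasure M {z \<in> space M. t < F z})
      + ennreal (D * ((1 - \<theta>) * \<tau> powr (- \<theta> / (1 - \<theta>)))) * (ennreal (t powr (- s)) * indicator {0<..<c} t) \<partial>lborel)"
  proof (intro nn_integral_mono)
    fix t :: real
    show "indicator {0<..<c} t * indicator {0<..} t * (\<integral>\<^sup>+y. K y * indicator {z \<in> space M. t < F z} y \<partial>M)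
      \<le> ennreal (D * (\<theta> * \<tau> / p)) * (ennreal (p * t powr (p - 1)) * indicator {0<..} t * emeasure M {z \<in> space M. t < F z})
      + ennreal (D * ((1 - \<theta>) * \<tau> powr (- \<theta> / (1 - \<theta>)))) * (ennreal (t powr (- s)) * indicator {0<..<c} t)"
    proof (cases "0 < t \<and> t < c")
      case True
      have "(\<integral>\<^sup>+y. K y * indicator {z \<in> space M. t < F z} y \<partial>M) \<le> ennreal (D * v t powr \<theta>)"
        using K fin[of t] True unfolding weak_kernel_def v_def by simp
      also have "\<dots> \<le> ennreal (D * (\<theta> * \<tau> / p) * (p * t powr (p - 1) * v t)
          + D * ((1 - \<theta>) * \<tau> powr (- \<theta> / (1 - \<theta>))) * t powr (- s))"
        using mult_left_mono[OF b[of t] D] True p by (intro ennreal_leI) (simp add: algebra_simps)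
      also have "\<dots> = ennreal (D * (\<theta> * \<tau> / p)) * (ennreal (p * t powr (p - 1)) * ennreal (v t))
          + ennreal (D * ((1 - \<theta>) * \<tau> powr (- \<theta> / (1 - \<theta>)))) * ennreal (t powr (- s))"
      proof -
        have "0 \<le> D * (\<theta> * \<tau> / p)" "0 \<le> D * ((1 - \<theta>) * \<tau> powr (- \<theta> / (1 - \<theta>)))" "0 \<le> v t" "0 \<le> p * t powr (p - 1)"
          using D \<theta> \<theta>1 \<tau> p by (auto simp: v_def)
        moreover have "ennreal (X * (W * V) + Y * T) = ennreal X * (ennreal W * ennreal V) + ennreal Y * ennreal T"
          if "0 \<le> X" "0 \<le> Y" "0 \<le> V" "0 \<le> W" "0 \<le> T" for X Y V W T :: real
          using that by (simp add: ennreal_mult)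
        note this[of "D * (\<theta> * \<tau> / p)" "D * ((1 - \<theta>) * \<tau> powr (- \<theta> / (1 - \<theta>)))" "v t" "p * t powr (p - 1)" "t powr (- s)"]
        ultimately show ?thesis by (simp only: mult.assoc powr_ge_zero simp_thms)
      qed
      finally show ?thesis using True fin[of t] by (simp add: v_def emeasure_eq_ennreal_measure top.not_eq_extremum)
    qed auto
  qed
  also have "\<dots> = ennreal (D * (\<theta> * \<tau> / p)) * (\<integral>\<^sup>+t. ennreal (p * t powr (p - 1)) * indicator {0<..} t * emeasure M {z \<in> space M. t < F z} \<partial>lborel)
      + ennreal (D * ((1 - \<theta>) * \<tau> powr (- \<theta> / (1 - \<theta>)))) * (\<integral>\<^sup>+t. ennreal (t powr (- s)) * indicator {0<..<c} t \<partial>lborel)"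
  proof -
    \<comment> \<open>For t \<le> 0 the level set may have infinite measure, and then the real
      number \<open>v t\<close> is 0. The two agree only after restriction to t > 0.\<close>
    have [measurable]: "(\<lambda>t. emeasure M {z \<in> space M. t < F z} * indicator {0<..} t) \<in> borel_measurable borel"
    proof -
      have "(\<lambda>t. emeasure M {z \<in> space M. t < F z} * indicator {0<..} t) = (\<lambda>t. ennreal (v t) * indicator {0<..} t)"
        using fin by (intro ext) (auto simp: v_def indicator_def emeasure_eq_ennreal_measure top.not_eq_extremum)
      then show ?thesis by simp
    qed
    have m: "(\<lambda>t. ennreal (p * t powr (p - 1)) * indicator {0<..} t * emeasure M {z \<in> space M. t < F z}) \<in> borel_measurable borel"
    proof -
      have "(\<lambda>t. ennreal (p * t powr (p - 1)) * indicator {0<..} t * emeasure M {z \<in> space M. t < F z})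
         = (\<lambda>t. ennreal (p * t powr (p - 1)) * (emeasure M {z \<in> space M. t < F z} * indicator {0<..} t))"
        by (simp add: mult_ac)
      then show ?thesis by simp
    qed
    show ?thesis using m by (subst nn_integral_add) (auto simp: nn_integral_cmult)
  qed
  also have "\<dots> \<le> ennreal (D * (\<theta> * \<tau> / p)) * 1 + ennreal (D * ((1 - \<theta>) * \<tau> powr (- \<theta> / (1 - \<theta>)))) * ennreal (X / (1 - s))"
  proof (intro add_mono mult_left_mono lev)
    show "(\<integral>\<^sup>+t. ennreal (t powr (- s)) * indicator {0<..<c} t \<partial>lborel) \<le> ennreal (X / (1 - s))"
      using nn_integral_powr_from_0[of "- s" c] c \<open>1 - s > 0\<close> by (simp add: X_def)
  qed auto
  also have "\<dots> = ennreal (D * (\<theta> * \<tau> / p + (1 - \<theta>) * \<tau> powr (- \<theta> / (1 - \<theta>)) * (X / (1 - s))))"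
    using D \<theta> \<theta>1 \<tau> p Y \<open>1 - s > 0\<close>
    by (simp add: ennreal_mult[symmetric] ennreal_plus[symmetric] distrib_left mult_ac del: ennreal_plus)
  also have "\<dots> \<le> ennreal (D * ((1 - p * \<theta>) powr (- (1 - \<theta>)) * c powr (1 - p * \<theta>)))"
  proof (intro ennreal_leI mult_left_mono D)
    have "\<tau> powr (- \<theta> / (1 - \<theta>)) = Y powr (- \<theta>)" using \<theta>1 by (simp add: \<tau>_def powr_powr)
    moreover have "X / (1 - s) = Y * (1 - \<theta>)" using \<theta> \<theta>1 by (simp add: Y_def s1)
    moreover have "Y powr (- \<theta>) * Y = Y powr (1 - \<theta>)"
      using Y powr_add[of Y "- \<theta>" 1] by simp
    ultimately have "(1 - \<theta>) * \<tau> powr (- \<theta> / (1 - \<theta>)) * (X / (1 - s)) = (1 - \<theta>) * (1 - \<theta>) * \<tau>"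
      by (simp add: \<tau>_def mult_ac)
    \<comment> \<open>The coefficients \<theta>/p and (1-\<theta>)^2 are enlarged to \<theta> and
      1-\<theta>, which add up to 1; the final constant leaves room for this loss.\<close>
    moreover have "\<theta> * \<tau> / p + (1 - \<theta>) * (1 - \<theta>) * \<tau> \<le> \<tau>"
    proof -
      have "\<theta> * \<tau> / p \<le> \<theta> * \<tau>" using p \<theta> \<tau> by (simp add: divide_le_eq)
      moreover have "(1 - \<theta>) * (1 - \<theta>) * \<tau> \<le> (1 - \<theta>) * \<tau>"
        using \<theta> \<theta>1 \<tau> by (simp add: mult_left_le_one_le)
      ultimately show ?thesis by (simp add: algebra_simps)
    qed
    moreover have "\<tau> = (1 - p * \<theta>) powr (- (1 - \<theta>)) * c powr (1 - p * \<theta>)"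
    proof -
      have "\<tau> = X powr (1 - \<theta>) / (1 - p * \<theta>) powr (1 - \<theta>)" using Y \<theta> by (simp add: \<tau>_def Y_def powr_divide)
      also have "X powr (1 - \<theta>) = c powr (1 - p * \<theta>)" using \<theta>1 c by (simp add: X_def powr_powr s1)
      finally show ?thesis using powr_minus[of "1 - p * \<theta>" "1 - \<theta>"]
        by (simp only: divide_inverse mult.commute)
    qed
    ultimately show "\<theta> * \<tau> / p + (1 - \<theta>) * \<tau> powr (- \<theta> / (1 - \<theta>)) * (X / (1 - s))
      \<le> (1 - p * \<theta>) powr (- (1 - \<theta>)) * c powr (1 - p * \<theta>)" by simp
  qed
  finally show ?thesis .
qed

text \<open>Where F(y)^p \<le> H(x)^s, the factor F(y) equals its truncation at H(x)^(s/p), and the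
  truncated estimate applies in y for fixed x. Elsewhere H(x) is at most F(y)^(p/s), and it applies
  in x for fixed y. Hence the weak type in both variables.\<close>

lemma (in sigma_finite_measure) weak_kernel_bilinear:
  fixes k :: "'a \<Rightarrow> 'a \<Rightarrow> ennreal" and F H :: "'a \<Rightarrow> real"
  assumes k[measurable]: "case_prod k \<in> borel_measurable (M \<Otimes>\<^sub>M M)" and D: "D \<ge> 0"
    and weak1: "AE x in M. weak_kernel M D \<theta> (k x)"
    and weak2: "AE y in M. weak_kernel M D \<theta> (\<lambda>x. k x y)"
    and F[measurable]: "F \<in> borel_measurable M" and Fnn: "\<And>y. 0 \<le> F y"
    and H[measurable]: "H \<in> borel_measurable M" and Hnn: "\<And>y. 0 \<le> H y"
    and Fint: "(\<integral>\<^sup>+y. ennreal (F y powr p) \<partial>M) \<le> 1"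
    and Hint: "(\<integral>\<^sup>+x. ennreal (H x powr s) \<partial>M) \<le> 1"
    and p: "1 < p" and s: "1 < s" and \<theta>: "0 < \<theta>" "\<theta> = 1 / p + 1 / s - 1"
  shows "(\<integral>\<^sup>+x. ennreal (H x) * (\<integral>\<^sup>+y. k x y * ennreal (F y) \<partial>M) \<partial>M)
    \<le> ennreal (D * ((1 - p * \<theta>) powr (- (1 - \<theta>)) + (1 - s * \<theta>) powr (- (1 - \<theta>))))"
proof -
  interpret MM: pair_sigma_finite M M ..
  define \<kappa> where "\<kappa> q = (1 - q * \<theta>) powr (- (1 - \<theta>))" for q
  have p\<theta>: "p * \<theta> = 1 + p / s - p" and s\<theta>: "s * \<theta> = 1 + s / p - s"
    using p s by (simp_all add: \<theta>(2) field_simps)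
  have lt: "p * \<theta> < 1" "s * \<theta> < 1"
    using p s by (simp_all add: p\<theta> s\<theta> divide_less_eq)
  \<comment> \<open>One estimate for both regions, with the roles of the two functions left open.
    The truncation at U^(b/a) contributes the power (b/a)(1 - a\<theta>) = b - 1 of U, which the
    outer factor U completes to U^b.\<close>
  have half: "(\<integral>\<^sup>+x. ennreal (U x) * (\<integral>\<^sup>+y. j x y * ennreal (min (V y) (U x powr (b / a))) \<partial>M) \<partial>M)
      \<le> ennreal (D * \<kappa> a)"
    if j: "AE x in M. weak_kernel M D \<theta> (j x)"
      and U[measurable]: "U \<in> borel_measurable M" and Unn: "\<And>y. 0 \<le> U y" and Uint: "(\<integral>\<^sup>+y. ennreal (U y powr b) \<partial>M) \<le> 1"
      and V[measurable]: "V \<in> borel_measurable M" and Vnn: "\<And>y. 0 \<le> V y" and Vint: "(\<integral>\<^sup>+y. ennreal (V y powr a) \<partial>M) \<le> 1"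
      and a: "1 < a" and b: "1 < b" and a\<theta>: "a * \<theta> = 1 + a / b - a" "a * \<theta> < 1"
    for U V :: "'a \<Rightarrow> real" and a b :: real and j :: "'a \<Rightarrow> 'a \<Rightarrow> ennreal"
  proof -
    have "(\<integral>\<^sup>+x. ennreal (U x) * (\<integral>\<^sup>+y. j x y * ennreal (min (V y) (U x powr (b / a))) \<partial>M) \<partial>M)
        \<le> (\<integral>\<^sup>+x. ennreal (D * \<kappa> a) * ennreal (U x powr b) \<partial>M)"
    proof (rule nn_integral_mono_AE, use j in eventually_elim)
      fix x assume "weak_kernel M D \<theta> (j x)"
      then have "(\<integral>\<^sup>+y. j x y * ennreal (min (V y) (U x powr (b / a))) \<partial>M)
          \<le> ennreal (D * (\<kappa> a * (U x powr (b / a)) powr (1 - a * \<theta>)))"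
        unfolding \<kappa>_def by (rule weak_kernel_truncated[OF _ D V Vnn Vint a \<theta>(1) a\<theta>(2)]) simp
      then have "ennreal (U x) * (\<integral>\<^sup>+y. j x y * ennreal (min (V y) (U x powr (b / a))) \<partial>M)
          \<le> ennreal (U x) * ennreal (D * (\<kappa> a * (U x powr (b / a)) powr (1 - a * \<theta>)))"
        by (rule mult_left_mono) simp
      also have "\<dots> = ennreal (D * \<kappa> a * (U x * U x powr (b / a * (1 - a * \<theta>))))"
        using Unn[of x] D by (simp add: \<kappa>_def powr_powr mult_ac flip: ennreal_mult)
      also have "b / a * (1 - a * \<theta>) = b - 1"
        unfolding a\<theta>(1) using a b by (simp add: field_simps)
      also have "U x * U x powr (b - 1) = U x powr b"
        using Unn[of x] by (cases "U x = 0") (auto simp: powr_diff)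
      finally show "ennreal (U x) * (\<integral>\<^sup>+y. j x y * ennreal (min (V y) (U x powr (b / a))) \<partial>M)
          \<le> ennreal (D * \<kappa> a) * ennreal (U x powr b)"
        using D by (simp add: \<kappa>_def flip: ennreal_mult)
    qed
    also have "\<dots> = ennreal (D * \<kappa> a) * (\<integral>\<^sup>+x. ennreal (U x powr b) \<partial>M)"
      by (rule nn_integral_cmult) measurable
    also have "\<dots> \<le> ennreal (D * \<kappa> a)"
      using mult_left_mono[OF Uint, of "ennreal (D * \<kappa> a)"] by simp
    finally show ?thesis .
  qed
  have split: "H x * F y \<le> H x * min (F y) (H x powr (s / p)) + F y * min (H x) (F y powr (p / s))" for x y
  proof (cases "F y \<le> H x powr (s / p)")
    case True
    then show ?thesis using Fnn[of y] Hnn[of x] by (simp add: min_def)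
  next
    case False
    then have "(H x powr (s / p)) powr (p / s) \<le> F y powr (p / s)"
      using p s by (intro powr_mono2) auto
    then have "H x \<le> F y powr (p / s)"
      using p s Hnn[of x] by (simp add: powr_powr)
    then show ?thesis using Fnn[of y] Hnn[of x] by (simp add: min_def mult_ac)
  qed
  have "(\<integral>\<^sup>+x. ennreal (H x) * (\<integral>\<^sup>+y. k x y * ennreal (F y) \<partial>M) \<partial>M)
      \<le> (\<integral>\<^sup>+x. (\<integral>\<^sup>+y. ennreal (H x) * (k x y * ennreal (min (F y) (H x powr (s / p))))
          + ennreal (F y) * (k x y * ennreal (min (H x) (F y powr (p / s)))) \<partial>M) \<partial>M)"
  proof (rule nn_integral_mono)
    fix x assume "x \<in> space M"
    then have [measurable]: "k x \<in> borel_measurable M" by measurable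
    have "ennreal (H x) * (\<integral>\<^sup>+y. k x y * ennreal (F y) \<partial>M) = (\<integral>\<^sup>+y. k x y * ennreal (H x * F y) \<partial>M)"
      using Hnn Fnn by (simp add: nn_integral_cmult[symmetric] ennreal_mult mult_ac)
    also have "\<dots> \<le> (\<integral>\<^sup>+y. ennreal (H x) * (k x y * ennreal (min (F y) (H x powr (s / p))))
          + ennreal (F y) * (k x y * ennreal (min (H x) (F y powr (p / s)))) \<partial>M)"
    proof (rule nn_integral_mono)
      fix y
      have "k x y * ennreal (H x * F y)
          \<le> k x y * ennreal (H x * min (F y) (H x powr (s / p)) + F y * min (H x) (F y powr (p / s)))"
        by (intro mult_left_mono ennreal_leI split) simp
      then show "k x y * ennreal (H x * F y) \<le> ennreal (H x) * (k x y * ennreal (min (F y) (H x powr (s / p))))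
          + ennreal (F y) * (k x y * ennreal (min (H x) (F y powr (p / s))))"
        using Hnn[of x] Fnn[of y] by (simp add: ennreal_mult distrib_left mult_ac)
    qed
    finally show "ennreal (H x) * (\<integral>\<^sup>+y. k x y * ennreal (F y) \<partial>M) \<le> \<dots>" .
  qed
  also have "\<dots> = (\<integral>\<^sup>+x. (\<integral>\<^sup>+y. ennreal (H x) * (k x y * ennreal (min (F y) (H x powr (s / p)))) \<partial>M) \<partial>M)
          + (\<integral>\<^sup>+x. (\<integral>\<^sup>+y. ennreal (F y) * (k x y * ennreal (min (H x) (F y powr (p / s)))) \<partial>M) \<partial>M)"
  proof -
    have "(\<integral>\<^sup>+y. ennreal (H x) * (k x y * ennreal (min (F y) (H x powr (s / p))))
          + ennreal (F y) * (k x y * ennreal (min (H x) (F y powr (p / s)))) \<partial>M)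
        = (\<integral>\<^sup>+y. ennreal (H x) * (k x y * ennreal (min (F y) (H x powr (s / p)))) \<partial>M)
          + (\<integral>\<^sup>+y. ennreal (F y) * (k x y * ennreal (min (H x) (F y powr (p / s)))) \<partial>M)" if "x \<in> space M" for x
      using that by (intro nn_integral_add) measurable
    then show ?thesis by (subst nn_integral_add[symmetric]) (auto intro!: nn_integral_cong)
  qed
  also have "(\<integral>\<^sup>+x. (\<integral>\<^sup>+y. ennreal (F y) * (k x y * ennreal (min (H x) (F y powr (p / s)))) \<partial>M) \<partial>M)
      = (\<integral>\<^sup>+y. (\<integral>\<^sup>+x. ennreal (F y) * (k x y * ennreal (min (H x) (F y powr (p / s)))) \<partial>M) \<partial>M)"
    by (rule MM.Fubini'[symmetric]) measurable
  also have "\<dots> = (\<integral>\<^sup>+y. ennreal (F y) * (\<integral>\<^sup>+x. k x y * ennreal (min (H x) (F y powr (p / s))) \<partial>M) \<partial>M)"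
    by (intro nn_integral_cong nn_integral_cmult) measurable
  also have "\<dots> \<le> ennreal (D * \<kappa> s)"
    by (rule half[OF weak2 F Fnn Fint H Hnn Hint s p s\<theta> lt(2)])
  also have "(\<integral>\<^sup>+x. (\<integral>\<^sup>+y. ennreal (H x) * (k x y * ennreal (min (F y) (H x powr (s / p)))) \<partial>M) \<partial>M)
      = (\<integral>\<^sup>+x. ennreal (H x) * (\<integral>\<^sup>+y. k x y * ennreal (min (F y) (H x powr (s / p))) \<partial>M) \<partial>M)"
    by (intro nn_integral_cong nn_integral_cmult) measurable
  also have "\<dots> \<le> ennreal (D * \<kappa> p)"
    by (rule half[OF weak1 H Hnn Hint F Fnn Fint p s p\<theta> lt(1)])
  finally show ?thesis
    using D by (simp add: \<kappa>_def distrib_left)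
qed

text \<open>Duality by means of the extremal function: testing the bilinear form with a multiple of
  g^(r-1) returns the L^r norm of g. As \<open>enn2real\<close> sends infinity to 0, the integral
  bound alone would not show finiteness a.e., so this is a conclusion of its own.\<close>

lemma (in sigma_finite_measure) weak_kernel_strong_type:
  fixes k :: "'a \<Rightarrow> 'a \<Rightarrow> ennreal" and F :: "'a \<Rightarrow> real"
  assumes k[measurable]: "case_prod k \<in> borel_measurable (M \<Otimes>\<^sub>M M)" and D: "D \<ge> 0"
    and weak1: "AE x in M. weak_kernel M D \<theta> (k x)"
    and weak2: "AE y in M. weak_kernel M D \<theta> (\<lambda>x. k x y)"
    and F[measurable]: "F \<in> borel_measurable M" and Fnn: "\<And>y. 0 \<le> F y"
    and Fint: "(\<integral>\<^sup>+y. ennreal (F y powr p) \<partial>M) \<le> 1"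
    and p: "1 < p" "p < r" and \<theta>: "\<theta> = 1 / p - 1 / r" and s: "s = r / (r - 1)"
    and L: "(1 - p * \<theta>) powr (- (1 - \<theta>)) + (1 - s * \<theta>) powr (- (1 - \<theta>)) \<le> L"
  shows "AE x in M. (\<integral>\<^sup>+y. k x y * ennreal (F y) \<partial>M) < \<infinity>" (is ?fin)
    and "(\<integral>\<^sup>+x. ennreal (enn2real (\<integral>\<^sup>+y. k x y * ennreal (F y) \<partial>M) powr r) \<partial>M) \<le> ennreal ((D * L) powr r)" (is ?int)
proof -
  define h where "h x = (\<integral>\<^sup>+y. k x y * ennreal (F y) \<partial>M)" for x
  have hm[measurable]: "h \<in> borel_measurable M" unfolding h_def by measurable
  have r: "r > 1" using p by simp
  have s1: "s > 1" using r by (simp add: s field_simps)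
  have \<theta>0: "\<theta> > 0" using p by (simp add: \<theta> field_simps)
  have \<theta>s: "\<theta> = 1 / p + 1 / s - 1" using r by (simp add: \<theta> s field_simps)
  have L0: "L \<ge> 0" using L by (smt (verit) powr_ge_zero)
  obtain A :: "nat \<Rightarrow> 'a set" where A: "range A \<subseteq> sets M" "(\<Union>i. A i) = space M" "\<And>i. emeasure M (A i) \<noteq> \<infinity>" "incseq A"
    using sigma_finite_incseq by metis
  have Am[measurable]: "A i \<in> sets M" for i using A(1) by auto
  \<comment> \<open>Truncation in height and in space makes the integral of the r-th power finite,
    so that it can be divided by.\<close>
  define g where "g n x = enn2real (min (h x) (of_nat n)) * indicator (A n) x" for n :: nat and x
  have gm[measurable]: "g n \<in> borel_measurable M" for n unfolding g_def by measurable
  have gnn: "g n x \<ge> 0" for n x by (simp add: g_def)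
  have gh: "ennreal (g n x) \<le> h x" for n x
  proof -
    have "ennreal (g n x) \<le> ennreal (enn2real (min (h x) (of_nat n)))"
      by (auto simp: g_def indicator_def)
    also have "\<dots> = min (h x) (of_nat n)" by (rule ennreal_enn2real) (simp add: min_less_iff_disj of_nat_less_top)
    finally show ?thesis by (rule order_trans) simp
  qed
  have gn: "g n x \<le> real n * indicator (A n) x" for n x
  proof -
    have "enn2real (min (h x) (of_nat n)) \<le> enn2real (of_nat n)"
      by (rule enn2real_mono) (auto simp: of_nat_less_top)
    then show ?thesis by (auto simp: g_def indicator_def)
  qed
  define Z where "Z n = (\<integral>\<^sup>+x. ennreal (g n x powr r) \<partial>M)" for n
  have Zb: "Z n \<le> ennreal ((D * L) powr r)" for n
  proof (cases "Z n = 0")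
    case False
    have "Z n \<le> (\<integral>\<^sup>+x. ennreal (real n powr r) * indicator (A n) x \<partial>M)"
      unfolding Z_def
    proof (rule nn_integral_mono)
      fix x show "ennreal (g n x powr r) \<le> ennreal (real n powr r) * indicator (A n) x"
        using gn[of n x] gnn[of n x] r by (auto simp: indicator_def intro!: ennreal_leI powr_mono2 split: if_splits)
    qed
    also have "\<dots> < \<infinity>" using A(3)[of n] by (simp add: nn_integral_cmult ennreal_mult_less_top top.not_eq_extremum)
    finally have "Z n < \<infinity>" .
    then obtain z where z: "Z n = ennreal z" "z \<ge> 0" by (cases "Z n") auto
    have z0: "z > 0" using z False by (cases "z = 0") auto
    \<comment> \<open>Equality case of Hoelder's inequality: (r-1) s = r makes H^s equal to g^r / z,
      which has integral 1.\<close>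
    define H where "H x = g n x powr (r - 1) / z powr (1 / s)" for x
    have Hint: "(\<integral>\<^sup>+x. ennreal (H x powr s) \<partial>M) \<le> 1"
    proof -
      have "H x powr s = g n x powr r * inverse z" for x
      proof -
        have "(r - 1) * s = r" using r by (simp add: s)
        then have "H x powr s = g n x powr r / z"
          using s1 z0 gnn[of n x] by (simp add: H_def powr_divide powr_powr)
        then show ?thesis by (simp add: divide_inverse)
      qed
      then have "(\<integral>\<^sup>+x. ennreal (H x powr s) \<partial>M) = (\<integral>\<^sup>+x. ennreal (g n x powr r) * ennreal (inverse z) \<partial>M)"
        using z0 by (simp add: ennreal_mult)
      also have "\<dots> = ennreal z * ennreal (inverse z)"
        by (subst nn_integral_multc) (auto simp: Z_def[symmetric] z)
      also have "\<dots> = 1" using z0 by (simp flip: ennreal_mult)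
      finally show ?thesis by simp
    qed
    have "ennreal (z powr (1 / r)) = ennreal (z / z powr (1 / s))"
    proof -
      have "1 / r = 1 - 1 / s" using r by (simp add: s field_simps)
      then show ?thesis using z0 by (simp add: powr_diff)
    qed
    also have "\<dots> = (\<integral>\<^sup>+x. ennreal (g n x powr r) * ennreal (1 / z powr (1 / s)) \<partial>M)"
      using z0 by (subst nn_integral_multc) (auto simp: Z_def[symmetric] z simp flip: ennreal_mult)
    also have "\<dots> = (\<integral>\<^sup>+x. ennreal (H x) * ennreal (g n x) \<partial>M)"
    proof (intro nn_integral_cong)
      fix x
      have "g n x powr r = g n x powr (r - 1) * g n x"
        using gnn[of n x] by (cases "g n x = 0") (auto simp: powr_diff)
      then show "ennreal (g n x powr r) * ennreal (1 / z powr (1 / s)) = ennreal (H x) * ennreal (g n x)"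
        using gnn[of n x] by (simp add: H_def flip: ennreal_mult)
    qed
    also have "\<dots> \<le> (\<integral>\<^sup>+x. ennreal (H x) * h x \<partial>M)"
      by (intro nn_integral_mono mult_left_mono gh) simp
    also have "\<dots> \<le> ennreal (D * ((1 - p * \<theta>) powr (- (1 - \<theta>)) + (1 - s * \<theta>) powr (- (1 - \<theta>))))"
      unfolding h_def
    proof (rule weak_kernel_bilinear[OF k D weak1 weak2 F Fnn _ _ Fint Hint p(1) s1 \<theta>0 \<theta>s])
      show "H \<in> borel_measurable M" unfolding H_def by measurable
    qed (simp add: H_def)
    also have "\<dots> \<le> ennreal (D * L)" by (intro ennreal_leI mult_left_mono L D)
    finally have "z powr (1 / r) \<le> D * L" using D L0 by simp
    then have "(z powr (1 / r)) powr r \<le> (D * L) powr r" using r by (intro powr_mono2) auto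
    then show ?thesis using r z0 by (simp add: powr_powr z ennreal_leI)
  qed simp
  \<comment> \<open>Unlike the r-th power of \<open>enn2real (h x)\<close>, this supremum is
    infinite where \<open>h\<close> is, so its finite integral forces h < \<infinity> a.e.\<close>
  define \<phi> where "\<phi> x = (SUP n. ennreal (g n x powr r))" for x
  have \<phi>m[measurable]: "\<phi> \<in> borel_measurable M" unfolding \<phi>_def by measurable
  have inc: "incseq (\<lambda>n x. ennreal (g n x powr r))"
  proof (intro incseq_SucI le_funI ennreal_leI powr_mono2 gnn)
    fix n x
    have "enn2real (min (h x) (of_nat n)) \<le> enn2real (min (h x) (of_nat (Suc n)))"
      by (intro enn2real_mono min.mono order_refl of_nat_mono) (auto simp: min_less_iff_disj of_nat_less_top)
    moreover have "x \<in> A n \<Longrightarrow> x \<in> A (Suc n)" using incseq_SucD[OF A(4), of n] by auto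
    ultimately show "g n x \<le> g (Suc n) x" by (auto simp: g_def indicator_def simp del: of_nat_Suc)
  qed (use r in simp)
  have \<phi>int: "(\<integral>\<^sup>+x. \<phi> x \<partial>M) \<le> ennreal ((D * L) powr r)"
    unfolding \<phi>_def using inc by (subst nn_integral_monotone_convergence_SUP) (auto intro!: SUP_least Zb[unfolded Z_def])
  have \<phi>inf: "\<phi> x = \<infinity>" if x: "x \<in> space M" "h x = \<infinity>" for x
  proof -
    obtain m where m: "x \<in> A m" using A(2) x by auto
    have "of_nat j \<le> \<phi> x" for j :: nat
    proof -
      define n where "n = Suc (max j m)"
      have "x \<in> A n" using m incseqD[OF A(4), of m n] le_SucI[OF max.cobounded2[of m j]] unfolding n_def by blast
      then have "g n x = real n" using x by (simp add: g_def)
      have "real j \<le> real n powr 1" by (simp add: n_def)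
      also have "\<dots> \<le> real n powr r" using r by (intro powr_mono) (auto simp: n_def)
      finally have "of_nat j \<le> ennreal (g n x powr r)" using \<open>g n x = real n\<close>
        by (simp add: ennreal_of_nat_eq_real_of_nat ennreal_leI)
      also have "\<dots> \<le> \<phi> x" unfolding \<phi>_def by (rule SUP_upper) simp
      finally show ?thesis .
    qed
    then show ?thesis by (metis ennreal_SUP_of_nat_eq_top SUP_least infinity_ennreal_def neq_top_trans top.extremum_uniqueI)
  qed
  have \<phi>ge: "ennreal (enn2real (h x) powr r) \<le> \<phi> x" if x: "x \<in> space M" for x
  proof (cases "h x = \<infinity>")
    case True
    then show ?thesis using \<phi>inf[OF x] by simp
  next
    case False
    obtain m where m: "x \<in> A m" using A(2) x by auto
    obtain j :: nat where j: "h x \<le> of_nat j" using False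
      by (metis ennreal_Ex_less_of_nat infinity_ennreal_def less_imp_le top.not_eq_extremum)
    define n where "n = max j m"
    have "x \<in> A n" using m incseqD[OF A(4), of m n] max.cobounded2[of m j] unfolding n_def by blast
    moreover have "h x \<le> of_nat n" using j by (rule order_trans) (simp add: n_def)
    ultimately have "g n x = enn2real (h x)" by (simp add: g_def min_def)
    then show ?thesis unfolding \<phi>_def by (metis SUP_upper UNIV_I)
  qed
  have "(\<integral>\<^sup>+x. \<phi> x \<partial>M) \<noteq> \<infinity>" using \<phi>int by (metis ennreal_less_top infinity_ennreal_def leD)
  then have "AE x in M. \<phi> x \<noteq> \<infinity>" by (intro nn_integral_PInf_AE) auto
  then show ?fin using AE_space
  proof eventually_elim
    case (elim x)
    then show ?case using \<phi>inf[of x] unfolding h_def[symmetric]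
      by (cases "h x = \<infinity>") (auto simp: top.not_eq_extremum)
  qed
  have "(\<integral>\<^sup>+x. ennreal (enn2real (h x) powr r) \<partial>M) \<le> (\<integral>\<^sup>+x. \<phi> x \<partial>M)"
    by (rule nn_integral_mono) (rule \<phi>ge)
  then show ?int using \<phi>int unfolding h_def by (rule order_trans)
qed

section \<open>Positive regular measures\<close>

text \<open>The values of a positive measure are nonnegative reals, so \<open>Re\<close> loses
  nothing. The form agrees with the measure under the integral in
  \<open>translation\<close>.\<close>

definition as_measure :: "('a::topological_space set \<Rightarrow> complex) \<Rightarrow> 'a measure" where
  "as_measure \<mu> = measure_of UNIV (sets borel) (\<lambda>E. ennreal (Re (\<mu> E)))"

lemma sets_as_measure [simp, measurable_cong]: "sets (as_measure \<mu>) = sets borel"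
  by (simp add: as_measure_def) (metis sets.sigma_sets_eq space_borel)

lemma space_as_measure [simp]: "space (as_measure \<mu>) = UNIV"
  by (simp add: as_measure_def space_measure_of_conv)

lemma borel_measurable_as_measure: "borel_measurable (as_measure \<mu>) = borel_measurable borel"
  by (rule measurable_cong_sets) auto

lemma positive_measureD:
  assumes "\<mu> \<in> positive_measures"
  shows "range A \<subseteq> sets borel \<Longrightarrow> disjoint_family A \<Longrightarrow> (\<lambda>i. \<mu> (A i)) sums \<mu> (\<Union>i. A i)"
    and "\<mu> E = complex_of_real (Re (\<mu> E))" and "0 \<le> Re (\<mu> E)"
proof -
  have cm: "complex_borel_measure \<mu>" and pos: "\<mu> E \<in> \<real>\<^sub>\<ge>\<^sub>0"
    using assms by (auto simp: positive_measures_def bounded_regular_measures_def)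
  show "range A \<subseteq> sets borel \<Longrightarrow> disjoint_family A \<Longrightarrow> (\<lambda>i. \<mu> (A i)) sums \<mu> (\<Union>i. A i)"
    using cm by (auto simp: complex_borel_measure_def)
  show "\<mu> E = complex_of_real (Re (\<mu> E))" "0 \<le> Re (\<mu> E)"
    using pos by (auto simp: complex_eq_iff elim!: nonneg_Reals_cases)
qed

lemma positive_measure_empty: 
  assumes "\<mu> \<in> positive_measures" shows "\<mu> {} = 0"
proof -
  have "(\<lambda>i::nat. \<mu> {}) sums \<mu> (\<Union>i::nat. {})"
    by (rule positive_measureD(1)[OF assms]) (auto simp: disjoint_family_on_def)
  then have "(\<lambda>i::nat. \<mu> {}) \<longlonglongrightarrow> 0" by (intro summable_LIMSEQ_zero) (rule sums_summable)
  then show ?thesis by (simp add: LIMSEQ_const_iff)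
qed

lemma emeasure_as_measure:
  assumes "\<mu> \<in> positive_measures" and E: "E \<in> sets borel"
  shows "emeasure (as_measure \<mu>) E = ennreal (Re (\<mu> E))"
  unfolding as_measure_def
proof (rule emeasure_measure_of_sigma)
  show "sigma_algebra UNIV (sets borel)" by (metis sets.sigma_algebra_axioms space_borel)
  show "positive (sets borel) (\<lambda>E. ennreal (Re (\<mu> E)))"
    using positive_measure_empty[OF assms(1)] by (simp add: positive_def)
  show "countably_additive (sets borel) (\<lambda>E. ennreal (Re (\<mu> E)))"
  proof (rule countably_additiveI)
    fix A :: "nat \<Rightarrow> 'a set"
    assume A: "range A \<subseteq> sets borel" "disjoint_family A"
    have "(\<lambda>i. Re (\<mu> (A i))) sums Re (\<mu> (\<Union>i. A i))"
      by (intro sums_Re positive_measureD(1) assms(1) A)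
    then show "(\<Sum>i. ennreal (Re (\<mu> (A i)))) = ennreal (Re (\<mu> (\<Union>i. A i)))"
      using positive_measureD(3)[OF assms(1)] by (intro suminf_ennreal_eq) auto
  qed
  show "E \<in> sets borel" by (rule E)
qed

lemma finite_as_measure: "\<mu> \<in> positive_measures \<Longrightarrow> finite_measure (as_measure \<mu>)"
  by (rule finite_measureI) (simp add: emeasure_as_measure)

lemma measure_as_measure:
  "\<mu> \<in> positive_measures \<Longrightarrow> E \<in> sets borel \<Longrightarrow> measure (as_measure \<mu>) E = Re (\<mu> E)"
  by (simp add: measure_def emeasure_as_measure positive_measureD(3))

lemma positive_part_positive_measure:
  assumes "\<mu> \<in> positive_measures"
  shows "positive_part (\<lambda>E. Re (\<mu> E)) = as_measure \<mu>"
proof -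
  have m: "sigma_sets UNIV (sets borel) = (sets borel :: 'a set set)" by (metis sets.sigma_sets_eq space_borel)
  interpret finite_measure "as_measure \<mu>" by (rule finite_as_measure[OF assms])
  have "(SUP F \<in> {F \<in> sets borel. F \<subseteq> E}. ennreal (Re (\<mu> F))) = ennreal (Re (\<mu> E))" if "E \<in> sets borel" for E
  proof (rule antisym)
    show "(SUP F \<in> {F \<in> sets borel. F \<subseteq> E}. ennreal (Re (\<mu> F))) \<le> ennreal (Re (\<mu> E))"
      using emeasure_mono[of _ E "as_measure \<mu>"] that assms
      by (intro SUP_least) (auto simp: emeasure_as_measure[symmetric])
    show "ennreal (Re (\<mu> E)) \<le> (SUP F \<in> {F \<in> sets borel. F \<subseteq> E}. ennreal (Re (\<mu> F)))"
      using that by (intro SUP_upper) auto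
  qed
  then show ?thesis unfolding positive_part_def as_measure_def
    by (intro measure_of_eq) (auto simp: m)
qed

lemma positive_part_nonpos:
  assumes "\<And>E. \<nu> E \<le> 0"
  shows "positive_part \<nu> = null_measure borel"
proof -
  have m: "sigma_sets UNIV (sets borel) = (sets borel :: 'a set set)" by (metis sets.sigma_sets_eq space_borel)
  have "(SUP F \<in> {F \<in> sets borel. F \<subseteq> E}. ennreal (\<nu> F)) = 0" for E
  proof -
    have "(SUP F \<in> {F \<in> sets borel. F \<subseteq> E}. ennreal (\<nu> F)) \<le> 0"
      using assms by (intro SUP_least) (simp add: ennreal_neg)
    then show ?thesis by simp
  qed
  then have "positive_part \<nu> = measure_of UNIV (sets borel) (\<lambda>E. 0)"
    unfolding positive_part_def by simp
  also have "\<dots> = null_measure borel"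
    by (simp add: null_measure_def)
  finally show ?thesis .
qed

text \<open>Three of the four terms of the Jordan decomposition come from set functions that are
  nowhere positive, and vanish.\<close>

lemma cm_integral_positive_measure:
  assumes "\<mu> \<in> positive_measures"
  shows "cm_integral \<mu> f = (LINT x|as_measure \<mu>. f x)"
proof -
  have "Im (\<mu> E) = 0" for E using positive_measureD(2)[OF assms, of E] by (metis Im_complex_of_real)
  then show ?thesis
    using positive_measureD(3)[OF assms]
    by (simp add: cm_integral_def positive_part_positive_measure[OF assms] positive_part_nonpos
        integral_null_measure)
qed

lemma total_variation_positive_measure:
  assumes "\<mu> \<in> positive_measures" "E \<in> sets borel"
  shows "total_variation \<mu> E = emeasure (as_measure \<mu>) E"
  unfolding total_variation_def
proof (rule antisym)
  have n: "ennreal (norm (\<mu> F)) = emeasure (as_measure \<mu>) F" if "F \<in> sets borel" for F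
    using positive_measureD(2,3)[OF assms(1), of F] emeasure_as_measure[OF assms(1) that]
    by (metis abs_of_nonneg norm_of_real)
  show "(SUP P \<in> {P. finite P \<and> P \<subseteq> sets borel \<and> disjoint P \<and> \<Union>P \<subseteq> E}. \<Sum>F\<in>P. ennreal (norm (\<mu> F)))
      \<le> emeasure (as_measure \<mu>) E"
  proof (rule SUP_least)
    fix P assume P: "P \<in> {P. finite P \<and> P \<subseteq> sets borel \<and> disjoint P \<and> \<Union>P \<subseteq> E}"
    then have "(\<Sum>F\<in>P. ennreal (norm (\<mu> F))) = (\<Sum>F\<in>P. emeasure (as_measure \<mu>) F)"
      by (intro sum.cong refl n) auto
    also have "\<dots> = emeasure (as_measure \<mu>) (\<Union>F\<in>P. F)"
      using P by (intro sum_emeasure) (auto simp: disjoint_family_on_def disjoint_def)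
    also have "\<dots> \<le> emeasure (as_measure \<mu>) E"
      using P assms by (intro emeasure_mono) auto
    finally show "(\<Sum>F\<in>P. ennreal (norm (\<mu> F))) \<le> emeasure (as_measure \<mu>) E" .
  qed
  have "emeasure (as_measure \<mu>) E = (\<Sum>F\<in>{E}. ennreal (norm (\<mu> F)))" using n assms by simp
  also have "\<dots> \<le> (SUP P \<in> {P. finite P \<and> P \<subseteq> sets borel \<and> disjoint P \<and> \<Union>P \<subseteq> E}. \<Sum>F\<in>P. ennreal (norm (\<mu> F)))"
    using assms by (intro SUP_upper) auto
  finally show "emeasure (as_measure \<mu>) E \<le> \<dots>" .
qed

lemma as_measure_inner_regular:
  fixes \<mu> :: "'a::t2_space set \<Rightarrow> complex"
  assumes "\<mu> \<in> positive_measures" "E \<in> sets borel" "\<epsilon> > 0"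
  shows "\<exists>C. compact C \<and> C \<subseteq> E \<and> measure (as_measure \<mu>) E < measure (as_measure \<mu>) C + \<epsilon>"
proof -
  interpret finite_measure "as_measure \<mu>" by (rule finite_as_measure[OF assms(1)])
  obtain C U where CU: "compact C" "open U" "C \<subseteq> E" "E \<subseteq> U" "total_variation \<mu> (U - C) < ennreal \<epsilon>"
    using assms unfolding positive_measures_def bounded_regular_measures_def by blast
  have m: "C \<in> sets borel" "U \<in> sets borel" using CU by (auto intro: borel_compact)
  have "measure (as_measure \<mu>) E \<le> measure (as_measure \<mu>) (C \<union> (U - C))"
    using CU m by (intro finite_measure_mono) auto
  also have "\<dots> = measure (as_measure \<mu>) C + measure (as_measure \<mu>) (U - C)"
    using m by (intro finite_measure_Union) auto
  also have "measure (as_measure \<mu>) (U - C) < \<epsilon>"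
    using CU(5) m assms by (simp add: total_variation_positive_measure emeasure_eq_measure ennreal_less_iff)
  finally show ?thesis using CU by auto
qed

lemma mem_measure_support:
  assumes "\<mu> \<in> positive_measures"
  shows "x \<in> measure_support \<mu> \<longleftrightarrow> (\<forall>U. open U \<longrightarrow> x \<in> U \<longrightarrow> emeasure (as_measure \<mu>) U \<noteq> 0)"
  using total_variation_positive_measure[OF assms borel_open] by (auto simp: measure_support_def)

lemma open_compl_measure_support:
  assumes "\<mu> \<in> positive_measures"
  shows "open (- measure_support \<mu>)"
proof (subst open_subopen, safe)
  fix x assume "x \<notin> measure_support \<mu>"
  then obtain U where "open U" "x \<in> U" "emeasure (as_measure \<mu>) U = 0"
    using mem_measure_support[OF assms] by auto
  then show "\<exists>T. open T \<and> x \<in> T \<and> T \<subseteq> - measure_support \<mu>"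
    using mem_measure_support[OF assms] by (intro exI[of _ U]) auto
qed

text \<open>The complement of the support is a union of possibly uncountably many open null sets.
  Inner regularity reduces the claim to a compact subset, which finitely many of them cover.\<close>

lemma emeasure_compl_measure_support:
  fixes \<mu> :: "'a::t2_space set \<Rightarrow> complex"
  assumes "\<mu> \<in> positive_measures"
  shows "emeasure (as_measure \<mu>) (- measure_support \<mu>) = 0"
proof (rule ccontr)
  interpret finite_measure "as_measure \<mu>" by (rule finite_as_measure[OF assms(1)])
  let ?O = "- measure_support \<mu>"
  assume "emeasure (as_measure \<mu>) ?O \<noteq> 0"
  then have pos: "measure (as_measure \<mu>) ?O > 0" by (simp add: emeasure_eq_measure zero_less_measure_iff)
  \<comment> \<open>The error allowed is the measure of the complement itself, which forces the
    compact set to have positive measure.\<close>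
  obtain C where C: "compact C" "C \<subseteq> ?O" "measure (as_measure \<mu>) ?O < measure (as_measure \<mu>) C + measure (as_measure \<mu>) ?O"
    using as_measure_inner_regular[OF assms borel_open[OF open_compl_measure_support[OF assms]] pos] by auto
  have "\<forall>x\<in>C. \<exists>U. open U \<and> x \<in> U \<and> emeasure (as_measure \<mu>) U = 0"
    using C(2) mem_measure_support[OF assms] by blast
  then obtain U where U: "\<And>x. x \<in> C \<Longrightarrow> open (U x) \<and> x \<in> U x \<and> emeasure (as_measure \<mu>) (U x) = 0"
    by metis
  obtain D where D: "D \<subseteq> C" "finite D" "C \<subseteq> (\<Union>x\<in>D. U x)"
    using compactE_image[OF C(1), of C U] U by blast
  have "emeasure (as_measure \<mu>) C \<le> emeasure (as_measure \<mu>) (\<Union>x\<in>D. U x)"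
    using D U by (intro emeasure_mono) (auto intro!: borel_open)
  also have "\<dots> \<le> (\<Sum>x\<in>D. emeasure (as_measure \<mu>) (U x))"
    using D U by (intro emeasure_subadditive_finite) (auto intro!: borel_open)
  also have "\<dots> = 0" using D U by (intro sum.neutral) auto
  finally have "measure (as_measure \<mu>) C = 0" by (simp add: measure_def)
  then show False using C by simp
qed

section \<open>Point measures and their finite nonnegative combinations\<close>

lemma complex_borel_point_measure: "complex_borel_measure (point_measure x)"
  unfolding complex_borel_measure_def
proof (intro conjI allI impI)
  fix E :: "nat \<Rightarrow> 'a set" assume E: "range E \<subseteq> sets borel" "disjoint_family E"
  show "(\<lambda>i. point_measure x (E i)) sums point_measure x (\<Union>i. E i)"
  proof (cases "\<exists>i. x \<in> E i")
    case True
    then obtain i where i: "x \<in> E i" by auto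
    then have "x \<notin> E j" if "j \<noteq> i" for j using E(2) that by (auto simp: disjoint_family_on_def)
    then have "point_measure x (E j) = (if j = i then 1 else 0)" for j
      using i E(1) by (auto simp: point_measure_def)
    moreover have "point_measure x (\<Union>i. E i) = 1"
      using i E(1) by (auto simp: point_measure_def)
    ultimately show ?thesis using sums_single[of i "\<lambda>_. 1::complex"] by simp
  qed (auto simp: point_measure_def)
qed (simp add: point_measure_def)

lemma finite_sum_point_measures_positive:
  fixes T :: "'a::t2_space set" and w :: "'a \<Rightarrow> real"
  assumes T: "finite T" and w: "\<And>t. t \<in> T \<Longrightarrow> 0 \<le> w t"
  shows "(\<lambda>E. \<Sum>t\<in>T. complex_of_real (w t) * point_measure t E) \<in> positive_measures"
proof -
  let ?\<mu> = "\<lambda>E. \<Sum>t\<in>T. complex_of_real (w t) * point_measure t E"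
  have cm: "complex_borel_measure ?\<mu>"
    using complex_borel_point_measure unfolding complex_borel_measure_def
    by (auto intro!: sums_sum sums_mult)
  have "\<exists>C U. compact C \<and> open U \<and> C \<subseteq> E \<and> E \<subseteq> U \<and> total_variation ?\<mu> (U - C) < ennreal \<epsilon>"
    if "\<epsilon> > 0" for \<epsilon> E
  proof (intro exI conjI)
    \<comment> \<open>The compact set collects the points of \<open>T\<close> in \<open>E\<close>,
      the open one avoids the other points of \<open>T\<close>, so their difference misses
      \<open>T\<close> altogether.\<close>
    show "compact (T \<inter> E)" using T by (intro finite_imp_compact) auto
    show "open (- (T - E))" using T by (intro open_Compl finite_imp_closed) auto
    have "total_variation ?\<mu> (- (T - E) - T \<inter> E) \<le> 0"
      unfolding total_variation_def
    proof (rule SUP_least)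
      fix P assume P: "P \<in> {P. finite P \<and> P \<subseteq> sets borel \<and> disjoint P \<and> \<Union>P \<subseteq> - (T - E) - T \<inter> E}"
      have "?\<mu> F = 0" if "F \<in> P" for F
        using P that by (intro sum.neutral) (auto simp: point_measure_def)
      then show "(\<Sum>F\<in>P. ennreal (norm (?\<mu> F))) \<le> 0" by simp
    qed
    then show "total_variation ?\<mu> (- (T - E) - T \<inter> E) < ennreal \<epsilon>" using that by simp
  qed auto
  moreover have "?\<mu> E \<in> \<real>\<^sub>\<ge>\<^sub>0" for E
  proof -
    have "?\<mu> E = complex_of_real (\<Sum>t\<in>T. w t * (if E \<in> sets borel \<and> t \<in> E then 1 else 0))"
      by (simp add: point_measure_def) (intro sum.cong, auto)
    also have "\<dots> \<in> \<real>\<^sub>\<ge>\<^sub>0" using w by (subst nonneg_Reals_of_real_iff) (auto intro!: sum_nonneg)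
    finally show ?thesis .
  qed
  ultimately show ?thesis using cm
    by (simp add: positive_measures_def bounded_regular_measures_def)
qed

lemma point_measure_positive: 
  fixes x :: "'a::t2_space"
  shows "point_measure x \<in> positive_measures"
  using finite_sum_point_measures_positive[of "{x}" "\<lambda>_. 1"] by simp

lemma integral_point_measure:
  fixes x :: "'a::t2_space" and f :: "'a \<Rightarrow> 'b::{banach, second_countable_topology}"
  assumes [measurable]: "f \<in> borel_measurable borel"
  shows "(LINT y|as_measure (point_measure x). f y) = f x"
proof -
  have "- {x} \<in> null_sets (as_measure (point_measure x))"
    by (simp add: null_sets_def emeasure_as_measure point_measure_positive) (simp add: point_measure_def)
  then have "AE y in as_measure (point_measure x). f y = f x"
    by (rule AE_I') auto
  then have "(LINT y|as_measure (point_measure x). f y) = (LINT y|as_measure (point_measure x). f x)"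
    by (intro integral_cong_AE) auto
  also have "\<dots> = f x"
    by (simp add: measure_as_measure point_measure_positive) (simp add: point_measure_def)
  finally show ?thesis .
qed

section \<open>The weak topology on bounded regular measures\<close>

definition weak_box ::
    "('a::topological_space set \<Rightarrow> complex) \<Rightarrow> ('a \<Rightarrow> complex) set \<Rightarrow> real \<Rightarrow> ('a set \<Rightarrow> complex) set" where
  "weak_box \<mu> \<Phi> \<epsilon> =
     {\<nu> \<in> bounded_regular_measures. \<forall>f\<in>\<Phi>. dist (cm_integral \<nu> f) (cm_integral \<mu> f) < \<epsilon>}"

text \<open>Induction over the generation of the topology; an intersection joins the two families
  and takes the smaller radius. Finiteness of the family is what lets a discrete measure reach a
  given neighbourhood.\<close>

lemma weak_topology_neighbourhood:
  assumes "openin weak_topology W" "\<mu> \<in> W"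
  shows "\<exists>\<Phi> \<epsilon>. finite \<Phi> \<and> \<epsilon> > 0 \<and> (\<forall>f\<in>\<Phi>. continuous_on UNIV f \<and> bounded (range f)) \<and> weak_box \<mu> \<Phi> \<epsilon> \<subseteq> W"
proof -
  have "generate_topology_on {{\<mu> \<in> bounded_regular_measures. cm_integral \<mu> f \<in> G} | f G.
        continuous_on UNIV f \<and> bounded (range f) \<and> open G} W"
    using assms(1) by (simp add: weak_topology_def openin_topology_generated_by_iff)
  then show ?thesis using assms(2)
  proof induction
    case (Int a b)
    then have "\<mu> \<in> a" "\<mu> \<in> b" by auto
    obtain \<Phi>1 \<epsilon>1 where 1: "finite \<Phi>1" "\<epsilon>1 > 0" "\<forall>f\<in>\<Phi>1. continuous_on UNIV f \<and> bounded (range f)"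
      "weak_box \<mu> \<Phi>1 \<epsilon>1 \<subseteq> a"
      using Int.IH(1)[OF \<open>\<mu> \<in> a\<close>] by auto
    obtain \<Phi>2 \<epsilon>2 where 2: "finite \<Phi>2" "\<epsilon>2 > 0" "\<forall>f\<in>\<Phi>2. continuous_on UNIV f \<and> bounded (range f)"
      "weak_box \<mu> \<Phi>2 \<epsilon>2 \<subseteq> b"
      using Int.IH(2)[OF \<open>\<mu> \<in> b\<close>] by auto
    have "weak_box \<mu> (\<Phi>1 \<union> \<Phi>2) (min \<epsilon>1 \<epsilon>2) \<subseteq> weak_box \<mu> \<Phi>1 \<epsilon>1 \<inter> weak_box \<mu> \<Phi>2 \<epsilon>2"
      by (auto simp: weak_box_def)
    then have "weak_box \<mu> (\<Phi>1 \<union> \<Phi>2) (min \<epsilon>1 \<epsilon>2) \<subseteq> a \<inter> b"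
      using 1(4) 2(4) by blast
    then show ?case
      by (intro exI[of _ "\<Phi>1 \<union> \<Phi>2"] exI[of _ "min \<epsilon>1 \<epsilon>2"]) (use 1(1-3) 2(1-3) in auto)
  next
    case (UN K)
    then obtain k where k: "k \<in> K" "\<mu> \<in> k" by auto
    obtain \<Phi> \<epsilon> where \<Phi>: "finite \<Phi>" "\<epsilon> > 0" "\<forall>f\<in>\<Phi>. continuous_on UNIV f \<and> bounded (range f)"
      "weak_box \<mu> \<Phi> \<epsilon> \<subseteq> k"
      using UN.IH[OF k] by auto
    have "weak_box \<mu> \<Phi> \<epsilon> \<subseteq> \<Union> K" using \<Phi>(4) k by blast
    then show ?case using \<Phi>(1-3) by (intro exI conjI)
  next
    case (Basis s)
    then obtain f G where f: "s = {\<mu> \<in> bounded_regular_measures. cm_integral \<mu> f \<in> G}"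
      "continuous_on UNIV f" "bounded (range f)" "open G" by auto
    then obtain \<epsilon> where \<epsilon>: "\<epsilon> > 0" "ball (cm_integral \<mu> f) \<epsilon> \<subseteq> G"
      using Basis open_contains_ball[of G] by auto
    have "weak_box \<mu> {f} \<epsilon> \<subseteq> s"
      using \<epsilon> by (auto simp: f(1) weak_box_def subset_iff dist_commute)
    then show ?case using f(2,3) \<epsilon>(1)
      by (intro exI[of _ "{f}"] exI[of _ \<epsilon>]) simp
  qed simp
qed

lemma topspace_weak_topology: "topspace weak_topology = bounded_regular_measures"
proof -
  have "\<exists>f G. bounded_regular_measures = {\<mu> \<in> bounded_regular_measures. cm_integral \<mu> f \<in> G} \<and>
      continuous_on UNIV f \<and> bounded (range f) \<and> open G"
    by (rule exI[of _ "\<lambda>_. 0"], rule exI[of _ UNIV]) auto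
  then show ?thesis
    unfolding weak_topology_def topology_generated_by_topspace by blast
qed

lemma continuous_map_cm_integral:
  assumes "continuous_on UNIV f" "bounded (range f)"
  shows "continuous_map weak_topology euclidean (\<lambda>\<mu>. cm_integral \<mu> f)"
  unfolding continuous_map_def
proof (intro conjI allI impI)
  fix G :: "complex set" assume "openin euclidean G"
  then show "openin weak_topology {\<mu> \<in> topspace weak_topology. cm_integral \<mu> f \<in> G}"
    unfolding topspace_weak_topology using assms
    by (auto simp: weak_topology_def openin_topology_generated_by_iff intro!: generate_topology_on.Basis)
qed auto

text \<open>A function integrates against the point mass at x to its value at x, so the preimage of
  a subbasic set is the preimage of an open set under a continuous function.\<close>

lemma continuous_map_point_measure:
  "continuous_map (euclidean :: 'a::t2_space topology) (subtopology weak_topology positive_measures) point_measure"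
proof (rule continuous_map_into_subtopology)
  show "continuous_map (euclidean :: 'a topology) weak_topology point_measure"
    unfolding weak_topology_def
  proof (rule continuous_on_generated_topo)
    fix S :: "('a set \<Rightarrow> complex) set"
    assume "S \<in> {{\<mu> \<in> bounded_regular_measures. cm_integral \<mu> f \<in> G} | f G.
        continuous_on UNIV f \<and> bounded (range f) \<and> open G}"
    then obtain f G where S: "S = {\<mu> \<in> bounded_regular_measures. cm_integral \<mu> f \<in> G}"
      "continuous_on UNIV f" "open G" by auto
    have "point_measure x \<in> S \<longleftrightarrow> f x \<in> G" for x
      using point_measure_positive[of x] integral_point_measure[OF borel_measurable_continuous_onI[OF S(2)], of x]
      by (simp add: S(1) cm_integral_positive_measure) (simp add: positive_measures_def)
    then show "openin euclidean (point_measure -` S \<inter> topspace euclidean)"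
      using open_vimage[OF S(3,2)] by (simp add: vimage_def)
  next
    have "point_measure ` topspace (euclidean :: 'a topology) \<subseteq> topspace (weak_topology :: ('a set \<Rightarrow> complex) topology)"
      using point_measure_positive by (auto simp: topspace_weak_topology positive_measures_def)
    then show "point_measure ` topspace (euclidean :: 'a topology) \<subseteq> \<Union> {{\<mu> \<in> bounded_regular_measures. cm_integral \<mu> f \<in> G} | f G.
        continuous_on UNIV f \<and> bounded (range f) \<and> open (G :: complex set)}"
      unfolding weak_topology_def topology_generated_by_topspace .
  qed
qed (use point_measure_positive in auto)

section \<open>Discrete approximation and operators determined by their values on point
  measures\<close>

lemma nn_integral_sum_measure:
  fixes M :: "'a measure" and N :: "'b \<Rightarrow> 'a measure" and f :: "'a \<Rightarrow> ennreal"
  assumes s: "\<And>t. t \<in> T \<Longrightarrow> sets (N t) = sets M"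
    and e: "\<And>E. E \<in> sets M \<Longrightarrow> emeasure M E = (\<Sum>t\<in>T. w t * emeasure (N t) E)"
    and f: "f \<in> borel_measurable M"
  shows "(\<integral>\<^sup>+x. f x \<partial>M) = (\<Sum>t\<in>T. w t * (\<integral>\<^sup>+x. f x \<partial>N t))"
proof -
  have m: "g \<in> borel_measurable (N t)" if "g \<in> borel_measurable M" "t \<in> T" for g :: "'a \<Rightarrow> ennreal" and t
    using that measurable_cong_sets[OF s[OF that(2)] refl] by auto
  have sp: "space (N t) = space M" if "t \<in> T" for t using s[OF that] by (rule sets_eq_imp_space_eq)
  show ?thesis using f
  proof induction
    case (cong f g)
    have "(\<integral>\<^sup>+x. f x \<partial>M) = (\<integral>\<^sup>+x. g x \<partial>M)" using cong by (intro nn_integral_cong) auto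
    moreover have "(\<integral>\<^sup>+x. f x \<partial>N t) = (\<integral>\<^sup>+x. g x \<partial>N t)" if "t \<in> T" for t
      using cong that by (intro nn_integral_cong) (auto simp: sp)
    ultimately show ?case using cong by simp
  next
    case (set A)
    then show ?case using e s by simp
  next
    case (mult u c)
    then show ?case by (simp add: nn_integral_cmult m sum_distrib_left mult_ac)
  next
    case (add u v)
    then show ?case by (simp add: nn_integral_add m distrib_left sum.distrib)
  next
    case (seq U)
    have "(\<integral>\<^sup>+x. (SUP i. U i) x \<partial>M) = (SUP i. \<integral>\<^sup>+x. U i x \<partial>M)"
      using seq by (simp add: image_comp nn_integral_monotone_convergence_SUP)
    also have "\<dots> = (SUP i. \<Sum>t\<in>T. w t * (\<integral>\<^sup>+x. U i x \<partial>N t))" using seq by simp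
    also have "\<dots> = (\<Sum>t\<in>T. SUP i. w t * (\<integral>\<^sup>+x. U i x \<partial>N t))"
      using seq(3) by (intro ennreal_SUP_sum) (auto simp: incseq_def le_fun_def intro!: mult_left_mono nn_integral_mono)
    also have "\<dots> = (\<Sum>t\<in>T. w t * (SUP i. \<integral>\<^sup>+x. U i x \<partial>N t))"
      by (simp add: SUP_mult_left_ennreal)
    also have "\<dots> = (\<Sum>t\<in>T. w t * (\<integral>\<^sup>+x. (SUP i. U i) x \<partial>N t))"
      using seq by (intro sum.cong refl) (simp add: image_comp nn_integral_monotone_convergence_SUP m)
    finally show ?case .
  qed
qed

lemma integral_finite_sum_point_measures:
  fixes T :: "'a::t2_space set" and w :: "'a \<Rightarrow> real" and f :: "'a \<Rightarrow> complex"
  assumes T: "finite T" and w: "\<And>t. t \<in> T \<Longrightarrow> 0 \<le> w t" and f[measurable]: "f \<in> borel_measurable borel"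
  shows "(LINT x|as_measure (\<lambda>E. \<Sum>t\<in>T. complex_of_real (w t) * point_measure t E). f x)
    = (\<Sum>t\<in>T. complex_of_real (w t) * f t)"
proof -
  define \<nu> where "\<nu> = (\<lambda>E. \<Sum>t\<in>T. complex_of_real (w t) * point_measure t E)"
  have \<nu>: "\<nu> \<in> positive_measures" unfolding \<nu>_def using T w by (rule finite_sum_point_measures_positive)
  interpret finite_measure "as_measure \<nu>" by (rule finite_as_measure[OF \<nu>])
  have Tb: "- T \<in> sets borel" using T by (intro borel_open open_Compl finite_imp_closed)
  have "\<nu> (- T) = 0" unfolding \<nu>_def by (intro sum.neutral) (auto simp: point_measure_def)
  then have "- T \<in> null_sets (as_measure \<nu>)"
    using Tb by (simp add: null_sets_def emeasure_as_measure[OF \<nu>])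
  then have "AE x in as_measure \<nu>. x \<in> T" by (rule AE_I') auto
  then have "AE x in as_measure \<nu>. f x = (\<Sum>t\<in>T. indicator {t} x *\<^sub>R f t)"
  proof eventually_elim
    case (elim x)
    have "(\<Sum>t\<in>T. indicator {t} x *\<^sub>R f t) = (\<Sum>t\<in>T. if x = t then f t else 0)"
      by (intro sum.cong) auto
    then show ?case using T elim by simp
  qed
  then have "(LINT x|as_measure \<nu>. f x) = (LINT x|as_measure \<nu>. (\<Sum>t\<in>T. indicator {t} x *\<^sub>R f t))"
    by (intro integral_cong_AE) auto
  also have "\<dots> = (\<Sum>t\<in>T. measure (as_measure \<nu>) {t} *\<^sub>R f t)"
    by (subst Bochner_Integration.integral_sum)
      (auto intro!: integrable_scaleR_left integrable_real_indicator simp: less_top[symmetric])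
  also have "\<dots> = (\<Sum>t\<in>T. complex_of_real (w t) * f t)"
  proof (intro sum.cong refl)
    fix t assume t: "t \<in> T"
    have "\<nu> {t} = (\<Sum>s\<in>T. if s = t then complex_of_real (w t) else 0)"
      unfolding \<nu>_def by (intro sum.cong) (auto simp: point_measure_def)
    also have "\<dots> = complex_of_real (w t)" using t T by simp
    finally show "measure (as_measure \<nu>) {t} *\<^sub>R f t = complex_of_real (w t) * f t"
      by (simp add: measure_as_measure[OF \<nu>] scaleR_conv_of_real)
  qed
  finally show ?thesis unfolding \<nu>_def .
qed

text \<open>Rounding the values of all functions of the family to a mesh partitions the space into
  finitely many Borel cells on which each of them is nearly constant. The mass of a cell is moved to
  one representative.\<close>

lemma positive_measure_finite_approximation:
  fixes \<mu> :: "'a::t2_space set \<Rightarrow> complex"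
  assumes \<mu>: "\<mu> \<in> positive_measures" and \<Phi>: "finite \<Phi>" and \<epsilon>: "\<epsilon> > 0"
    and f: "\<And>f. f \<in> \<Phi> \<Longrightarrow> f \<in> borel_measurable borel \<and> bounded (range f)"
  obtains T :: "'a set" and w :: "'a \<Rightarrow> real" where "finite T" "\<And>t. 0 \<le> w t"
    "\<And>f. f \<in> \<Phi> \<Longrightarrow> dist (\<Sum>t\<in>T. complex_of_real (w t) * f t) (LINT x|as_measure \<mu>. f x) < \<epsilon>"
proof -
  interpret finite_measure "as_measure \<mu>" by (rule finite_as_measure[OF \<mu>])
  define m where "m = measure (as_measure \<mu>) UNIV"
  \<comment> \<open>Real and imaginary part may each be off by \<delta>, so the total error is at
    most 2 \<delta> m = \<epsilon> m / (m+1). The summand 1 covers m = 0.\<close>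
  define \<delta> where "\<delta> = \<epsilon> / (2 * (m + 1))"
  have m0: "m \<ge> 0" by (simp add: m_def)
  have \<delta>: "\<delta> > 0" using \<epsilon> m0 by (simp add: \<delta>_def)
  \<comment> \<open>The vector of rounded values names the cell of x; \<open>restrict\<close> makes
    it depend on the family only, so that the range lies in a finite product.\<close>
  define c where "c x = restrict (\<lambda>f. (\<lfloor>Re (f x) / \<delta>\<rfloor>, \<lfloor>Im (f x) / \<delta>\<rfloor>)) \<Phi>" for x :: 'a
  have fin: "finite (range c)"
  proof -
    have "\<forall>f\<in>\<Phi>. \<exists>B. \<forall>x. norm (f x) \<le> B" using f by (auto simp: bounded_iff)
    then obtain B where B: "\<And>f x. f \<in> \<Phi> \<Longrightarrow> norm (f x) \<le> B f" by metis
    define I where "I f = {\<lfloor>- (B f) / \<delta>\<rfloor>..\<lfloor>B f / \<delta>\<rfloor>}" for f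
    have "\<lfloor>Re (f x) / \<delta>\<rfloor> \<in> I f \<and> \<lfloor>Im (f x) / \<delta>\<rfloor> \<in> I f" if "f \<in> \<Phi>" for f x
    proof -
      have "- B f \<le> Re (f x)" "Re (f x) \<le> B f" "- B f \<le> Im (f x)" "Im (f x) \<le> B f"
        using B[OF that, of x] abs_Re_le_cmod[of "f x"] abs_Im_le_cmod[of "f x"] by linarith+
      then show ?thesis using \<delta> unfolding I_def atLeastAtMost_iff
        by (intro conjI floor_mono divide_right_mono) auto
    qed
    then have "range c \<subseteq> (\<Pi>\<^sub>E f\<in>\<Phi>. I f \<times> I f)" by (auto simp: c_def)
    moreover have "finite (\<Pi>\<^sub>E f\<in>\<Phi>. I f \<times> I f)" using \<Phi> by (intro finite_PiE) (auto simp: I_def)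
    ultimately show ?thesis by (rule finite_subset)
  qed
  have cm: "{x. c x = c y} \<in> sets borel" for y
  proof -
    have "{x. c x = c y} = {x\<in>space borel. \<forall>f\<in>\<Phi>. \<lfloor>Re (f x) / \<delta>\<rfloor> = \<lfloor>Re (f y) / \<delta>\<rfloor> \<and> \<lfloor>Im (f x) / \<delta>\<rfloor> = \<lfloor>Im (f y) / \<delta>\<rfloor>}"
      by (auto simp: c_def restrict_def fun_eq_iff split: if_splits)
    also have "\<dots> \<in> sets borel"
    proof (intro sets.sets_Collect_finite_All \<Phi>)
      fix f assume "f \<in> \<Phi>"
      then have [measurable]: "f \<in> borel_measurable borel" using f by auto
      show "{x \<in> space borel. \<lfloor>Re (f x) / \<delta>\<rfloor> = \<lfloor>Re (f y) / \<delta>\<rfloor> \<and> \<lfloor>Im (f x) / \<delta>\<rfloor> = \<lfloor>Im (f y) / \<delta>\<rfloor>} \<in> sets borel"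
        by measurable
    qed
    finally show ?thesis .
  qed
  define rep where "rep v = (SOME x. c x = v)" for v
  have rep: "c (rep v) = v" if "v \<in> range c" for v
    unfolding rep_def using that by (auto intro: someI)
  have inj: "inj_on rep (range c)" by (rule inj_on_inverseI[of _ c]) (rule rep)
  \<comment> \<open>Cells are indexed by their representatives, which are distinct for distinct
    cells; the weight of a representative is the mass of its cell.\<close>
  define T where "T = rep ` range c"
  define w where "w t = measure (as_measure \<mu>) {x. c x = c t}" for t
  have near: "norm (f (rep (c x)) - f x) \<le> 2 * \<delta>" if "f \<in> \<Phi>" for f x
  proof -
    have e: "c (rep (c x)) f = c x f" using rep[of "c x"] by simp
    have fl: "\<bar>a - b\<bar> \<le> \<delta>" if "\<lfloor>a / \<delta>\<rfloor> = \<lfloor>b / \<delta>\<rfloor>" for a b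
    proof -
      have "\<bar>a / \<delta> - b / \<delta>\<bar> \<le> 1" using that by linarith
      then show ?thesis using \<delta> by (simp add: diff_divide_distrib[symmetric] divide_le_eq)
    qed
    have "\<bar>Re (f (rep (c x)) - f x)\<bar> \<le> \<delta>" "\<bar>Im (f (rep (c x)) - f x)\<bar> \<le> \<delta>"
      using fl e that by (auto simp: c_def)
    then show ?thesis using cmod_le[of "f (rep (c x)) - f x"] by linarith
  qed
  show ?thesis
  proof (rule that[of T w])
    show "finite T" using fin by (simp add: T_def)
    show "0 \<le> w t" for t by (simp add: w_def)
    fix f assume f': "f \<in> \<Phi>"
    have fm[measurable]: "f \<in> borel_measurable borel" using f f' by auto
    have fi: "integrable (as_measure \<mu>) f"
    proof -
      obtain B where "\<And>x. norm (f x) \<le> B" using f[OF f'] by (auto simp: bounded_iff)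
      then show ?thesis by (intro integrable_const_bound[of _ B]) (auto simp: borel_measurable_as_measure)
    qed
    have s: "f (rep (c x)) = (\<Sum>v\<in>range c. indicator {x. c x = v} x *\<^sub>R f (rep v))" for x
    proof -
      have "(\<Sum>v\<in>range c. indicator {x. c x = v} x *\<^sub>R f (rep v)) = (\<Sum>v\<in>range c. if c x = v then f (rep v) else 0)"
        by (intro sum.cong) auto
      then show ?thesis using fin by simp
    qed
    have cm': "{x. c x = v} \<in> sets borel" if "v \<in> range c" for v using cm that by auto
    have si: "integrable (as_measure \<mu>) (\<lambda>x. indicator {x. c x = v} x *\<^sub>R f (rep v))" if "v \<in> range c" for v
      using cm'[OF that] by (intro integrable_scaleR_left integrable_real_indicator) (auto simp: less_top[symmetric])
    have si': "(LINT x|as_measure \<mu>. indicator {x. c x = v} x *\<^sub>R f (rep v)) = measure (as_measure \<mu>) {x. c x = v} *\<^sub>R f (rep v)"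
      if "v \<in> range c" for v
    proof -
      have "integrable (as_measure \<mu>) (indicator {x. c x = v} :: 'a \<Rightarrow> real)"
        using cm'[OF that] by (intro integrable_real_indicator) (auto simp: less_top[symmetric])
      then show ?thesis using cm'[OF that] by (subst integral_scaleR_left) auto
    qed
    have "(LINT x|as_measure \<mu>. f (rep (c x))) = (\<Sum>v\<in>range c. measure (as_measure \<mu>) {x. c x = v} *\<^sub>R f (rep v))"
      unfolding s using si si' by (subst Bochner_Integration.integral_sum) (auto intro!: sum.cong)
    also have "\<dots> = (\<Sum>t\<in>T. complex_of_real (w t) * f t)"
      unfolding T_def by (subst sum.reindex[OF inj]) (simp add: w_def rep scaleR_conv_of_real)
    finally have "dist (\<Sum>t\<in>T. complex_of_real (w t) * f t) (LINT x|as_measure \<mu>. f x)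
        = norm (LINT x|as_measure \<mu>. f (rep (c x)) - f x)"
      using si fi by (subst Bochner_Integration.integral_diff)
        (auto simp: dist_norm s intro!: Bochner_Integration.integrable_sum)
    also have "\<dots> \<le> (LINT x|as_measure \<mu>. norm (f (rep (c x)) - f x))"
      by (rule integral_norm_bound)
    also have "\<dots> \<le> (LINT x|as_measure \<mu>. 2 * \<delta>)"
    proof (rule integral_mono)
      show "integrable (as_measure \<mu>) (\<lambda>x. norm (f (rep (c x)) - f x))"
        unfolding s using si fi by auto
    qed (use near[OF f'] in auto)
    also have "\<dots> = m * (2 * \<delta>)" by (simp add: m_def)
    also have "\<dots> < \<epsilon>" using \<epsilon> m0 by (simp add: \<delta>_def field_simps)
    finally show "dist (\<Sum>t\<in>T. complex_of_real (w t) * f t) (LINT x|as_measure \<mu>. f x) < \<epsilon>" .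
  qed
qed

lemma nn_integral_bounded_positive_measure:
  assumes \<mu>: "\<mu> \<in> positive_measures" and h: "h \<in> borel_measurable borel" "\<And>x. 0 \<le> h x" "\<And>x. h x \<le> (1::real)"
  shows "integrable (as_measure \<mu>) h"
    and "(\<integral>\<^sup>+x. ennreal (h x) \<partial>as_measure \<mu>) = ennreal (LINT x|as_measure \<mu>. h x)"
proof -
  interpret finite_measure "as_measure \<mu>" by (rule finite_as_measure[OF \<mu>])
  show i: "integrable (as_measure \<mu>) h"
    using h by (intro integrable_const_bound[of _ 1]) (auto simp: borel_measurable_as_measure)
  show "(\<integral>\<^sup>+x. ennreal (h x) \<partial>as_measure \<mu>) = ennreal (LINT x|as_measure \<mu>. h x)"
    using i h by (intro nn_integral_eq_integral) auto
qed

lemma cm_integral_of_real: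
  assumes "\<mu> \<in> positive_measures"
  shows "cm_integral \<mu> (\<lambda>x. complex_of_real (h x)) = complex_of_real (LINT x|as_measure \<mu>. h x)"
  by (simp add: cm_integral_positive_measure[OF assms])

lemma positive_operator_finite_sum:
  fixes \<Psi> :: "('a::t2_space set \<Rightarrow> complex) \<Rightarrow> ('a set \<Rightarrow> complex)"
  assumes lin: "\<And>\<mu> \<nu> a b. \<mu> \<in> bounded_regular_measures \<Longrightarrow> \<nu> \<in> bounded_regular_measures \<Longrightarrow>
        \<Psi> (\<lambda>E. a * \<mu> E + b * \<nu> E) = (\<lambda>E. a * \<Psi> \<mu> E + b * \<Psi> \<nu> E)"
    and T: "finite T" and w: "\<And>t. t \<in> T \<Longrightarrow> 0 \<le> w t"
  shows "\<Psi> (\<lambda>E. \<Sum>t\<in>T. complex_of_real (w t) * point_measure t E)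
    = (\<lambda>E. \<Sum>t\<in>T. complex_of_real (w t) * \<Psi> (point_measure t) E)"
  using T w
proof (induction T rule: finite_induct)
  \<comment> \<open>The value at the zero measure comes from linearity with both coefficients
    0.\<close>
  case empty
  have "point_measure undefined \<in> (bounded_regular_measures :: ('a set \<Rightarrow> complex) set)"
    using point_measure_positive by (auto simp: positive_measures_def)
  from lin[OF this this, of 0 0] show ?case by simp
next
  case (insert s T)
  have b: "point_measure s \<in> bounded_regular_measures"
    "(\<lambda>E. \<Sum>t\<in>T. complex_of_real (w t) * point_measure t E) \<in> bounded_regular_measures"
    using point_measure_positive[of s] finite_sum_point_measures_positive[of T w] insert
    by (auto simp: positive_measures_def)
  show ?case using insert lin[OF b, of "complex_of_real (w s)" 1] by simp
qed

text \<open>Linearity gives the formula for finite combinations of point masses, and weak continuity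
  carries it to \<open>\<mu>\<close>. The abstract \<open>\<Psi>\<close> covers left and right
  convolution by a point mass. The formula is stated with \<open>cm_integral\<close> because
  positivity of \<open>\<Psi> \<mu>\<close> is not among the hypotheses.\<close>

lemma positive_operator_integral:
  fixes \<Psi> :: "('a::t2_space set \<Rightarrow> complex) \<Rightarrow> ('a set \<Rightarrow> complex)" and h :: "'a \<Rightarrow> real"
  assumes closed: "\<And>\<mu>. \<mu> \<in> bounded_regular_measures \<Longrightarrow> \<Psi> \<mu> \<in> bounded_regular_measures"
    and lin: "\<And>\<mu> \<nu> a b. \<mu> \<in> bounded_regular_measures \<Longrightarrow> \<nu> \<in> bounded_regular_measures \<Longrightarrow>
        \<Psi> (\<lambda>E. a * \<mu> E + b * \<nu> E) = (\<lambda>E. a * \<Psi> \<mu> E + b * \<Psi> \<nu> E)"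
    and cont: "continuous_map (subtopology weak_topology positive_measures) weak_topology \<Psi>"
    and pt: "\<And>t. \<Psi> (point_measure t) \<in> probability_measures"
    and \<mu>: "\<mu> \<in> positive_measures"
    and h: "continuous_on UNIV h" "\<And>x. 0 \<le> h x" "\<And>x. h x \<le> 1"
  shows "continuous_on UNIV (\<lambda>t. LINT w|as_measure (\<Psi> (point_measure t)). h w)"
    and "cm_integral (\<Psi> \<mu>) (\<lambda>x. complex_of_real (h x))
      = complex_of_real (LINT t|as_measure \<mu>. (LINT w|as_measure (\<Psi> (point_measure t)). h w))"
proof -
  define H where "H t = (LINT w|as_measure (\<Psi> (point_measure t)). h w)" for t
  let ?h = "\<lambda>x. complex_of_real (h x)"
  have hm: "h \<in> borel_measurable borel" using h(1) by (rule borel_measurable_continuous_onI)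
  have hb: "continuous_on UNIV ?h" "bounded (range ?h)"
    using h by (auto simp: bounded_iff intro!: continuous_intros exI[of _ 1])
  have ptp: "\<Psi> (point_measure t) \<in> positive_measures" for t
    using pt by (auto simp: probability_measures_def)
  have \<Psi>h: "continuous_map (subtopology weak_topology positive_measures) euclidean (\<lambda>\<mu>. cm_integral (\<Psi> \<mu>) ?h)"
    using continuous_map_compose[OF cont continuous_map_cm_integral[OF hb]] by (simp add: o_def)
  from continuous_map_compose[OF continuous_map_point_measure this]
  have "continuous_on UNIV (\<lambda>t. complex_of_real (H t))"
    by (simp add: o_def cm_integral_of_real[OF ptp] H_def)
  then have Hc: "continuous_on UNIV H"
    using continuous_on_Re by fastforce
  then show "continuous_on UNIV (\<lambda>t. LINT w|as_measure (\<Psi> (point_measure t)). h w)"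
    by (simp add: H_def[abs_def])
  have H0: "0 \<le> H t" for t unfolding H_def using h by simp
  have H1: "H t \<le> 1" for t
  proof -
    interpret finite_measure "as_measure (\<Psi> (point_measure t))" by (rule finite_as_measure[OF ptp])
    have "H t \<le> (LINT w|as_measure (\<Psi> (point_measure t)). 1)"
      unfolding H_def using nn_integral_bounded_positive_measure(1)[OF ptp hm h(2,3)] h by (intro integral_mono) auto
    also have "\<dots> = 1" using pt[of t] measure_as_measure[OF ptp[of t], of UNIV]
      by (simp add: probability_measures_def)
    finally show ?thesis .
  qed
  let ?H = "\<lambda>x. complex_of_real (H x)"
  have Hb: "continuous_on UNIV ?H" "bounded (range ?H)"
    using Hc H0 H1 by (auto simp: bounded_iff intro!: continuous_intros exI[of _ 1])
  have fin: "cm_integral (\<Psi> (\<lambda>E. \<Sum>t\<in>T. complex_of_real (w t) * point_measure t E)) ?h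
      = (\<Sum>t\<in>T. complex_of_real (w t) * ?H t)" if T: "finite T" and w: "\<And>t. 0 \<le> w t" for T w
  proof -
    let ?\<nu> = "\<lambda>E. \<Sum>t\<in>T. complex_of_real (w t) * point_measure t E"
    have \<nu>: "?\<nu> \<in> positive_measures" using T w by (intro finite_sum_point_measures_positive)
    have eq: "\<Psi> ?\<nu> = (\<lambda>E. \<Sum>t\<in>T. complex_of_real (w t) * \<Psi> (point_measure t) E)"
      by (rule positive_operator_finite_sum[OF lin T w])
    have eq': "\<Psi> ?\<nu> E = complex_of_real (\<Sum>t\<in>T. w t * Re (\<Psi> (point_measure t) E))" for E
    proof -
      have "complex_of_real (w t) * \<Psi> (point_measure t) E = complex_of_real (w t * Re (\<Psi> (point_measure t) E))" for t
        by (subst positive_measureD(2)[OF ptp]) simp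
      then show ?thesis by (simp only: eq of_real_sum)
    qed
    \<comment> \<open>Positivity is known for images of point masses and passes to nonnegative
      combinations.\<close>
    have pos: "\<Psi> ?\<nu> \<in> positive_measures"
    proof -
      have "\<Psi> ?\<nu> E \<in> \<real>\<^sub>\<ge>\<^sub>0" for E
        unfolding eq' by (subst nonneg_Reals_of_real_iff) (auto intro!: sum_nonneg mult_nonneg_nonneg w positive_measureD(3)[OF ptp])
      moreover have "\<Psi> ?\<nu> \<in> bounded_regular_measures" using \<nu> by (intro closed) (simp add: positive_measures_def)
      ultimately show ?thesis by (simp add: positive_measures_def)
    qed
    have "ennreal (LINT x|as_measure (\<Psi> ?\<nu>). h x) = (\<integral>\<^sup>+x. ennreal (h x) \<partial>as_measure (\<Psi> ?\<nu>))"
      by (rule nn_integral_bounded_positive_measure(2)[OF pos hm h(2,3), symmetric])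
    also have "\<dots> = (\<Sum>t\<in>T. ennreal (w t) * (\<integral>\<^sup>+x. ennreal (h x) \<partial>as_measure (\<Psi> (point_measure t))))"
    proof (rule nn_integral_sum_measure)
      fix E assume "E \<in> sets (as_measure (\<Psi> ?\<nu>))"
      then have E: "E \<in> sets borel" by simp
      show "emeasure (as_measure (\<Psi> ?\<nu>)) E = (\<Sum>t\<in>T. ennreal (w t) * emeasure (as_measure (\<Psi> (point_measure t))) E)"
        using w positive_measureD(3)[OF ptp, of _ E]
        by (simp add: emeasure_as_measure[OF pos E] emeasure_as_measure[OF ptp E] eq' sum_ennreal flip: ennreal_mult)
    qed (use hm in \<open>auto simp: borel_measurable_as_measure\<close>)
    also have "\<dots> = ennreal (\<Sum>t\<in>T. w t * H t)"
      using w H0 by (simp add: nn_integral_bounded_positive_measure(2)[OF ptp hm h(2,3)] sum_ennreal H_def flip: ennreal_mult)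
    finally have "(LINT x|as_measure (\<Psi> ?\<nu>). h x) = (\<Sum>t\<in>T. w t * H t)"
      using h w H0 by (subst (asm) ennreal_inj) (auto intro!: sum_nonneg)
    then show ?thesis by (simp add: cm_integral_of_real[OF pos])
  qed
  let ?I = "complex_of_real (LINT t|as_measure \<mu>. H t)"
  have "dist (cm_integral (\<Psi> \<mu>) ?h) ?I < 2 * \<epsilon>" if \<epsilon>: "\<epsilon> > 0" for \<epsilon>
  proof -
    define S where "S = {\<nu> \<in> topspace (subtopology weak_topology positive_measures). cm_integral (\<Psi> \<nu>) ?h \<in> ball (cm_integral (\<Psi> \<mu>) ?h) \<epsilon>}"
    have "openin (subtopology weak_topology positive_measures) S"
      unfolding S_def by (rule openin_continuous_map_preimage[OF \<Psi>h]) simp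
    then obtain W where W: "openin weak_topology W" "S = W \<inter> positive_measures"
      unfolding openin_subtopology by blast
    have "\<mu> \<in> S"
      unfolding S_def using \<mu> \<epsilon> by (auto simp: topspace_weak_topology positive_measures_def)
    then have "\<mu> \<in> W" using W(2) by blast
    from weak_topology_neighbourhood[OF W(1) this] obtain \<Phi> \<delta> where
      \<Phi>: "finite \<Phi>" "\<delta> > 0" "\<forall>f\<in>\<Phi>. continuous_on UNIV f \<and> bounded (range f)" "weak_box \<mu> \<Phi> \<delta> \<subseteq> W" by auto
    \<comment> \<open>The discrete measure has to match \<open>\<mu>\<close> on the functions that
      keep its image close to that of \<open>\<mu>\<close>, and at the same time on
      \<open>?H\<close>, whose integral is the right-hand side.\<close>
    obtain T :: "'a set" and w where T: "finite T" "\<And>t. 0 \<le> w t" and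
      ap: "\<And>f. f \<in> insert ?H \<Phi> \<Longrightarrow> dist (\<Sum>t\<in>T. complex_of_real (w t) * f t) (LINT x|as_measure \<mu>. f x) < min \<delta> \<epsilon>"
    proof (rule positive_measure_finite_approximation[OF \<mu>, of "insert ?H \<Phi>" "min \<delta> \<epsilon>"])
      fix f assume "f \<in> insert ?H \<Phi>"
      then have "continuous_on UNIV f" "bounded (range f)" using \<Phi>(3) Hb by auto
      then show "f \<in> borel_measurable borel \<and> bounded (range f)"
        by (auto intro: borel_measurable_continuous_onI)
    qed (use \<Phi> \<epsilon> in auto)
    let ?\<nu> = "\<lambda>E. \<Sum>t\<in>T. complex_of_real (w t) * point_measure t E"
    have \<nu>: "?\<nu> \<in> positive_measures" using T by (intro finite_sum_point_measures_positive)
    have \<nu>f: "cm_integral ?\<nu> f = (\<Sum>t\<in>T. complex_of_real (w t) * f t)" if "f \<in> \<Phi>" for f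
    proof -
      have "f \<in> borel_measurable borel" using \<Phi>(3) that by (auto intro: borel_measurable_continuous_onI)
      from integral_finite_sum_point_measures[OF T this] show ?thesis
        unfolding cm_integral_positive_measure[OF \<nu>] .
    qed
    have "dist (cm_integral ?\<nu> f) (cm_integral \<mu> f) < \<delta>" if "f \<in> \<Phi>" for f
      unfolding \<nu>f[OF that] cm_integral_positive_measure[OF \<mu>] using ap[of f] that by simp
    moreover have "?\<nu> \<in> bounded_regular_measures" using \<nu> unfolding positive_measures_def by simp
    ultimately have "?\<nu> \<in> weak_box \<mu> \<Phi> \<delta>" unfolding weak_box_def by blast
    with \<Phi>(4) \<nu> have "?\<nu> \<in> W \<inter> positive_measures" by blast
    then have "dist (cm_integral (\<Psi> \<mu>) ?h) (cm_integral (\<Psi> ?\<nu>) ?h) < \<epsilon>"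
      unfolding W(2)[symmetric] S_def by simp
    moreover have "dist (cm_integral (\<Psi> ?\<nu>) ?h) ?I < \<epsilon>"
      unfolding fin[OF T] using ap[of ?H] by simp
    ultimately show ?thesis
      using dist_triangle[of "cm_integral (\<Psi> \<mu>) ?h" ?I "cm_integral (\<Psi> ?\<nu>) ?h"] by linarith
  qed
  note lt = this
  have "dist (cm_integral (\<Psi> \<mu>) ?h) ?I \<le> 0"
  proof (rule field_le_epsilon)
    fix d :: real assume "0 < d"
    then show "dist (cm_integral (\<Psi> \<mu>) ?h) ?I \<le> 0 + d" using lt[of "d / 2"] by simp
  qed
  then show "cm_integral (\<Psi> \<mu>) (\<lambda>x. complex_of_real (h x))
      = complex_of_real (LINT t|as_measure \<mu>. (LINT w|as_measure (\<Psi> (point_measure t)). h w))"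
    by (simp add: H_def)
qed

section \<open>Convolution of point measures\<close>

lemma Hausdorff_space_euclidean_t2: "Hausdorff_space (euclidean :: 'a::t2_space topology)"
  unfolding Hausdorff_space_def
proof (intro allI impI)
  fix x y :: 'a assume "x \<in> topspace euclidean \<and> y \<in> topspace euclidean \<and> x \<noteq> y"
  then obtain U V where "open U" "open V" "x \<in> U" "y \<in> V" "U \<inter> V = {}"
    using hausdorff[of x y] by auto
  then show "\<exists>U V. openin euclidean U \<and> openin euclidean V \<and> x \<in> U \<and> y \<in> V \<and> disjnt U V"
    by (intro exI[of _ U] exI[of _ V]) (simp add: disjnt_def)
qed

lemma ennreal_less_ennreal_iff: "ennreal c < ennreal m \<longleftrightarrow> max 0 c < m"
  by (cases "c \<ge> 0") (auto simp: ennreal_less_iff ennreal_neg max_def)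

lemma compact_point_separation:
  fixes S :: "'a::t2_space set"
  assumes "compact S" "a \<notin> S"
  obtains U V where "open U" "open V" "a \<in> U" "S \<subseteq> V" "U \<inter> V = {}"
  using Hausdorff_space_compact_separation[OF Hausdorff_space_euclidean_t2, of "{a}" S] assms
  by (metis compactin_euclidean_iff disjnt_def disjnt_insert1 disjnt_empty1 finite_imp_compact finite.emptyI
      finite_insert insert_subset open_openin)

context hypergroup
begin

definition point_conv :: "'a \<Rightarrow> 'a \<Rightarrow> 'a measure" where
  "point_conv x y = as_measure (conv (point_measure x) (point_measure y))"

lemma translation_eq: "translation conv x f y = (\<integral>\<^sup>+z. f z \<partial>point_conv x y)"
  by (simp add: translation_def point_conv_def as_measure_def)

lemma conv_point_positive: "conv (point_measure x) (point_measure y) \<in> positive_measures"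
  using point_conv_probability by (simp add: probability_measures_def)

lemma sets_point_conv [simp, measurable_cong]: "sets (point_conv x y) = sets borel"
  by (simp add: point_conv_def)

lemma space_point_conv [simp]: "space (point_conv x y) = UNIV"
  by (simp add: point_conv_def)

lemma emeasure_point_conv_UNIV [simp]: "emeasure (point_conv x y) UNIV = 1"
  using point_conv_probability[of x y] emeasure_as_measure[OF conv_point_positive, of UNIV x y]
  by (simp add: point_conv_def probability_measures_def)

lemma finite_measure_point_conv: "finite_measure (point_conv x y)"
  unfolding point_conv_def by (rule finite_as_measure[OF conv_point_positive])

lemma emeasure_point_conv_le_1: "emeasure (point_conv x y) E \<le> 1"
  using emeasure_space[of "point_conv x y" E] by simp

lemma integrable_point_conv:
  assumes "h \<in> borel_measurable borel" "\<And>x. 0 \<le> h x" "\<And>x. h x \<le> (1::real)"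
  shows "integrable (point_conv x y) h"
  unfolding point_conv_def by (rule nn_integral_bounded_positive_measure(1)[OF conv_point_positive assms])

abbreviation supp :: "'a \<Rightarrow> 'a \<Rightarrow> 'a set" where
  "supp x y \<equiv> measure_support (conv (point_measure x) (point_measure y))"

lemma point_measure_bounded_regular: "point_measure x \<in> bounded_regular_measures" for x :: 'a
  using point_measure_positive[of x] by (simp add: positive_measures_def)

lemma continuous_map_conv_left:
  "continuous_map (subtopology weak_topology positive_measures) weak_topology (conv (point_measure a))"
proof -
  have "continuous_map (subtopology weak_topology positive_measures)
      (prod_topology (subtopology weak_topology positive_measures) (subtopology weak_topology positive_measures))
      (\<lambda>\<mu>. (point_measure a, \<mu>))"
    by (intro continuous_map_pairedI) (auto simp: topspace_weak_topology point_measure_positive point_measure_bounded_regular)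
  from continuous_map_compose[OF this conv_weakly_continuous] show ?thesis by (simp add: o_def)
qed

lemma continuous_map_conv_right:
  "continuous_map (subtopology weak_topology positive_measures) weak_topology (\<lambda>\<mu>. conv \<mu> (point_measure a))"
proof -
  have "continuous_map (subtopology weak_topology positive_measures)
      (prod_topology (subtopology weak_topology positive_measures) (subtopology weak_topology positive_measures))
      (\<lambda>\<mu>. (\<mu>, point_measure a))"
    by (intro continuous_map_pairedI) (auto simp: topspace_weak_topology point_measure_positive point_measure_bounded_regular)
  from continuous_map_compose[OF this conv_weakly_continuous] show ?thesis by (simp add: o_def)
qed

text \<open>Together with its counterpart for right convolution, this turns the two sides of the
  associative law into iterated integrals over convolutions of points.\<close>

lemma conv_left_integral:
  assumes "\<mu> \<in> positive_measures" "continuous_on UNIV h" "\<And>x. 0 \<le> h x" "\<And>x. h x \<le> (1::real)"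
  shows "continuous_on UNIV (\<lambda>t. LINT w|point_conv a t. h w)"
    and "cm_integral (conv (point_measure a) \<mu>) (\<lambda>x. complex_of_real (h x))
      = complex_of_real (LINT t|as_measure \<mu>. (LINT w|point_conv a t. h w))"
  unfolding point_conv_def
  by (rule positive_operator_integral[OF conv_closed[OF point_measure_bounded_regular]
        conv_linear_right[OF point_measure_bounded_regular] continuous_map_conv_left point_conv_probability assms]; assumption)+

lemma conv_right_integral:
  assumes "\<mu> \<in> positive_measures" "continuous_on UNIV h" "\<And>x. 0 \<le> h x" "\<And>x. h x \<le> (1::real)"
  shows "cm_integral (conv \<mu> (point_measure a)) (\<lambda>x. complex_of_real (h x))
      = complex_of_real (LINT t|as_measure \<mu>. (LINT w|point_conv t a. h w))"
  unfolding point_conv_def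
  by (rule positive_operator_integral(2)[where \<Psi> = "\<lambda>\<mu>. conv \<mu> (point_measure a)",
        OF conv_closed[OF _ point_measure_bounded_regular]
        conv_linear_left[OF _ _ point_measure_bounded_regular] continuous_map_conv_right point_conv_probability assms]; assumption)

lemma continuous_point_conv_integral:
  assumes h: "continuous_on UNIV h" "\<And>x. 0 \<le> h x" "\<And>x. h x \<le> (1::real)"
  shows "continuous_on UNIV (\<lambda>(x, y). LINT w|point_conv x y. h w)"
proof -
  let ?h = "\<lambda>x. complex_of_real (h x)"
  let ?P = "subtopology weak_topology positive_measures :: ('a set \<Rightarrow> complex) topology"
  have hb: "continuous_on UNIV ?h" "bounded (range ?h)"
    using h by (auto simp: bounded_iff intro!: continuous_intros exI[of _ 1])
  have "continuous_map (prod_topology euclidean euclidean) (prod_topology ?P ?P)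
      (\<lambda>(x, y). (point_measure x, point_measure y))"
    by (simp only: continuous_map_prod_top continuous_map_point_measure simp_thms)
  from continuous_map_compose[OF continuous_map_compose[OF this conv_weakly_continuous] continuous_map_cm_integral[OF hb]]
  have "continuous_on UNIV (\<lambda>z. complex_of_real (case z of (x, y) \<Rightarrow> LINT w|point_conv x y. h w))"
    by (simp add: o_def case_prod_unfold cm_integral_of_real[OF conv_point_positive] point_conv_def)
  from continuous_on_Re[OF this] show ?thesis by (simp add: case_prod_unfold)
qed

lemma compact_neighbourhood: "\<exists>V C. open V \<and> compact C \<and> x \<in> V \<and> V \<subseteq> C" for x :: 'a
proof -
  have "openin (top_of_set (UNIV :: 'a set)) UNIV \<and> x \<in> UNIV" by simp
  then obtain V C where "openin (top_of_set (UNIV :: 'a set)) V" "compact C" "x \<in> V" "V \<subseteq> C"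
    using locally_compact unfolding locally_def by meson
  then show ?thesis by (intro exI[of _ V] exI[of _ C]) simp
qed

lemma Urysohn_compact_open:
  fixes C U :: "'a set"
  assumes "compact C" "open U" "C \<subseteq> U"
  obtains h :: "'a \<Rightarrow> real" where "continuous_on UNIV h" "\<And>x. 0 \<le> h x" "\<And>x. h x \<le> 1"
    "\<And>x. x \<in> C \<Longrightarrow> h x = 1" "\<And>x. x \<notin> U \<Longrightarrow> h x = 0"
proof -
  have "locally_compact_space (euclidean :: 'a topology)"
    unfolding locally_compact_space_def using compact_neighbourhood by (simp add: compactin_euclidean_iff)
  then have "completely_regular_space (euclidean :: 'a topology)"
    by (intro locally_compact_regular_imp_completely_regular_space) (auto simp: Hausdorff_space_euclidean_t2)
  then obtain h where h: "continuous_map euclidean (top_of_set {0..1::real}) h" "h ` (- U) \<subseteq> {0}" "h ` C \<subseteq> {1}"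
    using Urysohn_completely_regular_compact_closed[of 0 1 euclidean C "- U"] assms
    by (auto simp: disjnt_def closed_Compl)
  then have "continuous_on UNIV h" "\<And>x. h x \<in> {0..1}"
    by (auto simp: continuous_map_in_subtopology)
  then show thesis using h by (intro that[of h]) auto
qed

text \<open>Lower semicontinuity of the mass of \<open>U\<close>. A Urysohn function between a
  compact subset of nearly full mass and \<open>U\<close> has an integral that is continuous in
  (x,y), exceeds the threshold at the given point and never exceeds the mass of
  \<open>U\<close>.\<close>

lemma open_point_conv_greater:
  assumes U: "open U"
  shows "open {(x, y). emeasure (point_conv x y) U > ennreal c}"
proof (subst open_subopen, safe)
  fix x y assume gt: "emeasure (point_conv x y) U > ennreal c"
  interpret finite_measure "point_conv x y" by (rule finite_measure_point_conv)
  \<comment> \<open>\<open>ennreal\<close> sends negative numbers to 0, so the real threshold is max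
    0 c.\<close>
  define \<epsilon> where "\<epsilon> = measure (point_conv x y) U - max 0 c"
  have \<epsilon>: "\<epsilon> > 0" using gt by (simp add: \<epsilon>_def emeasure_eq_measure ennreal_less_ennreal_iff)
  obtain C where C: "compact C" "C \<subseteq> U" "measure (point_conv x y) U < measure (point_conv x y) C + \<epsilon>"
    using as_measure_inner_regular[OF conv_point_positive borel_open[OF U] \<epsilon>, of x y] by (auto simp: point_conv_def)
  obtain h where h: "continuous_on UNIV h" "\<And>x. 0 \<le> h x" "\<And>x. h x \<le> (1::real)"
    "\<And>x. x \<in> C \<Longrightarrow> h x = 1" "\<And>x. x \<notin> U \<Longrightarrow> h x = 0"
    using Urysohn_compact_open[OF C(1) U C(2)] by blast
  have hm[measurable]: "h \<in> borel_measurable borel" using h(1) by (rule borel_measurable_continuous_onI)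
  have Cm: "C \<in> sets borel" using C(1) by (rule borel_compact)
  have up: "(LINT w|point_conv s t. h w) \<le> measure (point_conv s t) U" for s t
  proof -
    interpret st: finite_measure "point_conv s t" by (rule finite_measure_point_conv)
    have "(LINT w|point_conv s t. h w) \<le> (LINT w|point_conv s t. indicator U w)"
      using U h by (intro integral_mono integrable_point_conv hm h) (auto split: split_indicator)
    also have "\<dots> = measure (point_conv s t) U" using U by simp
    finally show ?thesis .
  qed
  have "max 0 c < measure (point_conv x y) C" using C(3) by (simp add: \<epsilon>_def)
  also have "\<dots> = (LINT w|point_conv x y. indicator C w)" using Cm by simp
  also have "\<dots> \<le> (LINT w|point_conv x y. h w)"
    using Cm h by (intro integral_mono integrable_point_conv hm h) (auto split: split_indicator)
  finally have low: "max 0 c < (LINT w|point_conv x y. h w)" .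
  let ?T = "{(x, y). max 0 c < (LINT w|point_conv x y. h w)}"
  have "open ?T"
    using open_Collect_less[OF continuous_on_const[of UNIV "max 0 c"] continuous_point_conv_integral[OF h(1-3)]]
    by (simp add: case_prod_unfold)
  moreover have "?T \<subseteq> {(x, y). emeasure (point_conv x y) U > ennreal c}"
  proof safe
    fix s t assume "max 0 c < (LINT w|point_conv s t. h w)"
    also have "\<dots> \<le> measure (point_conv s t) U" by (rule up)
    finally show "ennreal c < emeasure (point_conv s t) U"
      by (simp add: finite_measure.emeasure_eq_measure[OF finite_measure_point_conv] ennreal_less_ennreal_iff)
  qed
  ultimately show "\<exists>T. open T \<and> (x, y) \<in> T \<and> T \<subseteq> {(x, y). emeasure (point_conv x y) U > ennreal c}"
    using low by blast
qed

section \<open>Supports of convolutions of point measures\<close>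

lemma mem_supp: "z \<in> supp x y \<longleftrightarrow> (\<forall>U. open U \<longrightarrow> z \<in> U \<longrightarrow> emeasure (point_conv x y) U \<noteq> 0)"
  unfolding point_conv_def by (rule mem_measure_support[OF conv_point_positive])

lemma emeasure_point_conv_disjoint_supp:
  assumes "open U" "U \<inter> supp x y = {}"
  shows "emeasure (point_conv x y) U = 0"
proof -
  have "emeasure (point_conv x y) U \<le> emeasure (point_conv x y) (- supp x y)"
    using assms open_compl_measure_support[OF conv_point_positive] by (intro emeasure_mono) auto
  then show ?thesis using emeasure_compl_measure_support[OF conv_point_positive] by (simp add: point_conv_def)
qed

text \<open>Upper semicontinuity of the support, from the Michael basic set with V the whole space.
  Total mass 1 makes the supports nonempty, as membership in that set requires.\<close>

lemma open_supp_subset: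
  assumes "open W"
  shows "open {(x, y). supp x y \<subseteq> W}"
proof -
  have "openin michael_topology {L. compact L \<and> L \<noteq> {} \<and> L \<inter> UNIV \<noteq> {} \<and> L \<subseteq> W}"
    unfolding michael_topology_def openin_topology_generated_by_iff using assms
    by (intro generate_topology_on.Basis) blast
  from openin_continuous_map_preimage[OF support_continuous this]
  have "open {(x, y). compact (supp x y) \<and> supp x y \<noteq> {} \<and> supp x y \<subseteq> W}"
    by (simp add: case_prod_unfold)
  moreover have "supp x y \<noteq> {}" for x y
    using emeasure_point_conv_disjoint_supp[of UNIV x y] by auto
  ultimately show ?thesis using point_conv_compact_support by simp
qed

text \<open>Compare both sides of $\delta_{n^\sim} * (\delta_x * \delta_z) = (\delta_{n^\sim} * \delta_x) * \delta_z$
  near $e$.\<close>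

lemma supp_adjoint:
  assumes n: "n \<in> supp x z"
  shows "z \<in> supp (invol x) n"
proof (rule ccontr)
  assume z: "z \<notin> supp (invol x) n"
  \<comment> \<open>The involution carries the convolution at (n~, x) to the one at (x~, n), hence
    the support of the first to that of the second.\<close>
  have "invol z \<notin> supp (invol n) x"
  proof
    assume a: "invol z \<in> supp (invol n) x"
    have "z \<in> supp (invol x) n"
      unfolding mem_supp
    proof (intro allI impI)
      fix U assume U: "open U" "z \<in> U"
      have o: "open (invol -` U)" using invol_continuous U(1) by (rule open_vimage[rotated])
      then have "emeasure (point_conv (invol n) x) (invol -` U) \<noteq> 0"
        using a U unfolding mem_supp by (auto simp: invol_invol)
      moreover have "emeasure (point_conv (invol x) n) U = emeasure (point_conv (invol n) x) (invol -` U)"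
        using invol_conv[of "invol n" x] U(1) o
        by (auto simp: point_conv_def emeasure_as_measure[OF conv_point_positive] image_measure_def invol_invol fun_eq_iff dest!: spec[of _ U])
      ultimately show "emeasure (point_conv (invol x) n) U \<noteq> 0" by simp
    qed
    then show False using z by simp
  qed
  define S where "S = supp (invol n) x"
  \<comment> \<open>For t in the compact set S, \<open>e\<close> is outside \<open>supp t z\<close>,
    as otherwise t = z~. Upper semicontinuity makes this locally uniform in t, and finitely many t
    suffice.\<close>
  have "\<exists>V. open V \<and> e \<in> V \<and> (\<forall>t\<in>S. emeasure (point_conv t z) V = 0)"
  proof -
    have "\<exists>T V. open T \<and> t \<in> T \<and> open V \<and> e \<in> V \<and> (\<forall>s\<in>T. emeasure (point_conv s z) V = 0)" if "t \<in> S" for t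
    proof -
      have "e \<notin> supp t z" using that \<open>invol z \<notin> supp (invol n) x\<close> identity_in_support_iff[of t z] by (auto simp: S_def)
      then obtain V W where VW: "open V" "open W" "e \<in> V" "supp t z \<subseteq> W" "V \<inter> W = {}"
        using compact_point_separation[OF point_conv_compact_support[of t z]] by metis
      have "open {s. supp s z \<subseteq> W}"
      proof -
        have "{s. supp s z \<subseteq> W} = (\<lambda>s. (s, z)) -` {(x, y). supp x y \<subseteq> W}" by auto
        also have "open \<dots>" by (intro open_vimage open_supp_subset VW continuous_intros)
        finally show ?thesis .
      qed
      moreover have "emeasure (point_conv s z) V = 0" if "supp s z \<subseteq> W" for s
        using that VW by (intro emeasure_point_conv_disjoint_supp) auto
      ultimately show ?thesis using VW by (intro exI[of _ "{s. supp s z \<subseteq> W}"] exI[of _ V]) auto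
    qed
    then obtain T V where TV: "\<And>t. t \<in> S \<Longrightarrow> open (T t) \<and> t \<in> T t \<and> open (V t) \<and> e \<in> V t \<and> (\<forall>s\<in>T t. emeasure (point_conv s z) (V t) = 0)"
      by metis
    obtain D where D: "D \<subseteq> S" "finite D" "S \<subseteq> (\<Union>t\<in>D. T t)"
      using compactE_image[OF point_conv_compact_support[of "invol n" x, folded S_def], of S T] TV by blast
    have "open (\<Inter>t\<in>D. V t)" using D TV by (intro open_INT) auto
    moreover have "e \<in> (\<Inter>t\<in>D. V t)" using D TV by auto
    moreover have "emeasure (point_conv s z) (\<Inter>t\<in>D. V t) = 0" if "s \<in> S" for s
    proof -
      obtain t where t: "t \<in> D" "s \<in> T t" using D(3) \<open>s \<in> S\<close> by blast
      have "emeasure (point_conv s z) (\<Inter>t\<in>D. V t) \<le> emeasure (point_conv s z) (V t)"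
        using t TV D by (intro emeasure_mono) (auto intro!: borel_open)
      then show ?thesis using TV t D by auto
    qed
    ultimately show ?thesis by blast
  qed
  then obtain V where V: "open V" "e \<in> V" "\<And>t. t \<in> S \<Longrightarrow> emeasure (point_conv t z) V = 0" by blast
  obtain h where h: "continuous_on UNIV h" "\<And>x. 0 \<le> h x" "\<And>x. h x \<le> (1::real)"
    "\<And>x. x \<in> {e} \<Longrightarrow> h x = 1" "\<And>x. x \<notin> V \<Longrightarrow> h x = 0"
    by (rule Urysohn_compact_open[of "{e}" V]) (use V in auto)
  have hm[measurable]: "h \<in> borel_measurable borel" using h(1) by (rule borel_measurable_continuous_onI)
  let ?h = "\<lambda>x. complex_of_real (h x)"
  define G where "G t = (LINT w|point_conv (invol n) t. h w)" for t
  have Gc: "continuous_on UNIV G"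
    unfolding G_def by (rule conv_left_integral(1)[OF point_measure_positive h(1-3)])
  have Gm[measurable]: "G \<in> borel_measurable borel" using Gc by (rule borel_measurable_continuous_onI)
  have Gb: "0 \<le> G t" "G t \<le> 1" for t
  proof -
    interpret finite_measure "point_conv (invol n) t" by (rule finite_measure_point_conv)
    show "0 \<le> G t" unfolding G_def using h by simp
    have "G t \<le> (LINT w|point_conv (invol n) t. 1)"
      unfolding G_def using h by (intro integral_mono integrable_point_conv hm h) auto
    also have "\<dots> = 1" by (simp add: measure_def)
    finally show "G t \<le> 1" .
  qed
  have assoc: "conv (conv (point_measure (invol n)) (point_measure x)) (point_measure z)
      = conv (point_measure (invol n)) (conv (point_measure x) (point_measure z))"
    by (intro conv_assoc point_measure_bounded_regular)
  have "complex_of_real (LINT t|point_conv x z. G t) = cm_integral (conv (point_measure (invol n)) (conv (point_measure x) (point_measure z))) ?h"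
    unfolding G_def point_conv_def[of x z]
    by (rule conv_left_integral(2)[OF conv_point_positive h(1-3), symmetric])
  also have "\<dots> = complex_of_real (LINT t|point_conv (invol n) x. (LINT w|point_conv t z. h w))"
    unfolding assoc[symmetric] point_conv_def[of "invol n" x]
    by (rule conv_right_integral[OF conv_point_positive h(1-3)])
  \<comment> \<open>The outer measure lives on S, and for t in S the inner one gives no mass to V,
    off which h vanishes.\<close>
  also have "(LINT t|point_conv (invol n) x. (LINT w|point_conv t z. h w)) = 0"
  proof (rule integral_eq_zero_AE)
    have "- S \<in> null_sets (point_conv (invol n) x)"
      using open_compl_measure_support[OF conv_point_positive] emeasure_compl_measure_support[OF conv_point_positive]
      by (auto simp: null_sets_def S_def point_conv_def)
    then have "AE t in point_conv (invol n) x. t \<in> S" by (rule AE_I') auto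
    then show "AE t in point_conv (invol n) x. (LINT w|point_conv t z. h w) = 0"
    proof eventually_elim
      case (elim t)
      have "V \<in> null_sets (point_conv t z)" using V elim by (simp add: null_sets_def)
      then have "AE w in point_conv t z. h w = 0" by (rule AE_I') (use h(5) in auto)
      then show ?case by (rule integral_eq_zero_AE)
    qed
  qed
  finally have G0: "(LINT t|point_conv x z. G t) = 0" by simp
  have AE0: "AE t in point_conv x z. G t = 0"
    using integral_nonneg_eq_0_iff_AE[OF integrable_point_conv[OF Gm Gb], of x z] G0 Gb by auto
  \<comment> \<open>\<open>e\<close> lies in the support at (n~, n) and h > 1/2 near
    \<open>e\<close>. By continuity G is positive near n, a point of \<open>supp x z\<close>,
    against G = 0 a.e.\<close>
  have "G n > 0"
  proof -
    let ?B = "{w. h w > 1 / 2}"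
    have "open ?B" using h(1) by (intro open_Collect_less continuous_intros)
    moreover have "e \<in> ?B" using h(4) by simp
    moreover have "e \<in> supp (invol n) n" by (simp add: identity_in_support_iff)
    ultimately have pos: "emeasure (point_conv (invol n) n) ?B \<noteq> 0" unfolding mem_supp by blast
    have "G n \<noteq> 0"
    proof
      assume "G n = 0"
      then have "AE w in point_conv (invol n) n. h w = 0"
        using integral_nonneg_eq_0_iff_AE[OF integrable_point_conv[OF hm h(2,3)], of "invol n" n] h
        by (auto simp: G_def)
      then have "AE w in point_conv (invol n) n. w \<notin> ?B" by eventually_elim auto
      then show False using pos \<open>open ?B\<close> AE_iff_measurable[of ?B "point_conv (invol n) n" "\<lambda>w. w \<notin> ?B"] by auto
    qed
    then show ?thesis using Gb(1)[of n] by simp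
  qed
  moreover have oG: "open {t. G t > 0}" using Gc by (intro open_Collect_less continuous_intros)
  ultimately have "emeasure (point_conv x z) {t. G t > 0} \<noteq> 0" using n unfolding mem_supp by blast
  moreover have "AE t in point_conv x z. t \<notin> {t. G t > 0}" using AE0 by eventually_elim auto
  ultimately show False using oG AE_iff_measurable[of "{t. G t > 0}" "point_conv x z" "\<lambda>t. t \<notin> {t. G t > 0}"] by auto
qed

end

section \<open>Radon measures on products\<close>

text \<open>The cover consists of open sets because approximation by compact sets from inside is
  part of \<open>radon_measure\<close> for open sets, and intersecting with an open set keeps
  openness.\<close>

locale sigma_finite_radon =
  fixes M :: "'a::t2_space measure"
  assumes radon: "radon_measure M"
    and finite_open_cover: "\<exists>U :: nat \<Rightarrow> 'a set. (\<forall>n. open (U n) \<and> emeasure M (U n) < \<infinity>) \<and> (\<Union>n. U n) = UNIV"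
begin

lemma sets_M [simp, measurable_cong]: "sets M = sets borel"
  using radon by (simp add: radon_measure_def)

lemma space_M [simp]: "space M = UNIV"
  using sets_eq_imp_space_eq[OF sets_M] by simp

sublocale sigma_finite_measure M
proof
  obtain U :: "nat \<Rightarrow> 'a set" where U: "\<And>n. open (U n)" "\<And>n. emeasure M (U n) < \<infinity>" "(\<Union>n. U n) = UNIV"
    using finite_open_cover by auto
  then show "\<exists>A. countable A \<and> A \<subseteq> sets M \<and> \<Union> A = space M \<and> (\<forall>a\<in>A. emeasure M a \<noteq> \<infinity>)"
    by (intro exI[of _ "range U"]) (auto intro!: borel_open simp: less_top)
qed

lemma emeasure_compact_finite: "compact C \<Longrightarrow> emeasure M C < \<infinity>"
  using radon by (simp add: radon_measure_def)

lemma emeasure_outer: "E \<in> sets borel \<Longrightarrow> emeasure M E = (INF U \<in> {U. open U \<and> E \<subseteq> U}. emeasure M U)"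
  using radon unfolding radon_measure_def by blast

lemma emeasure_inner: "open U \<Longrightarrow> emeasure M U = (SUP C \<in> {C. compact C \<and> C \<subseteq> U}. emeasure M C)"
  using radon unfolding radon_measure_def by blast

text \<open>A substitute for second countability.\<close>

lemma countable_subfamily_AE:
  assumes \<U>: "\<And>U. U \<in> \<U> \<Longrightarrow> open U"
  shows "\<exists>\<V>. countable \<V> \<and> \<V> \<subseteq> \<U> \<and> (AE x in M. x \<in> \<Union>\<U> \<longrightarrow> x \<in> \<Union>\<V>)"
proof -
  obtain U :: "nat \<Rightarrow> 'a set" where U: "\<And>n. open (U n)" "\<And>n. emeasure M (U n) < \<infinity>" "(\<Union>n. U n) = UNIV"
    using finite_open_cover by auto
  define O' where "O' n = \<Union>\<U> \<inter> U n" for n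
  have O'o: "open (O' n)" for n unfolding O'_def by (intro open_Int open_Union ballI U \<U>)
  have O'f: "emeasure M (O' n) < \<infinity>" for n
    using le_less_trans[OF emeasure_mono U(2)[of n], of "O' n"] U(1) by (auto simp: O'_def intro!: borel_open)
  \<comment> \<open>Countably many compact subsets exhaust the measure of \<open>O' n\<close>. Each
    is covered by finitely many members of the family, and all these members together form the
    countable subfamily.\<close>
  have "\<exists>C :: nat \<Rightarrow> 'a set. (\<forall>m. compact (C m) \<and> C m \<subseteq> O' n) \<and> emeasure M (O' n) = (SUP m. emeasure M (C m))" for n
  proof -
    have "{C. compact C \<and> C \<subseteq> O' n} \<noteq> {}" by (auto intro: compact_empty)
    from ennreal_SUP_countable_SUP[OF this, of "emeasure M"] obtain f :: "nat \<Rightarrow> ennreal" where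
      f: "range f \<subseteq> emeasure M ` {C. compact C \<and> C \<subseteq> O' n}" "(SUP C\<in>{C. compact C \<and> C \<subseteq> O' n}. emeasure M C) = Sup (range f)"
      by auto
    have "\<exists>C. compact C \<and> C \<subseteq> O' n \<and> f m = emeasure M C" for m using f(1) by blast
    then obtain C where C: "\<And>m. compact (C m) \<and> C m \<subseteq> O' n \<and> f m = emeasure M (C m)" by metis
    then have "(\<lambda>m. emeasure M (C m)) = f" by auto
    then show ?thesis using C f(2) emeasure_inner[OF O'o[of n]] by (intro exI[of _ C]) auto
  qed
  then obtain C :: "nat \<Rightarrow> nat \<Rightarrow> 'a set" where
    C: "\<And>n m. compact (C n m) \<and> C n m \<subseteq> O' n" "\<And>n. emeasure M (O' n) = (SUP m. emeasure M (C n m))"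
    by metis
  have "\<exists>D. D \<subseteq> \<U> \<and> finite D \<and> C n m \<subseteq> \<Union>D" for n m
  proof -
    have "compact (C n m)" "C n m \<subseteq> \<Union>\<U>" using C(1)[of n m] by (auto simp: O'_def)
    from compactE[OF this \<U>] obtain D where "D \<subseteq> \<U>" "finite D" "C n m \<subseteq> \<Union>D" by blast
    then show ?thesis by blast
  qed
  then obtain D where D: "\<And>n m. D n m \<subseteq> \<U> \<and> finite (D n m) \<and> C n m \<subseteq> \<Union>(D n m)" by metis
  define \<V> where "\<V> = (\<Union>n m. D n m)"
  have cV: "countable \<V>" unfolding \<V>_def by (intro countable_UN countableI_type countable_finite) (use D in blast)
  have VU: "\<V> \<subseteq> \<U>" unfolding \<V>_def using D by auto
  have oV: "open (\<Union>\<V>)" using VU by (intro open_Union ballI \<U>) auto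
  have null: "O' n - \<Union>\<V> \<in> null_sets M" for n
  proof -
    have m: "O' n \<in> sets M" "\<Union>\<V> \<in> sets M" using O'o[of n] oV by auto
    have fI: "emeasure M (O' n \<inter> \<Union>\<V>) < \<infinity>"
      using le_less_trans[OF emeasure_mono O'f[of n], of "O' n \<inter> \<Union>\<V>"] m by auto
    have "emeasure M (O' n) \<le> emeasure M (O' n \<inter> \<Union>\<V>)"
      unfolding C(2)
    proof (rule SUP_least)
      fix k
      have "C n k \<subseteq> O' n \<inter> \<Union>\<V>" using C(1)[of n k] D[of n k] unfolding \<V>_def by blast
      then show "emeasure M (C n k) \<le> emeasure M (O' n \<inter> \<Union>\<V>)" using m by (intro emeasure_mono) auto
    qed
    moreover have "emeasure M (O' n - \<Union>\<V>) = emeasure M (O' n) - emeasure M (O' n \<inter> \<Union>\<V>)"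
    proof -
      have "O' n - \<Union>\<V> = O' n - (O' n \<inter> \<Union>\<V>)" by blast
      then show ?thesis using emeasure_Diff[of M "O' n \<inter> \<Union>\<V>" "O' n"] m fI by (simp add: less_top)
    qed
    moreover note O'f[of n] fI
    ultimately have "emeasure M (O' n - \<Union>\<V>) = 0" by (metis diff_eq_0_iff_ennreal infinity_ennreal_def)
    then show ?thesis using m by (auto simp: null_sets_def)
  qed
  have "(\<Union>n. O' n - \<Union>\<V>) \<in> null_sets M" using null by (intro null_sets_UN) auto
  moreover have "(\<Union>n. O' n - \<Union>\<V>) = \<Union>\<U> - \<Union>\<V>" using U(3) unfolding O'_def by blast
  ultimately have "\<Union>\<U> - \<Union>\<V> \<in> null_sets M" by simp
  then have "AE x in M. x \<in> \<Union>\<U> \<longrightarrow> x \<in> \<Union>\<V>" by (rule AE_I') auto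
  then show ?thesis using cV VU by blast
qed

lemma open_section: "open (Pair x -` S)" if "open S" for S :: "('a \<times> 'a) set"
  using that by (intro open_vimage continuous_intros)

text \<open>For each rational c, rectangles in \<open>S\<close> with open base and a compact side of
  measure above c are considered. If the section of \<open>S\<close> at x has measure above c, the
  tube lemma gives one over x, and for almost every x one of countably many selected rectangles
  serves instead. So the sections of \<open>Q\<close> and \<open>S\<close> have equal measure;
  finiteness of the measure of \<open>W\<close> turns this into a null difference.\<close>

lemma open_rectangle_approximation_finite:
  fixes S :: "('a \<times> 'a) set"
  assumes S: "open S" and W: "open W" "emeasure M W < \<infinity>" "S \<subseteq> UNIV \<times> W"
  obtains Q where "Q \<in> sets (M \<Otimes>\<^sub>M M)" "Q \<subseteq> S" "AE x in M. AE y in M. (x, y) \<in> S \<longrightarrow> (x, y) \<in> Q"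
proof -
  define \<U> where "\<U> c = {V. open V \<and> (\<exists>C. compact C \<and> V \<times> C \<subseteq> S \<and> ennreal c < emeasure M C)}" for c
  have "\<forall>c. \<exists>\<V>. countable \<V> \<and> \<V> \<subseteq> \<U> c \<and> (AE x in M. x \<in> \<Union>(\<U> c) \<longrightarrow> x \<in> \<Union>\<V>)"
    by (intro allI countable_subfamily_AE) (simp add: \<U>_def)
  then obtain \<V> where \<V>: "\<And>c. countable (\<V> c)" "\<And>c. \<V> c \<subseteq> \<U> c" "\<And>c. AE x in M. x \<in> \<Union>(\<U> c) \<longrightarrow> x \<in> \<Union>(\<V> c)"
    by metis
  have "\<forall>c. \<forall>V\<in>\<V> c. \<exists>C. compact C \<and> V \<times> C \<subseteq> S \<and> ennreal c < emeasure M C"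
    using \<V>(2) unfolding \<U>_def by blast
  then obtain K where K: "\<And>c V. V \<in> \<V> c \<Longrightarrow> compact (K c V) \<and> V \<times> K c V \<subseteq> S \<and> ennreal c < emeasure M (K c V)"
    by metis
  define Q where "Q = (\<Union>c\<in>\<rat>. \<Union>V\<in>\<V> c. V \<times> K c V)"
  have Qm: "Q \<in> sets (M \<Otimes>\<^sub>M M)"
    unfolding Q_def
  proof (intro sets.countable_UN'' countable_rat \<V>(1))
    fix c V assume "V \<in> \<V> c"
    then have "V \<in> sets M" "K c V \<in> sets M" using K[of V c] \<V>(2)[of c] by (auto simp: \<U>_def intro: borel_compact)
    then show "V \<times> K c V \<in> sets (M \<Otimes>\<^sub>M M)" by (rule pair_measureI)
  qed
  have QS: "Q \<subseteq> S" unfolding Q_def using K by blast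
  have "AE x in M. \<forall>c\<in>\<rat>. x \<in> \<Union>(\<U> c) \<longrightarrow> x \<in> \<Union>(\<V> c)"
    using \<V>(3) by (subst AE_ball_countable) (auto intro: countable_rat)
  then have "AE x in M. AE y in M. (x, y) \<in> S \<longrightarrow> (x, y) \<in> Q"
  proof eventually_elim
    case (elim x)
    let ?S = "Pair x -` S" and ?Q = "Pair x -` Q"
    have So: "open ?S" using S by (rule open_section)
    have m: "?S \<in> sets M" "?Q \<in> sets M" using So Qm by (auto intro: sets_Pair1)
    have sub: "?Q \<subseteq> ?S" using QS by auto
    have fin: "emeasure M ?S < \<infinity>"
      using le_less_trans[OF emeasure_mono W(2), of ?S] W by auto
    then have finQ: "emeasure M ?Q < \<infinity>"
      using le_less_trans[OF emeasure_mono fin, of ?Q] sub m by auto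
    have eS: "emeasure M ?S = ennreal (measure M ?S)" and eQ: "emeasure M ?Q = ennreal (measure M ?Q)"
      using fin finQ by (auto intro!: emeasure_eq_ennreal_measure)
    have "emeasure M ?S \<le> emeasure M ?Q"
    proof (rule ccontr)
      assume "\<not> ?thesis"
      then have lt: "measure M ?Q < measure M ?S"
        by (simp add: eS eQ not_le ennreal_less_iff)
      obtain c where c: "c \<in> \<rat>" "measure M ?Q < c" "c < measure M ?S" using Rats_dense_in_real[OF lt] by blast
      have c0: "0 \<le> c" using c(2) measure_nonneg[of M ?Q] by linarith
      have "ennreal c < emeasure M ?S" using c c0 by (simp add: eS ennreal_less_iff)
      then obtain C where C: "compact C" "C \<subseteq> ?S" "ennreal c < emeasure M C"
        unfolding emeasure_inner[OF So] less_SUP_iff by blast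
      have "{x} \<times> C \<subseteq> S" using C(2) by auto
      \<comment> \<open>The rectangle found here need not be among the selected ones, but a selected
        one over x also has a side of measure above c.\<close>
      from Elementary_Topology.tube_lemma[OF C(1) S this] obtain V where V: "x \<in> V" "open V" "V \<times> C \<subseteq> S" by blast
      then have "x \<in> \<Union>(\<U> c)" unfolding \<U>_def using C by blast
      then obtain V' where V': "V' \<in> \<V> c" "x \<in> V'" using elim c(1) by blast
      have "K c V' \<subseteq> ?Q" unfolding Q_def using V' c(1) by blast
      then have "emeasure M (K c V') \<le> emeasure M ?Q" using m by (intro emeasure_mono)
      also have "\<dots> < ennreal c" using c by (simp add: eQ ennreal_less_iff)
      finally show False using K[OF V'(1)] by auto
    qed
    then have "emeasure M (?S - ?Q) = 0"
      using emeasure_Diff[of M ?Q ?S] m sub finQ by (simp add: diff_eq_0_iff_ennreal less_top)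
    then have "?S - ?Q \<in> null_sets M" using m by auto
    then show ?case by (rule AE_I') auto
  qed
  then show thesis using that[OF Qm QS] by blast
qed

lemma open_rectangle_approximation:
  fixes S :: "('a \<times> 'a) set"
  assumes S: "open S"
  obtains Q where "Q \<in> sets (M \<Otimes>\<^sub>M M)" "Q \<subseteq> S" "AE x in M. AE y in M. (x, y) \<in> S \<longrightarrow> (x, y) \<in> Q"
proof -
  obtain U :: "nat \<Rightarrow> 'a set" where U: "\<And>n. open (U n)" "\<And>n. emeasure M (U n) < \<infinity>" "(\<Union>n. U n) = UNIV"
    using finite_open_cover by auto
  have "\<exists>Q. Q \<in> sets (M \<Otimes>\<^sub>M M) \<and> Q \<subseteq> S \<inter> UNIV \<times> U n \<and>
      (AE x in M. AE y in M. (x, y) \<in> S \<inter> UNIV \<times> U n \<longrightarrow> (x, y) \<in> Q)" for n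
  proof -
    have "open (S \<inter> UNIV \<times> U n)" using S U by (intro open_Int open_Times) auto
    from open_rectangle_approximation_finite[OF this U(1,2)] show ?thesis by blast
  qed
  then have "\<exists>Q. \<forall>n. Q n \<in> sets (M \<Otimes>\<^sub>M M) \<and> Q n \<subseteq> S \<inter> UNIV \<times> U n \<and>
      (AE x in M. AE y in M. (x, y) \<in> S \<inter> UNIV \<times> U n \<longrightarrow> (x, y) \<in> Q n)"
    by (intro choice allI)
  then obtain Q where Q: "\<forall>n. Q n \<in> sets (M \<Otimes>\<^sub>M M) \<and> Q n \<subseteq> S \<inter> UNIV \<times> U n \<and>
      (AE x in M. AE y in M. (x, y) \<in> S \<inter> UNIV \<times> U n \<longrightarrow> (x, y) \<in> Q n)" ..
  have "AE x in M. \<forall>n. AE y in M. (x, y) \<in> S \<inter> UNIV \<times> U n \<longrightarrow> (x, y) \<in> Q n"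
    using Q unfolding AE_all_countable by simp
  then have "AE x in M. AE y in M. (x, y) \<in> S \<longrightarrow> (x, y) \<in> (\<Union>n. Q n)"
  proof eventually_elim
    case (elim x)
    then have "AE y in M. \<forall>n. (x, y) \<in> S \<inter> UNIV \<times> U n \<longrightarrow> (x, y) \<in> Q n"
      unfolding AE_all_countable .
    then show ?case
    proof eventually_elim
      case (elim y)
      obtain n where "y \<in> U n" using U(3) by blast
      then show ?case using elim by auto
    qed
  qed
  moreover have "(\<Union>n. Q n) \<in> sets (M \<Otimes>\<^sub>M M)" using Q by (intro sets.countable_UN) auto
  moreover have "(\<Union>n. Q n) \<subseteq> S" using Q by blast
  ultimately show thesis using that by blast
qed

text \<open>The approximation holds for a.e. y at a.e. x. A symmetric \<open>Q\<close> lets it be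
  read with the variables exchanged, as the second half of a Tonelli argument requires.\<close>

lemma open_rectangle_approximation_symmetric:
  fixes S :: "('a \<times> 'a) set"
  assumes S: "open S" and sym: "\<And>x y. (x, y) \<in> S \<longleftrightarrow> (y, x) \<in> S"
  obtains Q where "Q \<in> sets (M \<Otimes>\<^sub>M M)" "Q \<subseteq> S" "\<And>x y. (x, y) \<in> Q \<longleftrightarrow> (y, x) \<in> Q"
    "AE x in M. AE y in M. (x, y) \<in> S \<longrightarrow> (x, y) \<in> Q"
proof -
  obtain Q where Q: "Q \<in> sets (M \<Otimes>\<^sub>M M)" "Q \<subseteq> S" "AE x in M. AE y in M. (x, y) \<in> S \<longrightarrow> (x, y) \<in> Q"
    using open_rectangle_approximation[OF S] by blast
  let ?R = "Q \<union> ((\<lambda>(x, y). (y, x)) -` Q \<inter> space (M \<Otimes>\<^sub>M M))"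
  have "?R \<in> sets (M \<Otimes>\<^sub>M M)"
    using Q(1) measurable_sets[OF measurable_pair_swap'[of M M] Q(1)] by auto
  moreover have "?R \<subseteq> S" using Q(2) sym by auto
  moreover have "AE x in M. AE y in M. (x, y) \<in> S \<longrightarrow> (x, y) \<in> ?R" using Q(3) by (auto elim!: AE_mp)
  ultimately show thesis by (intro that[of ?R]) (auto simp: space_pair_measure)
qed

end

section \<open>Joint measurability of translations\<close>

lemma SUP_Rats_below:
  fixes v :: ennreal
  assumes "v < \<infinity>"
  shows "(SUP c\<in>\<rat>. if ennreal c < v then ennreal c else 0) = v" (is "?s = v")
proof (rule antisym)
  show "?s \<le> v" by (intro SUP_least) auto
  show "v \<le> ?s"
  proof (rule ccontr)
    assume "\<not> v \<le> ?s"
    then have lt: "?s < v" by simp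
    then obtain a where a: "?s = ennreal a" "a \<ge> 0" using assms by (cases ?s) auto
    obtain b where b: "v = ennreal b" "b \<ge> 0" using assms by (cases v) auto
    have "a < b" using lt a b by (simp add: ennreal_less_iff)
    then obtain c where c: "c \<in> \<rat>" "a < c" "c < b" using Rats_dense_in_real by blast
    have "ennreal c < v" using a b c by (simp add: ennreal_less_iff)
    then have "ennreal c \<le> ?s" using SUP_upper[OF c(1), of "\<lambda>c. if ennreal c < v then ennreal c else 0"] by simp
    then show False using a c by (simp add: ennreal_le_iff)
  qed
qed

locale commutative_hypergroup_haar =
  commutative_hypergroup conv e invol + sigma_finite_radon haar
  for conv :: "('a::t2_space set \<Rightarrow> complex) \<Rightarrow> ('a set \<Rightarrow> complex) \<Rightarrow> ('a set \<Rightarrow> complex)"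
    and e :: 'a and invol :: "'a \<Rightarrow> 'a" and haar :: "'a measure" +
  assumes haar: "haar_measure conv haar"
begin

lemma point_conv_commute': "point_conv x y = point_conv y x"
  unfolding point_conv_def using point_conv_commute[of x y] by simp

text \<open>\<open>K\<close> itself need not be measurable for the product sigma-algebra. Symmetry
  of \<open>k\<close> is built in so that one a.e. statement serves both orders of integration when
  \<open>K\<close> is symmetric.\<close>

definition product_version :: "('a \<Rightarrow> 'a \<Rightarrow> ennreal) \<Rightarrow> ('a \<Rightarrow> 'a \<Rightarrow> ennreal) \<Rightarrow> bool" where
  "product_version K k \<longleftrightarrow> case_prod k \<in> borel_measurable (haar \<Otimes>\<^sub>M haar) \<and> (\<forall>x y. k x y = k y x) \<and>
     (AE x in haar. AE y in haar. k x y = K x y)"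

text \<open>Sections are Borel for every x, not just for almost every one, since invariance is used
  at fixed x.\<close>

definition good_kernel :: "('a \<Rightarrow> 'a \<Rightarrow> ennreal) \<Rightarrow> bool" where
  "good_kernel K \<longleftrightarrow> (\<forall>x. K x \<in> borel_measurable borel) \<and> (\<exists>k. product_version K k)"

lemma good_kernelI:
  assumes "\<And>x. K x \<in> borel_measurable borel" "case_prod k \<in> borel_measurable (haar \<Otimes>\<^sub>M haar)"
    "\<And>x y. k x y = k y x" "AE x in haar. AE y in haar. k x y = K x y"
  shows "good_kernel K"
  using assms unfolding good_kernel_def product_version_def by blast

lemma good_kernel_map:
  assumes K: "good_kernel K" and g[measurable]: "g \<in> borel_measurable borel"
  shows "good_kernel (\<lambda>x y. g (K x y))"
proof -
  obtain k where k: "product_version K k" and m: "\<And>x. K x \<in> borel_measurable borel"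
    using K unfolding good_kernel_def by blast
  show ?thesis
  proof (rule good_kernelI[of _ "\<lambda>x y. g (k x y)"])
    have [measurable]: "case_prod k \<in> borel_measurable (haar \<Otimes>\<^sub>M haar)" using k by (simp add: product_version_def)
    show "(\<lambda>(x, y). g (k x y)) \<in> borel_measurable (haar \<Otimes>\<^sub>M haar)" by measurable
    show "(\<lambda>y. g (K x y)) \<in> borel_measurable borel" for x using m[of x] by measurable
    show "g (k x y) = g (k y x)" for x y using k by (simp add: product_version_def)
    have "AE x in haar. AE y in haar. k x y = K x y" using k by (simp add: product_version_def)
    then show "AE x in haar. AE y in haar. g (k x y) = g (K x y)" by (auto elim!: eventually_mono)
  qed
qed

text \<open>Covers suprema, series and finite sums at once; the countably many exceptional null sets
  are merged. A hypothesis cannot be polymorphic in the space, so measurability is asked of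
  \<open>G\<close> once on K and once on its square.\<close>

lemma good_kernel_countable_map:
  fixes K :: "nat \<Rightarrow> 'a \<Rightarrow> 'a \<Rightarrow> ennreal" and G :: "(nat \<Rightarrow> ennreal) \<Rightarrow> ennreal"
  assumes K: "\<And>i. good_kernel (K i)"
    and G: "\<And>(M :: 'a measure) f. (\<And>i. f i \<in> borel_measurable M) \<Longrightarrow> (\<lambda>x. G (\<lambda>i. f i x)) \<in> borel_measurable M"
      "\<And>(M :: ('a \<times> 'a) measure) f. (\<And>i. f i \<in> borel_measurable M) \<Longrightarrow> (\<lambda>x. G (\<lambda>i. f i x)) \<in> borel_measurable M"
  shows "good_kernel (\<lambda>x y. G (\<lambda>i. K i x y))"
proof -
  have "\<forall>i. \<exists>k. product_version (K i) k" and m: "\<And>i x. K i x \<in> borel_measurable borel"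
    using K unfolding good_kernel_def by blast+
  then obtain k where k: "\<And>i. product_version (K i) (k i)" by metis
  show ?thesis
  proof (rule good_kernelI[of _ "\<lambda>x y. G (\<lambda>i. k i x y)"])
    have "case_prod (k i) \<in> borel_measurable (haar \<Otimes>\<^sub>M haar)" for i using k[of i] by (simp add: product_version_def)
    from G(2)[of "\<lambda>i. case_prod (k i)", OF this]
    show "(\<lambda>(x, y). G (\<lambda>i. k i x y)) \<in> borel_measurable (haar \<Otimes>\<^sub>M haar)" by (simp add: case_prod_unfold)
    show "(\<lambda>y. G (\<lambda>i. K i x y)) \<in> borel_measurable borel" for x using m by (intro G(1)) auto
    show "G (\<lambda>i. k i x y) = G (\<lambda>i. k i y x)" for x y using k unfolding product_version_def by metis
    have "AE x in haar. \<forall>i. AE y in haar. k i x y = K i x y"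
      unfolding AE_all_countable using k by (simp add: product_version_def)
    then show "AE x in haar. AE y in haar. G (\<lambda>i. k i x y) = G (\<lambda>i. K i x y)"
    proof eventually_elim
      case (elim x)
      then have "AE y in haar. \<forall>i. k i x y = K i x y" unfolding AE_all_countable .
      then show ?case by eventually_elim simp
    qed
  qed
qed

lemma good_kernel_add:
  assumes "good_kernel K" "good_kernel K'"
  shows "good_kernel (\<lambda>x y. K x y + K' x y)"
proof -
  have "good_kernel (\<lambda>x y. (if (0::nat) = 0 then K else K') x y + (if (1::nat) = 0 then K else K') x y)"
    by (rule good_kernel_countable_map[of "\<lambda>i. if i = 0 then K else K'" "\<lambda>h. h 0 + h 1"]) (use assms in auto)
  then show ?thesis by simp
qed

lemma good_kernel_open:
  assumes U: "open U"
  shows "good_kernel (\<lambda>x y. emeasure (point_conv x y) U)"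
proof -
  define S where "S c = {(x, y). emeasure (point_conv x y) U > ennreal c}" for c
  have So: "open (S c)" for c unfolding S_def by (rule open_point_conv_greater[OF U])
  have "\<exists>Q. Q \<in> sets (haar \<Otimes>\<^sub>M haar) \<and> Q \<subseteq> S c \<and> (\<forall>x y. (x, y) \<in> Q \<longleftrightarrow> (y, x) \<in> Q) \<and>
    (AE x in haar. AE y in haar. (x, y) \<in> S c \<longrightarrow> (x, y) \<in> Q)" for c
  proof -
    have sym: "(x, y) \<in> S c \<longleftrightarrow> (y, x) \<in> S c" for x y unfolding S_def using point_conv_commute'[of x y] by simp
    show ?thesis by (rule open_rectangle_approximation_symmetric[OF So[of c] sym]) blast
  qed
  then have "\<exists>Q. \<forall>c. Q c \<in> sets (haar \<Otimes>\<^sub>M haar) \<and> Q c \<subseteq> S c \<and> (\<forall>x y. (x, y) \<in> Q c \<longleftrightarrow> (y, x) \<in> Q c) \<and>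
    (AE x in haar. AE y in haar. (x, y) \<in> S c \<longrightarrow> (x, y) \<in> Q c)"
    by (intro choice allI)
  then obtain Q where Q: "\<forall>c. Q c \<in> sets (haar \<Otimes>\<^sub>M haar) \<and> Q c \<subseteq> S c \<and> (\<forall>x y. (x, y) \<in> Q c \<longleftrightarrow> (y, x) \<in> Q c) \<and>
    (AE x in haar. AE y in haar. (x, y) \<in> S c \<longrightarrow> (x, y) \<in> Q c)" ..
  have Qm: "Q c \<in> sets (haar \<Otimes>\<^sub>M haar)" and QS: "Q c \<subseteq> S c" and Qsym: "(x, y) \<in> Q c \<longleftrightarrow> (y, x) \<in> Q c"
    and Qae: "AE x in haar. AE y in haar. (x, y) \<in> S c \<longrightarrow> (x, y) \<in> Q c" for c x y
    using Q by blast+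
  \<comment> \<open>The mass of \<open>U\<close> is rebuilt from its rational superlevel sets, each
    replaced by the measurable \<open>Q c\<close>; negative c contribute 0.\<close>
  define k where "k x y = (SUP c\<in>\<rat>. if (x, y) \<in> Q c then ennreal c else 0)" for x y
  show ?thesis
  proof (rule good_kernelI[of _ k])
    have "(\<lambda>z. SUP c\<in>\<rat>. if z \<in> Q c then ennreal c else 0) \<in> borel_measurable (haar \<Otimes>\<^sub>M haar)"
      using Qm by (intro borel_measurable_SUP countable_rat measurable_If_set) auto
    then show "case_prod k \<in> borel_measurable (haar \<Otimes>\<^sub>M haar)" by (simp add: k_def case_prod_unfold)
    show "k x y = k y x" for x y unfolding k_def using Qsym[of x y] by simp
    show "(\<lambda>y. emeasure (point_conv x y) U) \<in> borel_measurable borel" for x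
    proof (rule borel_measurableI_greater)
      fix a :: ennreal
      show "{y \<in> space borel. a < emeasure (point_conv x y) U} \<in> sets borel"
      proof (cases a)
        case (real r)
        have "{y. a < emeasure (point_conv x y) U} = Pair x -` S r" unfolding S_def real by auto
        then show ?thesis using open_section[OF So[of r], of x] by simp
      qed simp
    qed
    have "AE x in haar. \<forall>c\<in>\<rat>. AE y in haar. (x, y) \<in> S c \<longrightarrow> (x, y) \<in> Q c"
      using Qae by (subst AE_ball_countable) (auto intro: countable_rat)
    then show "AE x in haar. AE y in haar. k x y = emeasure (point_conv x y) U"
    proof eventually_elim
      case (elim x)
      then have "AE y in haar. \<forall>c\<in>\<rat>. (x, y) \<in> S c \<longrightarrow> (x, y) \<in> Q c"
        by (subst AE_ball_countable) (auto intro: countable_rat)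
      then show ?case
      proof eventually_elim
        case (elim y)
        have "k x y = (SUP c\<in>\<rat>. if ennreal c < emeasure (point_conv x y) U then ennreal c else 0)"
          unfolding k_def
        proof (rule SUP_cong)
          fix c :: real assume "c \<in> \<rat>"
          then have "(x, y) \<in> Q c \<longleftrightarrow> (x, y) \<in> S c" using elim QS[of c] by blast
          then show "(if (x, y) \<in> Q c then ennreal c else 0) = (if ennreal c < emeasure (point_conv x y) U then ennreal c else 0)"
            by (simp add: S_def)
        qed simp
        also have "\<dots> = emeasure (point_conv x y) U"
          using le_less_trans[OF emeasure_point_conv_le_1] by (intro SUP_Rats_below) simp
        finally show ?case .
      qed
    qed
  qed
qed

text \<open>Dynkin's induction from the intersection-stable open sets; total mass 1 handles
  complements.\<close>

lemma good_kernel_emeasure: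
  assumes "E \<in> sets borel"
  shows "good_kernel (\<lambda>x y. emeasure (point_conv x y) E)"
proof -
  have "E \<in> sigma_sets UNIV {S. open S}" using assms by (simp add: borel_def)
  have s: "sigma_sets UNIV {S. open S} = (sets borel :: 'a set set)" by (simp add: borel_def)
  have "Int_stable {S :: 'a set. open S}" "{S :: 'a set. open S} \<subseteq> Pow UNIV" by (auto simp: Int_stable_def)
  from this \<open>E \<in> sigma_sets UNIV {S. open S}\<close> show ?thesis
  proof (induction rule: sigma_sets_induct_disjoint)
    case (basic A)
    then show ?case by (intro good_kernel_open) simp
  next
    case empty
    show ?case using good_kernel_open[of "{}"] by simp
  next
    case (compl A)
    then have A: "A \<in> sets borel" by (simp add: s)
    have "emeasure (point_conv x y) (UNIV - A) = 1 - emeasure (point_conv x y) A" for x y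
      using emeasure_compl[of A "point_conv x y"] A le_less_trans[OF emeasure_point_conv_le_1, of top x y A] by (simp add: less_top)
    then show ?case using good_kernel_map[OF compl(2), of "\<lambda>v. 1 - v"] by simp
  next
    case (union A)
    then have A: "range A \<subseteq> sets borel" by (simp add: s)
    have "(\<Sum>i. emeasure (point_conv x y) (A i)) = emeasure (point_conv x y) (\<Union>i. A i)" for x y
      using union A by (intro suminf_emeasure) auto
    moreover have "good_kernel (\<lambda>x y. \<Sum>i. emeasure (point_conv x y) (A i))"
      by (rule good_kernel_countable_map[of "\<lambda>i x y. emeasure (point_conv x y) (A i)" suminf]) (use union in auto)
    ultimately show ?case by simp
  qed
qed

lemma good_kernel_translation:
  assumes "f \<in> borel_measurable borel"
  shows "good_kernel (\<lambda>x y. translation conv x f y)"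
  using assms unfolding translation_eq
proof induction
  case (cong f g)
  have "(\<integral>\<^sup>+z. f z \<partial>point_conv x y) = (\<integral>\<^sup>+z. g z \<partial>point_conv x y)" for x y
    using cong by (intro nn_integral_cong) auto
  then show ?case using cong by simp
next
  case (set A)
  then have "(\<integral>\<^sup>+z. indicator A z \<partial>point_conv x y) = emeasure (point_conv x y) A" for x y by simp
  then show ?case using good_kernel_emeasure[OF set] by simp
next
  case (mult u c)
  have "(\<integral>\<^sup>+z. c * u z \<partial>point_conv x y) = c * (\<integral>\<^sup>+z. u z \<partial>point_conv x y)" for x y
    using mult by (intro nn_integral_cmult) simp
  then show ?case using good_kernel_map[OF mult(4), of "\<lambda>v. c * v"] by simp
next
  case (add u v)
  have "(\<integral>\<^sup>+z. v z + u z \<partial>point_conv x y) = (\<integral>\<^sup>+z. v z \<partial>point_conv x y) + (\<integral>\<^sup>+z. u z \<partial>point_conv x y)" for x y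
    using add by (intro nn_integral_add) simp_all
  moreover have "good_kernel (\<lambda>x y. (\<integral>\<^sup>+z. v z \<partial>point_conv x y) + (\<integral>\<^sup>+z. u z \<partial>point_conv x y))"
    by (intro good_kernel_add) fact+
  ultimately show ?case by simp
next
  case (seq U)
  have "(\<integral>\<^sup>+z. (SUP i. U i) z \<partial>point_conv x y) = (SUP i. \<integral>\<^sup>+z. U i z \<partial>point_conv x y)" for x y
    using seq by (simp add: image_comp) (intro nn_integral_monotone_convergence_SUP, auto)
  moreover have "good_kernel (\<lambda>x y. SUP i. \<integral>\<^sup>+z. U i z \<partial>point_conv x y)"
    by (rule good_kernel_countable_map[of "\<lambda>i x y. \<integral>\<^sup>+z. U i z \<partial>point_conv x y" "\<lambda>h. SUP i. h i"]) (use seq in auto)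
  ultimately show ?case by simp
qed

end

section \<open>Invariance of the Haar measure under the involution\<close>

text \<open>The integral of the excess over \<open>c\<close> is that of the distribution function
  over (c, \<infinity>), where t^(-q) is integrable because q > 1.\<close>

lemma (in sigma_finite_measure) nn_integral_excess_le:
  fixes G :: "'a \<Rightarrow> real"
  assumes [measurable]: "G \<in> borel_measurable M" and q: "q > 1" and c: "c > 0" and A: "A > 0"
    and dist: "\<And>t. t > 0 \<Longrightarrow> emeasure M {y \<in> space M. t < G y} \<le> ennreal (A * t powr (- q))"
  shows "(\<integral>\<^sup>+y. ennreal (max 0 (G y - c)) \<partial>M) \<le> ennreal (A * c powr (1 - q) / (q - 1))"
proof -
  have "(\<integral>\<^sup>+y. ennreal (max 0 (G y - c)) \<partial>M)
      = (\<integral>\<^sup>+y. 1 * (\<integral>\<^sup>+t. indicator {c<..} t * indicator {0<..<G y} t \<partial>lborel) \<partial>M)"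
  proof (intro nn_integral_cong)
    fix y
    have "(\<integral>\<^sup>+t. indicator {c<..} t * indicator {0<..<G y} t \<partial>lborel) = (\<integral>\<^sup>+t. indicator {c<..<G y} t \<partial>lborel)"
      using c by (intro nn_integral_cong) (auto simp: indicator_def)
    also have "\<dots> = ennreal (max 0 (G y - c))"
      by (cases "c \<le> G y") (auto simp: max_def)
    finally show "ennreal (max 0 (G y - c)) = 1 * (\<integral>\<^sup>+t. indicator {c<..} t * indicator {0<..<G y} t \<partial>lborel)"
      by simp
  qed
  also have "\<dots> = (\<integral>\<^sup>+t. indicator {c<..} t * indicator {0<..} t * (\<integral>\<^sup>+y. 1 * indicator {z \<in> space M. t < G z} y \<partial>M) \<partial>lborel)"
    by (rule nn_integral_layer_cake) auto
  also have "\<dots> \<le> (\<integral>\<^sup>+t. ennreal A * (ennreal (t powr (- q)) * indicator {c..} t) \<partial>lborel)"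
  proof (intro nn_integral_mono)
    fix t :: real
    show "indicator {c<..} t * indicator {0<..} t * (\<integral>\<^sup>+y. 1 * indicator {z \<in> space M. t < G z} y \<partial>M)
        \<le> ennreal A * (ennreal (t powr (- q)) * indicator {c..} t)"
      using dist[of t] c A by (cases "c < t") (auto simp: ennreal_mult indicator_def[of "{c<..}"])
  qed
  also have "\<dots> = ennreal A * (\<integral>\<^sup>+t. ennreal (t powr (- q)) * indicator {c..} t \<partial>lborel)"
    by (rule nn_integral_cmult) measurable
  also have "(\<integral>\<^sup>+t. ennreal (t powr (- q)) * indicator {c..} t \<partial>lborel) = ennreal (- (c powr (- q + 1)) / (- q + 1))"
    using q c by (intro nn_integral_has_integral_lebesgue' has_integral_powr_to_inf) auto
  also have "- (c powr (- q + 1)) / (- q + 1) = c powr (1 - q) / (q - 1)"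
    using q by (simp add: field_simps)
  finally show ?thesis using A q by (simp add: ennreal_mult[symmetric])
qed

context commutative_hypergroup_haar
begin

section \<open>Translations integrated against the Haar measure\<close>

lemma haar_invariant:
  assumes "f \<in> borel_measurable borel"
  shows "(\<integral>\<^sup>+y. translation conv x f y \<partial>haar) = (\<integral>\<^sup>+y. f y \<partial>haar)"
  using haar assms unfolding haar_measure_def by blast

lemma translation_commute: "translation conv x f y = translation conv y f x"
  by (simp add: translation_eq point_conv_commute'[of x y])

lemma borel_measurable_translation:
  assumes "f \<in> borel_measurable borel"
  shows "translation conv x f \<in> borel_measurable borel"
  using good_kernel_translation[OF assms] by (auto simp: good_kernel_def)

lemma borel_measurable_haar: "borel_measurable haar = borel_measurable borel"
  by (rule measurable_cong_sets) auto

lemma borel_measurable_point_conv: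
  "E \<in> sets borel \<Longrightarrow> (\<lambda>y. emeasure (point_conv x y) E) \<in> borel_measurable haar"
  using good_kernel_emeasure[of E] by (simp add: good_kernel_def borel_measurable_haar)

lemma translation_indicator: "E \<in> sets borel \<Longrightarrow> translation conv x (indicator E) y = emeasure (point_conv x y) E"
  by (simp add: translation_eq)

lemma haar_point_conv:
  assumes "E \<in> sets borel"
  shows "(\<integral>\<^sup>+y. emeasure (point_conv x y) E \<partial>haar) = emeasure haar E"
  using haar_invariant[of "indicator E" x] assms by (simp add: translation_indicator)

text \<open>Tonelli is applied to the product-measurable version. For almost every outer variable
  its section is a.e. the translation, in the second order by its symmetry together with
  commutativity.\<close>

lemma translation_Tonelli:
  assumes f: "f \<in> borel_measurable borel"
    and [measurable]: "\<phi> \<in> borel_measurable borel" "\<psi> \<in> borel_measurable borel"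
  shows "(\<integral>\<^sup>+x. \<phi> x * (\<integral>\<^sup>+y. \<psi> y * translation conv x f y \<partial>haar) \<partial>haar)
    = (\<integral>\<^sup>+y. \<psi> y * (\<integral>\<^sup>+x. \<phi> x * translation conv x f y \<partial>haar) \<partial>haar)"
proof -
  interpret P: pair_sigma_finite haar haar ..
  obtain k where k: "product_version (\<lambda>x y. translation conv x f y) k"
    using good_kernel_translation[OF f] unfolding good_kernel_def by blast
  then have km[measurable]: "case_prod k \<in> borel_measurable (haar \<Otimes>\<^sub>M haar)" and sym: "\<And>x y. k x y = k y x"
    and ae: "AE x in haar. AE y in haar. k x y = translation conv x f y"
    by (auto simp: product_version_def)
  have [measurable]: "\<phi> \<in> borel_measurable haar" "\<psi> \<in> borel_measurable haar"
    using assms(2,3) by (simp_all add: borel_measurable_haar)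
  have "(\<integral>\<^sup>+x. \<phi> x * (\<integral>\<^sup>+y. \<psi> y * translation conv x f y \<partial>haar) \<partial>haar)
      = (\<integral>\<^sup>+x. \<phi> x * (\<integral>\<^sup>+y. \<psi> y * k x y \<partial>haar) \<partial>haar)"
  proof (intro nn_integral_cong_AE, use ae in eventually_elim)
    case (elim x)
    have "(\<integral>\<^sup>+y. \<psi> y * translation conv x f y \<partial>haar) = (\<integral>\<^sup>+y. \<psi> y * k x y \<partial>haar)"
      by (intro nn_integral_cong_AE, use elim in eventually_elim) simp
    then show ?case by simp
  qed
  also have "\<dots> = (\<integral>\<^sup>+x. (\<integral>\<^sup>+y. \<phi> x * (\<psi> y * k x y) \<partial>haar) \<partial>haar)"
    by (intro nn_integral_cong nn_integral_cmult[symmetric]) measurable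
  also have "\<dots> = (\<integral>\<^sup>+y. (\<integral>\<^sup>+x. \<phi> x * (\<psi> y * k x y) \<partial>haar) \<partial>haar)"
    by (rule P.Fubini'[symmetric]) measurable
  also have "\<dots> = (\<integral>\<^sup>+y. (\<integral>\<^sup>+x. \<psi> y * (\<phi> x * k x y) \<partial>haar) \<partial>haar)"
    by (simp add: mult_ac)
  also have "\<dots> = (\<integral>\<^sup>+y. \<psi> y * (\<integral>\<^sup>+x. \<phi> x * k x y \<partial>haar) \<partial>haar)"
    by (intro nn_integral_cong nn_integral_cmult) measurable
  also have "\<dots> = (\<integral>\<^sup>+y. \<psi> y * (\<integral>\<^sup>+x. \<phi> x * translation conv x f y \<partial>haar) \<partial>haar)"
  proof (intro nn_integral_cong_AE, use ae in eventually_elim)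
    case (elim y)
    have "(\<integral>\<^sup>+x. \<phi> x * k x y \<partial>haar) = (\<integral>\<^sup>+x. \<phi> x * translation conv x f y \<partial>haar)"
      by (intro nn_integral_cong_AE, use elim in eventually_elim)
        (simp add: sym[of _ y] translation_commute[of _ f y])
    then show ?case by simp
  qed
  finally show ?thesis .
qed

text \<open>If \<open>N\<close> were null, invariance would make null the set of all z for which the
  convolution at (y~, z) charges \<open>N\<close>. This set is open and contains y, since
  \<open>e\<close> lies in the support at (y~, y). So K would be a union of open null sets, and a
  countable subfamily would give zero Haar measure.\<close>

lemma emeasure_haar_neighbourhood_pos:
  assumes N: "open N" "e \<in> N"
  shows "emeasure haar N \<noteq> 0"
proof
  assume 0: "emeasure haar N = 0"
  define \<U> where "\<U> = {V. open V \<and> emeasure haar V = 0}"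
  have "y \<in> \<Union>\<U>" for y
  proof -
    let ?V = "{z. emeasure (point_conv (invol y) z) N > 0}"
    have "?V = Pair (invol y) -` {(x, y). emeasure (point_conv x y) N > ennreal 0}" by auto
    then have o: "open ?V" using open_section[OF open_point_conv_greater[OF N(1), of 0]] by simp
    have "(\<integral>\<^sup>+z. emeasure (point_conv (invol y) z) N \<partial>haar) = 0"
      using haar_point_conv[of N "invol y"] N 0 by simp
    then have "AE z in haar. emeasure (point_conv (invol y) z) N = 0"
      using N by (subst (asm) nn_integral_0_iff_AE) (auto intro: borel_measurable_point_conv)
    then have "AE z in haar. \<not> 0 < emeasure (point_conv (invol y) z) N" by eventually_elim simp
    from emeasure_eq_0_AE[OF this] have "emeasure haar ?V = 0" by simp
    moreover have "y \<in> ?V"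
    proof -
      have "e \<in> supp (invol y) y" by (simp add: identity_in_support_iff)
      then show ?thesis using N unfolding mem_supp by (auto simp: zero_less_iff_neq_zero)
    qed
    ultimately show ?thesis using o unfolding \<U>_def by blast
  qed
  then have U: "\<Union>\<U> = UNIV" by blast
  obtain \<V> where V: "countable \<V>" "\<V> \<subseteq> \<U>" "AE x in haar. x \<in> \<Union>\<U> \<longrightarrow> x \<in> \<Union>\<V>"
    using countable_subfamily_AE[of \<U>] unfolding \<U>_def by auto
  have "\<Union>\<V> \<in> null_sets haar"
  proof -
    have "V \<in> null_sets haar" if "V \<in> \<V>" for V
      using V(2) that unfolding \<U>_def by (auto simp: null_sets_def)
    then show ?thesis using null_sets_UN'[OF V(1), of "\<lambda>V. V" haar] by simp
  qed
  then have "AE x in haar. x \<notin> \<Union>\<V>" by (rule AE_not_in)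
  moreover have "AE x in haar. x \<in> \<Union>\<V>" using V(3) unfolding U by simp
  ultimately have "AE x in haar. False" by eventually_elim (rule notE)
  then have "emeasure haar UNIV = 0" using AE_iff_measurable[of UNIV haar "\<lambda>_. False"] by simp
  then show False using haar by (simp add: haar_measure_def)
qed

text \<open>Convolving with points near \<open>e\<close> hardly moves \<open>C\<close>: the support
  at (c, e) is inside {c}, so by upper semicontinuity and the tube lemma the support at (c, n) stays
  in \<open>U\<close> for c in \<open>C\<close> and n in N. If N met \<open>supp x z\<close> with x~
  in \<open>C\<close>, adjointness would place z in \<open>U\<close>.\<close>

lemma involution_separation:
  assumes C: "compact C" and U: "open U" "C \<subseteq> U"
  shows "\<exists>N. open N \<and> e \<in> N \<and> emeasure haar N < \<infinity> \<and>
    (\<forall>x z. invol x \<in> C \<longrightarrow> z \<notin> U \<longrightarrow> emeasure (point_conv x z) N = 0)"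
proof -
  define W where "W = (\<lambda>(n, c). (c, n)) -` {(x, y). supp x y \<subseteq> U}"
  have "open W"
    unfolding W_def case_prod_unfold by (intro open_vimage continuous_intros) (use open_supp_subset[OF U(1)] in \<open>simp add: case_prod_unfold\<close>)
  moreover have "{e} \<times> C \<subseteq> W"
  proof -
    have "supp c e \<subseteq> {c}" for c
    proof
      fix z assume "z \<in> supp c e"
      then have "z \<in> measure_support (point_measure c)" by (simp add: conv_identity_right)
      then have "emeasure (as_measure (point_measure c)) (- {c}) \<noteq> 0" if "z \<noteq> c"
        using that unfolding mem_measure_support[OF point_measure_positive] by (auto simp: open_Compl)
      moreover have "emeasure (as_measure (point_measure c)) (- {c}) = 0"
        by (subst emeasure_as_measure[OF point_measure_positive]) (auto simp: point_measure_def)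
      ultimately show "z \<in> {c}" by auto
    qed
    then show ?thesis using U(2) unfolding W_def by fastforce
  qed
  ultimately have "\<exists>X. e \<in> X \<and> open X \<and> X \<times> C \<subseteq> W" by (rule Elementary_Topology.tube_lemma[OF C])
  then obtain X where X: "e \<in> X" "open X" "X \<times> C \<subseteq> W" by auto
  \<comment> \<open>Intersecting with a neighbourhood inside a compact set gives N finite measure,
    so that this measure can be cancelled later.\<close>
  obtain V K where VK: "open V" "compact K" "e \<in> V" "V \<subseteq> K" using compact_neighbourhood[of e] by blast
  have "emeasure haar (X \<inter> V) < \<infinity>"
    using le_less_trans[OF emeasure_mono emeasure_compact_finite[OF VK(2)], of "X \<inter> V"] VK by (auto intro: borel_compact)
  moreover have "emeasure (point_conv x z) (X \<inter> V) = 0" if "invol x \<in> C" "z \<notin> U" for x z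
  proof (rule emeasure_point_conv_disjoint_supp)
    show "open (X \<inter> V)" using X VK by auto
    show "X \<inter> V \<inter> supp x z = {}"
    proof (rule ccontr)
      assume "X \<inter> V \<inter> supp x z \<noteq> {}"
      then obtain n where n: "n \<in> X" "n \<in> supp x z" by auto
      have "(n, invol x) \<in> W" using subsetD[OF X(3), of "(n, invol x)"] n that by simp
      then have "supp (invol x) n \<subseteq> U" unfolding W_def by simp
      then show False using supp_adjoint[OF n(2)] that by blast
    qed
  qed
  ultimately show ?thesis using X VK by (intro exI[of _ "X \<inter> V"]) auto
qed

lemma open_invol: "open U \<Longrightarrow> open (invol -` U)"
  using invol_continuous by (intro open_vimage) auto

lemma invol_measurable [measurable]: "invol \<in> borel \<rightarrow>\<^sub>M borel"
  using invol_continuous by (rule borel_measurable_continuous_onI)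

lemma invol_vimage_borel: "E \<in> sets borel \<Longrightarrow> invol -` E \<in> sets borel"
  using measurable_sets[OF invol_measurable, of E] by simp

lemma invol_vimage_invol [simp]: "invol -` (invol -` E) = E"
  by (auto simp: invol_invol)

lemma compact_invol: "compact C \<Longrightarrow> compact (invol -` C)"
proof -
  assume "compact C"
  then have "compact (invol ` C)" using invol_continuous continuous_on_subset by (blast intro: compact_continuous_image)
  moreover have "invol ` C = invol -` C"
    by (auto simp: invol_invol image_iff) (metis invol_invol)
  ultimately show ?thesis by simp
qed

text \<open>For every open $U$ containing $C$, integrating $(\delta_x * \delta_z)(N)$ over $C^\sim \times U$ in both
  orders, with $N$ a small neighbourhood of $e$, gives
  $\lambda(C^\sim) \lambda(N) \leq \lambda(U) \lambda(N)$.\<close>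

lemma emeasure_invol_compact_le:
  assumes C: "compact C"
  shows "emeasure haar (invol -` C) \<le> emeasure haar C"
proof -
  have Cm: "C \<in> sets borel" and Im: "invol -` C \<in> sets borel"
    using C compact_invol by (auto intro: borel_compact)
  have "emeasure haar (invol -` C) \<le> emeasure haar U" if U: "open U" "C \<subseteq> U" for U
  proof -
    obtain N where N: "open N" "e \<in> N" "emeasure haar N < \<infinity>"
      "\<And>x z. invol x \<in> C \<Longrightarrow> z \<notin> U \<Longrightarrow> emeasure (point_conv x z) N = 0"
      using involution_separation[OF C U] by blast
    have Nm: "N \<in> sets borel" and Um: "U \<in> sets borel" using N U by auto
    have "emeasure haar (invol -` C) * emeasure haar N
        = (\<integral>\<^sup>+x. indicator (invol -` C) x * (\<integral>\<^sup>+z. emeasure (point_conv x z) N \<partial>haar) \<partial>haar)"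
      using Im by (simp add: haar_point_conv[OF Nm] nn_integral_multc)
    \<comment> \<open>For x~ in \<open>C\<close> the integrand vanishes off \<open>U\<close> by the
      choice of N, so restricting z to \<open>U\<close> changes nothing.\<close>
    also have "\<dots> = (\<integral>\<^sup>+x. indicator (invol -` C) x * (\<integral>\<^sup>+z. indicator U z * translation conv x (indicator N) z \<partial>haar) \<partial>haar)"
    proof (intro nn_integral_cong)
      fix x
      show "indicator (invol -` C) x * (\<integral>\<^sup>+z. emeasure (point_conv x z) N \<partial>haar)
          = indicator (invol -` C) x * (\<integral>\<^sup>+z. indicator U z * translation conv x (indicator N) z \<partial>haar)"
      proof (cases "invol x \<in> C")
        case True
        then have "(\<integral>\<^sup>+z. emeasure (point_conv x z) N \<partial>haar) = (\<integral>\<^sup>+z. indicator U z * translation conv x (indicator N) z \<partial>haar)"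
          using N(4) by (intro nn_integral_cong) (auto simp: translation_indicator[OF Nm] indicator_def)
        then show ?thesis by simp
      qed simp
    qed
    also have "\<dots> = (\<integral>\<^sup>+z. indicator U z * (\<integral>\<^sup>+x. indicator (invol -` C) x * translation conv x (indicator N) z \<partial>haar) \<partial>haar)"
      using Nm Um Im by (intro translation_Tonelli) auto
    also have "\<dots> \<le> (\<integral>\<^sup>+z. indicator U z * emeasure haar N \<partial>haar)"
    proof (intro nn_integral_mono mult_left_mono)
      fix z
      have "(\<integral>\<^sup>+x. indicator (invol -` C) x * translation conv x (indicator N) z \<partial>haar)
          \<le> (\<integral>\<^sup>+x. translation conv z (indicator N) x \<partial>haar)"
        by (intro nn_integral_mono) (auto simp: indicator_def translation_commute[of _ _ z])
      also have "\<dots> = emeasure haar N" using haar_invariant[of "indicator N" z] Nm by simp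
      finally show "(\<integral>\<^sup>+x. indicator (invol -` C) x * translation conv x (indicator N) z \<partial>haar) \<le> emeasure haar N" .
    qed simp
    also have "\<dots> = emeasure haar U * emeasure haar N" using Um by (simp add: nn_integral_multc)
    finally show ?thesis
      using emeasure_haar_neighbourhood_pos[OF N(1,2)] N(3)
      by (simp add: mult.commute[of _ "emeasure haar N"] ennreal_mult_le_mult_iff less_top)
  qed
  then show ?thesis unfolding emeasure_outer[OF Cm] by (intro INF_greatest) auto
qed

text \<open>The inequality passes from compact to open sets by inner regularity and on to Borel sets
  by outer regularity. As the involution is its own inverse, applying the inequality to the image of
  \<open>E\<close> gives equality.\<close>

lemma emeasure_invol:
  assumes E: "E \<in> sets borel"
  shows "emeasure haar (invol -` E) = emeasure haar E"
proof -
  have op: "emeasure haar (invol -` U) \<le> emeasure haar U" if U: "open U" for U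
    unfolding emeasure_inner[OF open_invol[OF U]]
  proof (rule SUP_least)
    fix C assume "C \<in> {C. compact C \<and> C \<subseteq> invol -` U}"
    then have C: "compact C" "C \<subseteq> invol -` U" by auto
    have "emeasure haar C \<le> emeasure haar (invol -` C)"
      using emeasure_invol_compact_le[OF compact_invol[OF C(1)]] by simp
    also have "\<dots> \<le> emeasure haar U"
    proof (rule emeasure_mono)
      show "invol -` C \<subseteq> U" using C(2) by (metis invol_vimage_invol vimage_mono)
    qed (use U in auto)
    finally show "emeasure haar C \<le> emeasure haar U" .
  qed
  have le: "emeasure haar (invol -` B) \<le> emeasure haar B" if B: "B \<in> sets borel" for B
    unfolding emeasure_outer[OF B]
  proof (rule INF_greatest)
    fix U assume "U \<in> {U. open U \<and> B \<subseteq> U}"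
    then have U: "open U" "B \<subseteq> U" by auto
    have "emeasure haar (invol -` B) \<le> emeasure haar (invol -` U)"
      using U open_invol[OF U(1)] by (intro emeasure_mono) auto
    also have "\<dots> \<le> emeasure haar U" by (rule op[OF U(1)])
    finally show "emeasure haar (invol -` B) \<le> emeasure haar U" .
  qed
  show ?thesis
    using le[OF E] le[OF invol_vimage_borel[OF E]] by simp
qed

lemma distr_invol: "distr haar haar invol = haar"
proof (rule measure_eqI)
  fix E assume "E \<in> sets (distr haar haar invol)"
  then have E: "E \<in> sets borel" by simp
  have "invol \<in> haar \<rightarrow>\<^sub>M haar" using invol_measurable measurable_cong_sets[OF sets_M sets_M] by blast
  then show "emeasure (distr haar haar invol) E = emeasure haar E"
    using E emeasure_invol[OF E] by (simp add: emeasure_distr)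
qed simp

lemma invol_measurable_haar [measurable]: "invol \<in> haar \<rightarrow>\<^sub>M haar"
  using invol_measurable measurable_cong_sets[OF sets_M sets_M] by blast

lemma nn_integral_invol:
  assumes "f \<in> borel_measurable borel"
  shows "(\<integral>\<^sup>+y. f (invol y) \<partial>haar) = (\<integral>\<^sup>+y. f y \<partial>haar)"
proof -
  have "f \<in> borel_measurable haar" using assms by (simp add: borel_measurable_haar)
  then show ?thesis using nn_integral_distr[OF invol_measurable_haar, of f] by (simp add: distr_invol)
qed

lemma AE_invol:
  assumes "AE y in haar. P y"
  shows "AE y in haar. P (invol y)"
proof -
  obtain Z where Z: "Z \<in> null_sets haar" "{y \<in> space haar. \<not> P y} \<subseteq> Z"
    using assms by (auto simp: eventually_ae_filter)
  have "invol -` Z \<in> null_sets haar"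
    using Z(1) emeasure_invol[of Z] invol_vimage_borel[of Z] by (auto simp: null_sets_def)
  then show ?thesis by (rule AE_I') (use Z(2) in auto)
qed

text \<open>By invariance a null set is charged by the convolutions at (x, y) for almost no y. The
  two functions are arbitrary, which lets the Riesz kernel be exchanged for a Borel
  function.\<close>

lemma AE_translation_cong:
  assumes "AE z in haar. f z = g z"
  shows "AE y in haar. translation conv x f y = translation conv x g y"
proof -
  obtain Z where Z: "Z \<in> null_sets haar" "{z \<in> space haar. f z \<noteq> g z} \<subseteq> Z"
    using assms by (auto simp: eventually_ae_filter)
  then have Zm: "Z \<in> sets borel" by auto
  have "(\<integral>\<^sup>+y. emeasure (point_conv x y) Z \<partial>haar) = 0"
    using haar_point_conv[OF Zm] Z by auto
  then have "AE y in haar. emeasure (point_conv x y) Z = 0"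
    using Zm by (subst (asm) nn_integral_0_iff_AE) (auto intro: borel_measurable_point_conv)
  then show ?thesis
  proof eventually_elim
    case (elim y)
    then have "Z \<in> null_sets (point_conv x y)" using Zm by (simp add: null_sets_def)
    then have "AE z in point_conv x y. f z = g z" by (rule AE_I') (use Z(2) in auto)
    then show ?case unfolding translation_eq by (rule nn_integral_cong_AE)
  qed
qed

section \<open>Weak type of the translates of a function with power-like distribution\<close>

lemma translation_weak_kernel:
  fixes G :: "'a \<Rightarrow> real"
  assumes G[measurable]: "G \<in> borel_measurable borel" and q: "q > 1" and A: "A > 0"
    and dist: "\<And>t. t > 0 \<Longrightarrow> emeasure haar {y. t < G y} \<le> ennreal (A * t powr (- q))"
  shows "weak_kernel haar (q / (q - 1) * A powr (1 / q)) (1 - 1 / q) (translation conv x (\<lambda>y. ennreal (G y)))"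
  unfolding weak_kernel_def
proof (intro conjI ballI impI)
  let ?T = "translation conv x"
  have GT: "?T (\<lambda>y. ennreal (G y)) \<in> borel_measurable borel" by (rule borel_measurable_translation) measurable
  then show "?T (\<lambda>y. ennreal (G y)) \<in> borel_measurable haar" by (simp add: borel_measurable_haar)
  fix E assume E: "E \<in> sets haar" and fin: "emeasure haar E < \<infinity>"
  define v where "v = measure haar E"
  have v: "emeasure haar E = ennreal v" "v \<ge> 0" using fin by (auto simp: v_def intro!: emeasure_eq_ennreal_measure)
  show "(\<integral>\<^sup>+y. ?T (\<lambda>y. ennreal (G y)) y * indicator E y \<partial>haar) \<le> ennreal (q / (q - 1) * A powr (1 / q) * measure haar E powr (1 - 1 / q))"
  proof (cases "v = 0")
    case True
    then have "E \<in> null_sets haar" using v E by auto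
    then have "AE y in haar. y \<notin> E" by (rule AE_not_in)
    then have "(\<integral>\<^sup>+y. ?T (\<lambda>y. ennreal (G y)) y * indicator E y \<partial>haar) = (\<integral>\<^sup>+y. 0 \<partial>haar)"
      by (intro nn_integral_cong_AE) (auto elim!: eventually_mono)
    then show ?thesis by simp
  next
    case False
    then have v0: "v > 0" using v by simp
    \<comment> \<open>This height minimises A c^(1-q)/(q-1) + c v, the bound obtained below. At the
      minimum A c^(1-q) = c v, so the bound is q/(q-1) times c v.\<close>
    define c where "c = (A / v) powr (1 / q)"
    have c: "c > 0" using A v0 by (simp add: c_def)
    let ?g = "\<lambda>y. ennreal (max 0 (G y - c))"
    have gm: "?g \<in> borel_measurable borel" by measurable
    have Gm: "G \<in> borel_measurable haar" using G by (simp add: borel_measurable_haar)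
    \<comment> \<open>The constant survives translation because convolutions of points have mass 1.
      The excess is then integrated over all of K, where invariance removes x.\<close>
    have Tg: "?T (\<lambda>y. ennreal (G y)) y \<le> ?T ?g y + ennreal c" for y
    proof -
      have "?T (\<lambda>y. ennreal (G y)) y \<le> (\<integral>\<^sup>+z. ?g z + ennreal c \<partial>point_conv x y)"
        unfolding translation_eq
      proof (rule nn_integral_mono)
        fix z
        have "ennreal (G z) \<le> ennreal (max 0 (G z - c) + c)" by (rule ennreal_leI) simp
        also have "\<dots> = ?g z + ennreal c" using c by (intro ennreal_plus) auto
        finally show "ennreal (G z) \<le> ?g z + ennreal c" .
      qed
      also have "\<dots> = ?T ?g y + ennreal c"
        unfolding translation_eq using gm by (subst nn_integral_add) auto
      finally show ?thesis .
    qed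
    have Tm: "?T ?g \<in> borel_measurable haar" 
      using borel_measurable_translation[OF gm] by (simp add: borel_measurable_haar)
    have "(\<integral>\<^sup>+y. ?T (\<lambda>y. ennreal (G y)) y * indicator E y \<partial>haar) \<le> (\<integral>\<^sup>+y. ?T ?g y + ennreal c * indicator E y \<partial>haar)"
      using Tg by (intro nn_integral_mono) (auto simp: indicator_def)
    also have "\<dots> = (\<integral>\<^sup>+y. ?g y \<partial>haar) + ennreal c * ennreal v"
      using Tm E by (subst nn_integral_add) (auto simp: nn_integral_cmult haar_invariant[OF gm] v(1))
    also have "\<dots> \<le> ennreal (A * c powr (1 - q) / (q - 1)) + ennreal c * ennreal v"
      using dist by (intro add_right_mono nn_integral_excess_le[OF Gm q c A]) simp
    also have "\<dots> = ennreal (A * c powr (1 - q) / (q - 1) + c * v)"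
      using A c q v by (simp add: ennreal_mult)
    also have "A * c powr (1 - q) / (q - 1) + c * v = q / (q - 1) * A powr (1 / q) * v powr (1 - 1 / q)"
    proof -
      have "c powr q = A / v" using q A v0 by (simp add: c_def powr_powr)
      then have "A * c powr (1 - q) = c * v" using c A v0 by (simp add: powr_diff)
      moreover have "c * v = A powr (1 / q) * v powr (1 - 1 / q)"
        using A v0 by (simp add: c_def powr_divide powr_diff)
      moreover have "c * v / (q - 1) + c * v = q / (q - 1) * (c * v)" using q by (simp add: field_simps)
      ultimately show ?thesis by (simp add: mult.assoc)
    qed
    finally show ?thesis by (simp add: v_def)
  qed
qed

end

section \<open>The fractional integral\<close>

lemma measurable_completion_AE_eq:
  fixes f g :: "'a \<Rightarrow> 'b::topological_space"
  assumes f: "f \<in> borel_measurable M" and ae: "AE x in M. g x = f x"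
  shows "g \<in> borel_measurable (completion M)"
proof (rule measurableI)
  obtain Z where Z: "Z \<in> null_sets M" "{x \<in> space M. g x \<noteq> f x} \<subseteq> Z"
    using ae by (auto simp: eventually_ae_filter)
  fix A :: "'b set" assume A: "A \<in> sets borel"
  show "g -` A \<inter> space (completion M) \<in> sets (completion M)"
  proof (rule sets_completionI)
    show "g -` A \<inter> space (completion M) = (f -` A \<inter> space M - Z) \<union> (g -` A \<inter> Z)"
      using Z sets.sets_into_space[of Z M] by auto
    show "g -` A \<inter> Z \<subseteq> Z" by simp
    show "Z \<in> null_sets M" by fact
    show "f -` A \<inter> space M - Z \<in> sets M" using measurable_sets[OF f A] Z(1) by auto
  qed
qed simp

lemma completion_ex_borel_measurable_complex:
  fixes f :: "'a \<Rightarrow> complex"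
  assumes f[measurable]: "f \<in> borel_measurable (completion M)"
  obtains g where "g \<in> borel_measurable M" "AE x in M. f x = g x"
proof -
  obtain a where a: "a \<in> borel_measurable M" "AE x in M. Re (f x) = a x"
    using completion_ex_borel_measurable_real[of "\<lambda>x. Re (f x)" M] by auto
  obtain b where b: "b \<in> borel_measurable M" "AE x in M. Im (f x) = b x"
    using completion_ex_borel_measurable_real[of "\<lambda>x. Im (f x)" M] by auto
  show thesis
  proof (rule that[of "\<lambda>x. Complex (a x) (b x)"])
    have "(\<lambda>x. complex_of_real (a x) + \<i> * complex_of_real (b x)) \<in> borel_measurable M"
      using a(1) b(1) by measurable
    then show "(\<lambda>x. Complex (a x) (b x)) \<in> borel_measurable M" by (simp add: Complex_eq)
    show "AE x in M. f x = Complex (a x) (b x)"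
      using a(2) b(2) by eventually_elim (simp add: complex_eq_iff)
  qed
qed

lemma Lp_norm_le:
  fixes h :: "'a \<Rightarrow> complex"
  assumes h: "h \<in> borel_measurable (completion M)" and r: "r > 0" and B: "B \<ge> 0"
    and int: "(\<integral>\<^sup>+x. ennreal (norm (h x) powr r) \<partial>M) \<le> ennreal (B powr r)"
  shows "h \<in> Lp_space r M" "Lp_norm r M h \<le> B"
proof -
  have int': "(\<integral>\<^sup>+x. ennreal (norm (h x) powr r) \<partial>completion M) \<le> ennreal (B powr r)"
    using int by (simp add: nn_integral_completion)
  then show "h \<in> Lp_space r M" using h by (auto simp: Lp_space_def intro: le_less_trans)
  have "(LINT x|completion M. norm (h x) powr r) = enn2real (\<integral>\<^sup>+x. ennreal (norm (h x) powr r) \<partial>completion M)"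
    using h by (intro integral_eq_nn_integral) auto
  also have "\<dots> \<le> B powr r"
    using enn2real_mono[OF int'] by simp
  finally have "(LINT x|completion M. norm (h x) powr r) powr (1 / r) \<le> (B powr r) powr (1 / r)"
    using r by (intro powr_mono2) auto
  then show "Lp_norm r M h \<le> B" using r B by (simp add: Lp_norm_def powr_powr)
qed

lemma Lp_norm_nn_integral:
  assumes "f \<in> Lp_space p M" and p: "p > 0"
  shows "(\<integral>\<^sup>+x. ennreal (norm (f x) powr p) \<partial>M) = ennreal (Lp_norm p M f powr p)"
proof -
  have f: "f \<in> borel_measurable (completion M)"
    and fin: "(\<integral>\<^sup>+x. ennreal (norm (f x) powr p) \<partial>completion M) < \<infinity>"
    using assms by (auto simp: Lp_space_def)
  have i: "(LINT x|completion M. norm (f x) powr p) = enn2real (\<integral>\<^sup>+x. ennreal (norm (f x) powr p) \<partial>completion M)"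
    using f by (intro integral_eq_nn_integral) auto
  then have "Lp_norm p M f powr p = enn2real (\<integral>\<^sup>+x. ennreal (norm (f x) powr p) \<partial>completion M)"
    using p by (simp add: Lp_norm_def powr_powr)
  then show ?thesis using fin by (simp add: nn_integral_completion)
qed

text \<open>Since 1 - p\<theta> = p/r and 1 - s\<theta> = s/p' for the exponent p' conjugate to p,
  the left side is X + (p'/s)^(1-\<theta>), at most X + p', with X = (r/p)^(1-\<theta>). The right
  side is 3 p p' X, and p, p', X are all at least 1.\<close>

lemma fractional_constant_bound:
  fixes p r \<theta> s :: real
  assumes p: "1 < p" "p < r" and \<theta>: "\<theta> = 1 / p - 1 / r" and s: "s = r / (r - 1)"
  shows "(1 - p * \<theta>) powr (- (1 - \<theta>)) + (1 - s * \<theta>) powr (- (1 - \<theta>))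
    \<le> 3 * p * r / (p - 1) * (p / r) powr \<theta>"
proof -
  define p' where "p' = p / (p - 1)"
  have p': "p' \<ge> 1" using p by (simp add: p'_def)
  have r: "r > 1" using p by simp
  have \<theta>0: "\<theta> > 0" using p by (simp add: \<theta> field_simps)
  have \<theta>1: "\<theta> < 1"
  proof -
    have "1 / p < 1" "1 / r > 0" using p by auto
    then show ?thesis unfolding \<theta> by linarith
  qed
  define X where "X = (r / p) powr (1 - \<theta>)"
  have X: "X \<ge> 1" unfolding X_def using p \<theta>1 by (intro ge_one_powr_ge_zero) auto
  have "1 - p * \<theta> = p / r" using p by (simp add: \<theta> field_simps)
  then have 1: "(1 - p * \<theta>) powr (- (1 - \<theta>)) = X"
    using p by (simp only: powr_minus) (simp add: X_def powr_divide)
  have e: "1 - s * \<theta> = s / p'" using p r by (simp add: s p'_def \<theta> field_simps)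
  have sp: "p' / s \<ge> 1" using p by (simp add: s p'_def field_simps)
  have s1: "s \<ge> 1" using r by (simp add: s)
  have "(1 - s * \<theta>) powr (- (1 - \<theta>)) = (p' / s) powr (1 - \<theta>)"
    unfolding e using p' s1 by (simp only: powr_minus) (simp add: powr_divide)
  also have "\<dots> \<le> (p' / s) powr 1" using sp \<theta>0 by (intro powr_mono) auto
  also have "\<dots> \<le> p'" using sp s1 p' by (simp add: divide_le_eq)
  finally have 2: "(1 - s * \<theta>) powr (- (1 - \<theta>)) \<le> p'" .
  have 3: "3 * p * r / (p - 1) * (p / r) powr \<theta> = 3 * p' * p * X"
  proof -
    have "X = (r / p) * (p / r) powr \<theta>" unfolding X_def using p by (simp add: powr_diff powr_divide)
    then show ?thesis using p by (simp add: p'_def)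
  qed
  have "X \<le> p' * X" "p' \<le> p' * X" using mult_right_mono[of 1 p' X] mult_left_mono[of 1 X p'] p' X by simp_all
  moreover have "p' * X \<le> p' * X * p" using mult_left_mono[of 1 p "p' * X"] p p' X by simp
  ultimately show ?thesis unfolding 1 3 using 2 p' X by (simp only: mult.assoc mult.commute[of p X])
qed

theorem theorem4p4:
  fixes conv :: "('a::t2_space set \<Rightarrow> complex) \<Rightarrow> ('a set \<Rightarrow> complex) \<Rightarrow> ('a set \<Rightarrow> complex)"
    and e :: 'a and invol :: "'a \<Rightarrow> 'a"
    and haar :: "'a measure"
    and \<rho> :: "'a \<Rightarrow> 'a \<Rightarrow> real"
    and N A p \<alpha> r :: real
    and f :: "'a \<Rightarrow> complex"
  assumes "commutative_hypergroup conv e invol"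
    and "haar_measure conv haar"
    and "quasi_metric \<rho>"
    and "N > 0" and "A > 0"
    and "\<And>s. s > 0 \<Longrightarrow> quasi_ball \<rho> e s \<in> sets (completion haar)"
    and "\<And>s. s > 0 \<Longrightarrow>
           emeasure (completion haar) (quasi_ball \<rho> e s) = ennreal (A * s powr N)"
    and "1 < p" and "0 < \<alpha>" and "\<alpha> < N / p"
    and "1 / r = 1 / p - \<alpha> / N"
    and "f \<in> Lp_space p haar"
  shows "(AE x in completion haar. fractional_integral_defined conv e invol haar \<rho> N \<alpha> f x) \<and>
         fractional_integral conv e invol haar \<rho> N \<alpha> f \<in> Lp_space r haar \<and>
         Lp_norm r haar (fractional_integral conv e invol haar \<rho> N \<alpha> f)
           \<le> (3 * p * r / (p - 1)) * (p / r) powr (1 / p - 1 / r) * (N / \<alpha>)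
               * A powr ((N - \<alpha>) / N) * Lp_norm p haar f"
proof -
  note radon = assms(2)[unfolded haar_measure_def, THEN conjunct1]
  note balls = assms(6) and ball_measure = assms(7) and p = \<open>1 < p\<close> and \<alpha> = \<open>0 < \<alpha>\<close> and f = assms(12)
  note N = \<open>N > 0\<close> and A = \<open>A > 0\<close>
  have \<rho>: "0 \<le> \<rho> x y" "\<rho> x y = 0 \<longleftrightarrow> x = y" for x y
    using assms(3) by (auto simp: quasi_metric_def)
  have sets_haar: "sets haar = sets borel" using radon by (simp add: radon_measure_def)
  have space_haar: "space haar = UNIV" using sets_eq_imp_space_eq[OF sets_haar] by simp
  \<comment> \<open>The balls around \<open>e\<close> exhaust K. Each lies in a Borel set of the
    same finite measure, which outer regularity encloses in an open set of finite measure.\<close>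
  have cover: "\<exists>U :: nat \<Rightarrow> 'a set. (\<forall>n. open (U n) \<and> emeasure haar (U n) < \<infinity>) \<and> (\<Union>n. U n) = UNIV"
  proof -
    have "\<exists>U. open U \<and> quasi_ball \<rho> e (real (Suc n)) \<subseteq> U \<and> emeasure haar U < \<infinity>" for n
    proof -
      obtain B where B: "B \<in> sets haar" "quasi_ball \<rho> e (real (Suc n)) \<subseteq> B"
        "emeasure (completion haar) (quasi_ball \<rho> e (real (Suc n))) = emeasure haar B"
        using completion_upper[OF balls[of "real (Suc n)"]] by auto
      then have "emeasure haar B < \<infinity>" using ball_measure[of "real (Suc n)"] by simp
      moreover have "emeasure haar B = (INF U \<in> {U. open U \<and> B \<subseteq> U}. emeasure haar U)"
        using radon B(1) unfolding radon_measure_def sets_haar by blast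
      ultimately obtain U where "open U" "B \<subseteq> U" "emeasure haar U < \<infinity>"
        by (auto simp: INF_less_iff)
      then show ?thesis using B(2) by blast
    qed
    then obtain U where U: "\<And>n. open (U n) \<and> quasi_ball \<rho> e (real (Suc n)) \<subseteq> U n \<and> emeasure haar (U n) < \<infinity>"
      by metis
    moreover have "y \<in> (\<Union>n. U n)" for y
    proof -
      obtain n where "\<rho> e y < real n" using reals_Archimedean2 by blast
      then have "y \<in> quasi_ball \<rho> e (real (Suc n))" by (simp add: quasi_ball_def)
      then show ?thesis using U by blast
    qed
    ultimately show ?thesis by (intro exI[of _ U]) auto
  qed
  interpret H: commutative_hypergroup conv e invol by fact
  interpret commutative_hypergroup_haar conv e invol haar
    by unfold_locales (fact radon, fact cover, fact assms(2))
  \<comment> \<open>\<open>q\<close> is the weak exponent of the kernel and \<open>s\<close> is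
    conjugate to \<open>r\<close>. \<open>D\<close> comes from the weak-type bound, \<open>L\<close>
    from the estimate of the constant, and their product is the constant claimed.\<close>
  define q where "q = N / (N - \<alpha>)"
  define \<theta> where "\<theta> = \<alpha> / N"
  define D where "D = N / \<alpha> * A powr ((N - \<alpha>) / N)"
  define s where "s = r / (r - 1)"
  define L where "L = 3 * p * r / (p - 1) * (p / r) powr \<theta>"
  have "N / p < N" using p N by (simp add: divide_less_eq)
  then have \<alpha>N: "\<alpha> < N" using assms(10) by simp
  have \<theta>: "\<theta> = 1 / p - 1 / r" using assms(11) by (simp add: \<theta>_def)
  have r: "p < r"
  proof -
    have "\<alpha> / N < 1 / p" using assms(10) N by (simp add: field_simps)
    then have "1 / r > 0" "1 / r < 1 / p" using assms(11) \<alpha> N by auto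
    then show ?thesis using p by (simp add: field_simps)
  qed
  have q: "q > 1" "1 / q = (N - \<alpha>) / N" "1 - 1 / q = \<theta>" "q / (q - 1) = N / \<alpha>"
    using \<alpha> \<alpha>N N by (auto simp: q_def \<theta>_def field_simps)
  have D: "D > 0" using A N \<alpha> by (simp add: D_def)
  have L: "(1 - p * \<theta>) powr (- (1 - \<theta>)) + (1 - s * \<theta>) powr (- (1 - \<theta>)) \<le> L"
    unfolding L_def by (rule fractional_constant_bound[OF p r \<theta> s_def])
  have L0: "L \<ge> 0" using L by (smt (verit) powr_ge_zero)

  \<comment> \<open>{e} lies in a ball of arbitrarily small measure. Hence the value at
    \<open>e\<close> is immaterial: it is infinite for \<open>riesz_kernel\<close> and 0 for
    \<open>G0\<close>.\<close>
  have e_null: "{e} \<in> null_sets haar"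
  proof -
    have "emeasure haar {e} \<le> 0 + ennreal \<epsilon>" if "\<epsilon> > 0" for \<epsilon>
    proof -
      define t where "t = (\<epsilon> / A) powr (1 / N)"
      have t: "t > 0" using that A by (simp add: t_def)
      have "emeasure haar {e} = emeasure (completion haar) {e}" by (simp add: sets_haar)
      also have "\<dots> \<le> emeasure (completion haar) (quasi_ball \<rho> e t)"
        using balls[OF t] t \<rho>(2)[of e e] by (intro emeasure_mono) (auto simp: quasi_ball_def)
      also have "\<dots> = ennreal \<epsilon>" using ball_measure[OF t] that A N by (simp add: t_def powr_powr)
      finally show ?thesis by simp
    qed
    then have "emeasure haar {e} \<le> 0" by (rule ennreal_le_epsilon)
    then show ?thesis by (simp add: null_sets_def)
  qed

  define G0 where "G0 y = \<rho> e y powr (\<alpha> - N)" for y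
  \<comment> \<open>The exponent \<alpha> - N is negative, so superlevel sets are balls;
    \<open>e\<close> is taken out because 0 \<open>powr\<close> anything is 0.\<close>
  have G0_level: "{y. t < G0 y} = quasi_ball \<rho> e (t powr (1 / (\<alpha> - N))) - {e}" if "t > 0" for t
  proof -
    have "t < G0 y \<longleftrightarrow> \<rho> e y < t powr (1 / (\<alpha> - N))" if "y \<noteq> e" for y
    proof -
      have pos: "\<rho> e y > 0" using \<rho>[of e y] that by auto
      have "t < G0 y \<longleftrightarrow> (\<rho> e y powr (\<alpha> - N)) powr (1 / (\<alpha> - N)) < t powr (1 / (\<alpha> - N))"
      proof
        assume "t < G0 y"
        then show "(\<rho> e y powr (\<alpha> - N)) powr (1 / (\<alpha> - N)) < t powr (1 / (\<alpha> - N))"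
          unfolding G0_def using \<open>t > 0\<close> \<alpha>N by (intro powr_less_mono2_neg) auto
      next
        assume *: "(\<rho> e y powr (\<alpha> - N)) powr (1 / (\<alpha> - N)) < t powr (1 / (\<alpha> - N))"
        show "t < G0 y"
        proof (rule ccontr)
          assume "\<not> t < G0 y"
          then have "t powr (1 / (\<alpha> - N)) \<le> (\<rho> e y powr (\<alpha> - N)) powr (1 / (\<alpha> - N))"
            unfolding G0_def using pos \<alpha>N by (intro powr_mono2') auto
          then show False using * by simp
        qed
      qed
      also have "(\<rho> e y powr (\<alpha> - N)) powr (1 / (\<alpha> - N)) = \<rho> e y"
        using pos \<alpha>N by (simp add: powr_powr)
      finally show ?thesis .
    qed
    note level = this
    have "G0 e = 0" using \<rho>(2)[of e e] by (simp add: G0_def)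
    have "t < G0 y \<longleftrightarrow> y \<in> quasi_ball \<rho> e (t powr (1 / (\<alpha> - N))) - {e}" for y
      using level[of y] \<open>G0 e = 0\<close> that by (cases "y = e") (simp_all add: quasi_ball_def)
    then show ?thesis by blast
  qed
  have e_sets: "{e} \<in> sets (completion haar)" by (simp add: sets_haar)
  have "G0 \<in> borel_measurable (completion haar)"
  proof (rule borel_measurableI_greater)
    fix t :: real
    consider "t < 0" | "t = 0" | "t > 0" by linarith
    then show "{y \<in> space (completion haar). t < G0 y} \<in> sets (completion haar)"
    proof cases
      case 1
      then have "{y \<in> space (completion haar). t < G0 y} = space (completion haar)"
        by (auto simp: G0_def intro: less_le_trans)
      then show ?thesis by (metis sets.top)
    next
      case 2
      then have "{y \<in> space (completion haar). t < G0 y} = space (completion haar) - {e}"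
        using \<rho>(2)[of e] by (auto simp: G0_def)
      then show ?thesis using e_sets by auto
    next
      case 3
      then have "quasi_ball \<rho> e (t powr (1 / (\<alpha> - N))) - {e} \<in> sets (completion haar)"
        using e_sets by (intro sets.Diff balls) auto
      then show ?thesis using G0_level[OF 3] by (simp add: space_haar)
    qed
  qed
  \<comment> \<open>Balls are measurable for the completion only, so a Borel version replaces
    \<open>G0\<close> before translating.\<close>
  then obtain G where G: "G \<in> borel_measurable haar" "AE y in haar. G0 y = G y"
    using completion_ex_borel_measurable_real by blast
  have Gb: "G \<in> borel_measurable borel" using G(1) by (simp add: borel_measurable_haar)
  have G_dist: "emeasure haar {y. t < G y} \<le> ennreal (A * t powr (- q))" if t: "t > 0" for t
  proof -
    have Gs: "{y. t < G y} \<in> sets haar" using measurable_sets[OF Gb, of "{t<..}"] by (simp add: vimage_def)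
    have ball: "quasi_ball \<rho> e (t powr (1 / (\<alpha> - N))) \<in> sets (completion haar)" using t by (intro balls) simp
    have "emeasure haar {y. t < G y} = emeasure (completion haar) {y. t < G y}" using Gs by simp
    also have "\<dots> = emeasure (completion haar) (quasi_ball \<rho> e (t powr (1 / (\<alpha> - N))) - {e})"
    proof (rule emeasure_eq_AE)
      show "AE y in completion haar. y \<in> {y. t < G y} \<longleftrightarrow> y \<in> quasi_ball \<rho> e (t powr (1 / (\<alpha> - N))) - {e}"
        unfolding G0_level[OF t, symmetric] by (rule AE_completion) (use G(2) in eventually_elim, simp)
    qed (use Gs ball e_sets in auto)
    also have "\<dots> \<le> emeasure (completion haar) (quasi_ball \<rho> e (t powr (1 / (\<alpha> - N))))"
      using ball by (intro emeasure_mono) auto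
    also have "\<dots> = ennreal (A * (t powr (1 / (\<alpha> - N))) powr N)" using t by (intro ball_measure) simp
    also have "(t powr (1 / (\<alpha> - N))) powr N = t powr (- q)"
    proof -
      have "1 / (\<alpha> - N) * N = - q" using \<alpha>N by (simp add: q_def field_simps)
      then show ?thesis by (simp add: powr_powr)
    qed
    finally show ?thesis .
  qed
  have riesz_AE: "AE y in haar. riesz_kernel \<rho> e N \<alpha> y = ennreal (G y)"
    using G(2) AE_not_in[OF e_null]
    by eventually_elim (use \<rho>(2)[of e] in \<open>auto simp: riesz_kernel_def G0_def\<close>)
  \<comment> \<open>\<open>T\<close> translates the Riesz kernel itself, \<open>K\<close> its Borel
    version, and \<open>k\<close> will be measurable on the product. \<open>T x\<close> and
    \<open>K x\<close> agree a.e. for every x, \<open>k x\<close> and \<open>K x\<close> only for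
    almost every x.\<close>
  define K where "K x = translation conv x (\<lambda>y. ennreal (G y))" for x
  define T where "T x = translation conv x (riesz_kernel \<rho> e N \<alpha>)" for x
  have Gm: "(\<lambda>y. ennreal (G y)) \<in> borel_measurable borel" using Gb by measurable
  have Km: "K x \<in> borel_measurable haar" for x
    using borel_measurable_translation[OF Gm] by (simp add: K_def borel_measurable_haar)
  have TK: "AE y in haar. T x y = K x y" for x
    unfolding T_def K_def by (rule AE_translation_cong[OF riesz_AE])
  have Kweak: "weak_kernel haar D \<theta> (K x)" for x
  proof -
    have "q / (q - 1) * A powr (1 / q) = D" by (simp only: D_def q(2,4))
    moreover have "weak_kernel haar (q / (q - 1) * A powr (1 / q)) (1 - 1 / q) (translation conv x (\<lambda>y. ennreal (G y)))"
      by (rule translation_weak_kernel[OF Gb q(1) A]) (rule G_dist)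
    ultimately show ?thesis by (simp only: K_def q(3))
  qed
  obtain k where k: "product_version (\<lambda>x y. K x y) k"
    using good_kernel_translation[OF Gm] unfolding good_kernel_def K_def by blast
  have km[measurable]: "case_prod k \<in> borel_measurable (haar \<Otimes>\<^sub>M haar)" and ksym: "\<And>x y. k x y = k y x"
    and kK: "AE x in haar. AE y in haar. k x y = K x y"
    using k by (auto simp: product_version_def)
  have kxm: "k x \<in> borel_measurable haar" for x
    using measurable_Pair2[OF km, of x] by (simp add: space_haar)
  have weak1: "AE x in haar. weak_kernel haar D \<theta> (k x)"
    using kK
  proof eventually_elim
    case (elim x)
    have "(\<integral>\<^sup>+y. k x y * indicator E y \<partial>haar) = (\<integral>\<^sup>+y. K x y * indicator E y \<partial>haar)" for E
      by (intro nn_integral_cong_AE, use elim in eventually_elim) simp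
    then show ?case using Kweak[of x] kxm[of x] by (simp add: weak_kernel_def)
  qed
  have weak2: "AE y in haar. weak_kernel haar D \<theta> (\<lambda>x. k x y)"
    using weak1
  proof eventually_elim
    case (elim y)
    have "(\<lambda>x. k x y) = k y" using ksym by auto
    then show ?case using elim by simp
  qed

  have fc: "f \<in> borel_measurable (completion haar)" using f by (simp add: Lp_space_def)
  obtain f' where f': "f' \<in> borel_measurable haar" "AE x in haar. f x = f' x"
    using completion_ex_borel_measurable_complex[OF fc] by blast
  \<comment> \<open>The involution preserves null sets, so a Borel version of \<open>f\<close>
    remains one after composition with it.\<close>
  define \<phi> where "\<phi> y = f' (invol y)" for y
  have \<phi>m[measurable]: "\<phi> \<in> borel_measurable haar" unfolding \<phi>_def using f'(1) by measurable
  have f\<phi>: "AE y in haar. f (invol y) = \<phi> y" unfolding \<phi>_def by (rule AE_invol[OF f'(2)])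
  have fi: "(\<lambda>y. f (invol y)) \<in> borel_measurable (completion haar)"
    by (rule measurable_completion_AE_eq[OF \<phi>m f\<phi>])
  have Tm: "T x \<in> borel_measurable (completion haar)" for x
    by (rule measurable_completion_AE_eq[OF Km TK])
  have \<phi>_int: "(\<integral>\<^sup>+y. ennreal (norm (\<phi> y) powr p) \<partial>haar) = ennreal (Lp_norm p haar f powr p)"
  proof -
    have [measurable]: "f' \<in> borel_measurable borel" using f'(1) by (simp add: borel_measurable_haar)
    have "(\<integral>\<^sup>+y. ennreal (norm (\<phi> y) powr p) \<partial>haar) = (\<integral>\<^sup>+y. ennreal (norm (f' y) powr p) \<partial>haar)"
      unfolding \<phi>_def by (rule nn_integral_invol[of "\<lambda>y. ennreal (norm (f' y) powr p)"]) measurable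
    also have "\<dots> = (\<integral>\<^sup>+y. ennreal (norm (f y) powr p) \<partial>haar)"
      by (intro nn_integral_cong_AE, use f'(2) in eventually_elim) simp
    also have "\<dots> = ennreal (Lp_norm p haar f powr p)"
      using f p by (intro Lp_norm_nn_integral) auto
    finally show ?thesis .
  qed
  define h where "h x = (\<integral>\<^sup>+y. k x y * ennreal (norm (\<phi> y)) \<partial>haar)" for x
  have Tk: "AE x in haar. AE y in haar. T x y = k x y"
    using kK
  proof eventually_elim
    case (elim x)
    show ?case using elim TK[of x] by eventually_elim simp
  qed
  define I where "I = fractional_integral conv e invol haar \<rho> N \<alpha> f"
  \<comment> \<open>Built from \<open>k\<close>, hence measurable as a parametric integral;
    \<open>I\<close> inherits measurability through a.e. equality.\<close>
  define I' where "I' x = (LINT y|haar. complex_of_real (enn2real (k x y)) * \<phi> y)" for x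
  have I'm: "I' \<in> borel_measurable haar" unfolding I'_def by measurable
  have II': "AE x in haar. I x = I' x"
    using Tk
  proof eventually_elim
    case (elim x)
    have m: "(\<lambda>y. complex_of_real (enn2real (k x y)) * \<phi> y) \<in> borel_measurable haar"
      using kxm[of x] by measurable
    have "I x = (LINT y|completion haar. complex_of_real (enn2real (T x y)) * f (invol y))"
      by (simp add: I_def fractional_integral_def T_def)
    also have "\<dots> = (LINT y|completion haar. complex_of_real (enn2real (k x y)) * \<phi> y)"
    proof (rule integral_cong_AE)
      show "(\<lambda>y. complex_of_real (enn2real (T x y)) * f (invol y)) \<in> borel_measurable (completion haar)"
        using Tm[of x] fi by measurable
      show "(\<lambda>y. complex_of_real (enn2real (k x y)) * \<phi> y) \<in> borel_measurable (completion haar)"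
        by (rule measurable_completion[OF m])
      show "AE y in completion haar. complex_of_real (enn2real (T x y)) * f (invol y) = complex_of_real (enn2real (k x y)) * \<phi> y"
        by (rule AE_completion) (use elim f\<phi> in eventually_elim, simp)
    qed
    also have "\<dots> = I' x" unfolding I'_def by (rule integral_completion[OF m])
    finally show ?case .
  qed
  have Im: "I \<in> borel_measurable (completion haar)" by (rule measurable_completion_AE_eq[OF I'm II'])
  \<comment> \<open>This holds at every x: without integrability the Bochner integral is 0 by
    default.\<close>
  have I'h: "ennreal (norm (I' x)) \<le> h x" for x
  proof (cases "integrable haar (\<lambda>y. complex_of_real (enn2real (k x y)) * \<phi> y)")
    case True
    then have "ennreal (norm (I' x)) \<le> (\<integral>\<^sup>+y. ennreal (norm (complex_of_real (enn2real (k x y)) * \<phi> y)) \<partial>haar)"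
      unfolding I'_def by (rule integral_norm_bound_ennreal)
    also have "\<dots> \<le> h x"
      unfolding h_def
    proof (rule nn_integral_mono)
      fix y
      have "ennreal (enn2real (k x y)) \<le> k x y" by (cases "k x y") auto
      then show "ennreal (norm (complex_of_real (enn2real (k x y)) * \<phi> y)) \<le> k x y * ennreal (norm (\<phi> y))"
        by (simp add: norm_mult ennreal_mult mult_right_mono)
    qed
    finally show ?thesis .
  next
    case False
    then show ?thesis by (simp add: I'_def not_integrable_integral_eq)
  qed
  \<comment> \<open>Normalising by a number \<open>a\<close> strictly above the norm of
    \<open>f\<close> avoids dividing by 0 when \<open>f\<close> vanishes a.e.; \<open>a\<close> is
    lowered to the norm at the end.\<close>
  have main: "(AE x in haar. h x < \<infinity>) \<and> (\<integral>\<^sup>+x. ennreal (norm (I x) powr r) \<partial>haar) \<le> ennreal ((D * L * a) powr r)"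
    if a: "a > Lp_norm p haar f" for a
  proof -
    have nf: "Lp_norm p haar f \<ge> 0" by (simp add: Lp_norm_def)
    have a0: "a > 0" using a nf by simp
    define F where "F y = norm (\<phi> y) / a" for y
    have Fm[measurable]: "F \<in> borel_measurable haar" unfolding F_def by measurable
    have F0: "0 \<le> F y" for y using a0 by (simp add: F_def)
    have Fint: "(\<integral>\<^sup>+y. ennreal (F y powr p) \<partial>haar) \<le> 1"
    proof -
      have "(\<integral>\<^sup>+y. ennreal (F y powr p) \<partial>haar) = (\<integral>\<^sup>+y. ennreal (norm (\<phi> y) powr p) * ennreal (inverse (a powr p)) \<partial>haar)"
      proof (intro nn_integral_cong)
        fix y
        have "F y powr p = norm (\<phi> y) powr p * inverse (a powr p)"
          using a0 unfolding F_def by (subst powr_divide) (auto simp: divide_inverse)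
        then show "ennreal (F y powr p) = ennreal (norm (\<phi> y) powr p) * ennreal (inverse (a powr p))"
          by (simp flip: ennreal_mult)
      qed
      also have "\<dots> = ennreal (Lp_norm p haar f powr p) * ennreal (inverse (a powr p))"
        by (subst nn_integral_multc) (auto simp: \<phi>_int)
      also have "\<dots> = ennreal (Lp_norm p haar f powr p / a powr p)"
        by (simp add: divide_inverse flip: ennreal_mult)
      also have "\<dots> \<le> ennreal 1"
        using a a0 nf p by (intro ennreal_leI) (simp add: powr_mono2)
      finally show ?thesis by simp
    qed
    note strong = weak_kernel_strong_type[OF km less_imp_le[OF D] weak1 weak2 Fm F0 Fint p r \<theta> s_def L]
    have hF: "h x = ennreal a * (\<integral>\<^sup>+y. k x y * ennreal (F y) \<partial>haar)" for x
    proof -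
      have "ennreal a * (\<integral>\<^sup>+y. k x y * ennreal (F y) \<partial>haar) = (\<integral>\<^sup>+y. ennreal a * (k x y * ennreal (F y)) \<partial>haar)"
        using kxm[of x] Fm borel_measurable_haar by (intro nn_integral_cmult[symmetric]) auto
      also have "\<dots> = h x"
        unfolding h_def
      proof (rule nn_integral_cong)
        fix y
        have "ennreal a * ennreal (F y) = ennreal (norm (\<phi> y))"
          using a0 by (simp add: F_def flip: ennreal_mult)
        then show "ennreal a * (k x y * ennreal (F y)) = k x y * ennreal (norm (\<phi> y))"
          by (metis mult.left_commute)
      qed
      finally show ?thesis by simp
    qed
    have hfin: "AE x in haar. h x < \<infinity>"
      using strong(1) by eventually_elim (simp add: hF ennreal_mult_less_top)
    have "(\<integral>\<^sup>+x. ennreal (norm (I x) powr r) \<partial>haar)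
        \<le> (\<integral>\<^sup>+x. ennreal (a powr r) * ennreal (enn2real (\<integral>\<^sup>+y. k x y * ennreal (F y) \<partial>haar) powr r) \<partial>haar)"
    proof (rule nn_integral_mono_AE, use II' hfin in eventually_elim)
      case (elim x)
      have "norm (I x) \<le> enn2real (h x)"
        using enn2real_mono[OF I'h[of x]] elim by simp
      also have "enn2real (h x) = a * enn2real (\<integral>\<^sup>+y. k x y * ennreal (F y) \<partial>haar)"
        using a0 by (simp add: hF enn2real_mult)
      finally have "norm (I x) powr r \<le> (a * enn2real (\<integral>\<^sup>+y. k x y * ennreal (F y) \<partial>haar)) powr r"
        using r p by (intro powr_mono2) auto
      then show ?case using a0 by (simp add: powr_mult ennreal_leI flip: ennreal_mult)
    qed
    also have "\<dots> = ennreal (a powr r) * (\<integral>\<^sup>+x. ennreal (enn2real (\<integral>\<^sup>+y. k x y * ennreal (F y) \<partial>haar) powr r) \<partial>haar)"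
      using Fm by (intro nn_integral_cmult) measurable
    also have "\<dots> \<le> ennreal (a powr r) * ennreal ((D * L) powr r)"
      by (intro mult_left_mono strong(2)) simp
    also have "\<dots> = ennreal ((D * L * a) powr r)"
      using a0 D L0 by (simp add: powr_mult mult_ac flip: ennreal_mult)
    finally show ?thesis using hfin by simp
  qed
  have r0: "r > 0" using p r by simp
  have nf: "Lp_norm p haar f \<ge> 0" by (simp add: Lp_norm_def)
  have norm_le: "Lp_norm r haar I \<le> D * L * a" and I_Lp: "I \<in> Lp_space r haar" if "a > Lp_norm p haar f" for a
    using Lp_norm_le[OF Im r0 _ conjunct2[OF main[OF that]]] D L0 nf that by auto
  have "Lp_norm r haar I \<le> D * L * Lp_norm p haar f"
  proof (rule field_le_epsilon)
    fix \<epsilon> :: real assume \<epsilon>: "\<epsilon> > 0"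
    \<comment> \<open>The excess is multiplied by D L and then stays below \<epsilon>; the summand 1
      keeps the denominator positive.\<close>
    define a where "a = Lp_norm p haar f + \<epsilon> / (D * L + 1)"
    have DL: "D * L \<ge> 0" using D L0 by simp
    have "a > Lp_norm p haar f" using \<epsilon> DL by (simp add: a_def)
    then have "Lp_norm r haar I \<le> D * L * a" by (rule norm_le)
    also have "\<dots> = D * L * Lp_norm p haar f + D * L * \<epsilon> / (D * L + 1)" by (simp add: a_def distrib_left)
    also have "D * L * \<epsilon> / (D * L + 1) \<le> \<epsilon>" using \<epsilon> DL by (simp add: divide_le_eq algebra_simps)
    finally show "Lp_norm r haar I \<le> D * L * Lp_norm p haar f + \<epsilon>" by simp
  qed
  moreover have "D * L = 3 * p * r / (p - 1) * (p / r) powr (1 / p - 1 / r) * (N / \<alpha>) * A powr ((N - \<alpha>) / N)"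
    by (simp add: D_def L_def \<theta>[symmetric] mult_ac)
  moreover have "AE x in completion haar. fractional_integral_defined conv e invol haar \<rho> N \<alpha> f x"
  proof (rule AE_completion)
    \<comment> \<open>Finiteness of \<open>h\<close> is absolute convergence of the defining
      integral, since \<open>T x\<close> and \<open>k x\<close>, as well as \<open>\<phi>\<close>
      and the reflected \<open>f\<close>, agree a.e.\<close>
    have "AE x in haar. h x < \<infinity>" using main[of "Lp_norm p haar f + 1"] by simp
    with Tk show "AE x in haar. fractional_integral_defined conv e invol haar \<rho> N \<alpha> f x"
    proof eventually_elim
      case (elim x)
      have "(\<integral>\<^sup>+y. T x y * ennreal (norm (f (invol y))) \<partial>haar) = h x"
        unfolding h_def by (intro nn_integral_cong_AE, use elim(1) f\<phi> in eventually_elim) simp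
      then show ?case
        using elim(2) Tm[of x] fi by (simp add: fractional_integral_defined_def nn_integral_completion T_def[symmetric])
    qed
  qed
  ultimately show ?thesis
    using I_Lp[of "Lp_norm p haar f + 1"] unfolding I_def by simp
qed

end
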